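(* Let $d,k\in\mathbb{N}$, let $G\subset\mathbb{R}^d$ be a bounded domain, and let $\tau>0$, $T>0$. Let $\mathbf{F}\colon\mathbb{R}^{k\times d}\to\mathcal{S}_{\ge 0}(\mathbb{R}^{k\times d})$ be weakly differentiable such that $\mathbf{F}$ together with its weak Jacobian are essentially bounded by a number $c>0$. Let $\tilde{\mathbf{u}}^0\in\mathcal{H}$ and $\tilde{\mathbf{H}}^0\in L^\infty(G,\mathcal{S}(\mathbb{R}^{k\times d}))$, and let $(\mathbf{u}_1,\mathbf{H}_1)^T$, $(\mathbf{u}_2,\mathbf{H}_2)^T$ be two weak solutions on $[0,T]$ of $$\partial_t\mathbf{u}+\mathcal{A}(\mathbf{H})\mathbf{u}=0\ \text{ in } L^2(0,T;\mathcal{V}'),$$ $$\tau\partial_t\mathbf{H}+\mathbf{H}-\mathbf{F}(\nabla\mathbf{u})=0\ \text{ in } L^2\big(0,T;L^\infty(G,\mathcal{S}(\mathbb{R}^{k\times d}))\big),$$ $$\mathbf{u}(0,\cdot)=\tilde{\mathbf{u}}^0\ \text{ in }\mathcal{H},\qquad \mathbf{H}(0,\cdot)=\tilde{\mathbf{H}}^0\ \text{ in } L^\infty(G,\mathcal{S}(\mathbb{R}^{k\times d}))$$ such that $\nabla\mathbf{u}_1,\nabla\mathbf{u}_2\in L^\infty\big((0,T)\times G,\mathbb{R}^{k\times d}\big)$. Then $\mathbf{u}_1\equiv\mathbf{u}_2$ a.e. in $(0,T)\times G$.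
   Context: $\mathbb{R}^{k\times d}$ carries the Frobenius scalar product $\mathbf{D}:\hat{\mathbf{D}}=\sum_{i,j}D_{ij}\hat D_{ij}$. A fourth-order tensor $\mathbf{H}=(H_{ijIJ})\in\mathbb{R}^{(k\times d)\times(k\times d)}$ ($i,I=1,\dots,k$; $j,J=1,\dots,d$) acts on $\mathbf{D}\in\mathbb{R}^{k\times d}$ by $(\mathbf{H}\mathbf{D})_{ij}=\sum_{I=1}^k\sum_{J=1}^d H_{ijIJ}D_{IJ}$; the space of tensors carries the Frobenius norm. $\mathcal{S}(\mathbb{R}^{k\times d})$ is the space of symmetric tensors ($H_{ijIJ}=H_{IJij}$), and for $\kappa\ge 0$, $\mathcal{S}_{\ge\kappa}(\mathbb{R}^{k\times d})$ is the set of $\mathbf{H}\in\mathcal{S}(\mathbb{R}^{k\times d})$ with smallest eigenvalue $\ge\kappa$, i.e. $(\mathbf{H}\mathbf{D}):\mathbf{D}\ge\kappa\,\mathbf{D}:\mathbf{D}$ for all $\mathbf{D}$. $L^\infty(G,\mathcal{S}_{\ge\kappa}(\mathbb{R}^{k\times d}))$ is the set of $\mathbf{H}\in L^\infty(G,\mathcal{S}(\mathbb{R}^{k\times d}))$ with $\mathbf{H}(\mathbf{x})\in\mathcal{S}_{\ge\kappa}(\mathbb{R}^{k\times d})$ for a.e. $\mathbf{x}\in G$. $\mathcal{H}:=\{\mathbf{u}\in L^2(G,\mathbb{R}^k)\mid\int_G\mathbf{u}\,\mathrm{d}\mathbf{x}=\mathbf{0}\}$, $\mathcal{V}:=H^1(G,\mathbb{R}^k)\cap\mathcal{H}$,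 and $\mathcal{V}'$ is the dual of $\mathcal{V}$ in the Gelfand triple $(\mathcal{V},\mathcal{H},\mathcal{V}')$. For $\mathbf{H}\in L^\infty(G,\mathcal{S}_{\ge\kappa}(\mathbb{R}^{k\times d}))$ with $\kappa>0$, the operator $\mathcal{A}(\mathbf{H})\colon\mathcal{V}\to\mathcal{V}'$ is given by $\langle\mathcal{A}(\mathbf{H})\mathbf{u},\mathbf{v}\rangle_{\mathcal{V}';\mathcal{V}}=\int_G(\mathbf{H}\nabla\mathbf{u}):(\nabla\mathbf{v})\,\mathrm{d}\mathbf{x}$, with $\nabla\mathbf{u}=(\partial_{x_j}u_i)_{ij}$ the Jacobian. $\mathbf{F}$ is identified with its Lipschitz continuous representative. Weak solution on $[0,T]$: a pair $(\mathbf{u},\mathbf{H})^T$ for which there is a number $\kappa>0$ with $\mathbf{H}\in\mathcal{S}_{\ge\kappa}(\mathbb{R}^{k\times d})$ a.e. in $(0,T)\times G$, with $$\mathbf{u}\in H^1(0,T;\mathcal{V}')\cap L^2(0,T;\mathcal{V}),\qquad \mathbf{H}\in H^1\big(0,T;L^\infty(G,\mathcal{S}(\mathbb{R}^{k\times d}))\big),$$ fulfilling the two differential equations and the initial conditions, the initial value of $\mathbf{u}$ being understood via the embedding $L^2(0,T;\mathcal{V})\cap H^1(0,T;\mathcal{V}')\hookrightarrow C^0([0,T],\mathcal{H})$. *)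

theory Defs
  imports "HOL-Analysis.Analysis" "HOL-Probability.Essential_Supremum"
begin

text \<open>
  Matrices have type \<open>real^'d^'k\<close> and are indexed as \<open>D $ i $ j\<close>; tensors have type
  \<open>real^'d^'k^'d^'k\<close> and are indexed as \<open>H $ i $ j $ I $ J\<close>. On these nested vector types the
  library's \<^const>\<open>inner\<close> and \<^const>\<open>norm\<close> are the Frobenius product and the Frobenius norm.
\<close>

type_synonym ('k, 'd) matr = "real^'d^'k"
type_synonym ('k, 'd) tensor = "real^'d^'k^'d^'k"

definition tensor_app :: "('k::finite, 'd::finite) tensor \<Rightarrow> ('k, 'd) matr \<Rightarrow> ('k, 'd) matr" where
  "tensor_app H D = (\<chi> i j. \<Sum>I\<in>UNIV. \<Sum>J\<in>UNIV. H $ i $ j $ I $ J * D $ I $ J)"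

definition sym_tensors :: "('k::finite, 'd::finite) tensor set" where
  "sym_tensors = {H. \<forall>i j I J. H $ i $ j $ I $ J = H $ I $ J $ i $ j}"

definition sym_tensors_ge :: "real \<Rightarrow> ('k::finite, 'd::finite) tensor set" where
  "sym_tensors_ge \<kappa> = {H \<in> sym_tensors. \<forall>D. tensor_app H D \<bullet> D \<ge> \<kappa> * (D \<bullet> D)}"

primrec Ck :: "nat \<Rightarrow> ('a::euclidean_space \<Rightarrow> real) \<Rightarrow> bool" where
  "Ck 0 f \<longleftrightarrow> continuous_on UNIV f"
| "Ck (Suc n) f \<longleftrightarrow> (\<forall>x. f differentiable (at x)) \<and>
     (\<forall>e\<in>Basis. Ck n (\<lambda>x. frechet_derivative f (at x) e))"

definition test_function :: "'a::euclidean_space set \<Rightarrow> ('a \<Rightarrow> real) \<Rightarrow> bool" where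
  "test_function S \<phi> \<longleftrightarrow> (\<forall>n. Ck n \<phi>) \<and>
     compact (closure {x. \<phi> x \<noteq> 0}) \<and> closure {x. \<phi> x \<noteq> 0} \<subseteq> S"

definition locally_integrable ::
    "'a::euclidean_space set \<Rightarrow> ('a \<Rightarrow> 'b::euclidean_space) \<Rightarrow> bool" where
  "locally_integrable S f \<longleftrightarrow> (\<forall>K. compact K \<longrightarrow> K \<subseteq> S \<longrightarrow> f absolutely_integrable_on K)"

definition has_weak_partial ::
    "'a::euclidean_space set \<Rightarrow> ('a \<Rightarrow> 'b::euclidean_space) \<Rightarrow> 'a \<Rightarrow> ('a \<Rightarrow> 'b) \<Rightarrow> bool" where
  "has_weak_partial S f e g \<longleftrightarrow> locally_integrable S f \<and> locally_integrable S g \<and>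
     (\<forall>\<phi>. test_function S \<phi> \<longrightarrow>
        (\<integral>x. frechet_derivative \<phi> (at x) e *\<^sub>R f x \<partial>(lebesgue_on S)) =
        - (\<integral>x. \<phi> x *\<^sub>R g x \<partial>(lebesgue_on S)))"

text \<open>The Jacobian matrix has the entries \<open>J x $ i $ j = \<partial>\<^sub>j f\<^sub>i\<close>.\<close>

definition has_weak_jacobian ::
    "(real^'d::finite) set \<Rightarrow> (real^'d \<Rightarrow> real^'k::finite) \<Rightarrow> (real^'d \<Rightarrow> ('k, 'd) matr) \<Rightarrow> bool" where
  "has_weak_jacobian G f J \<longleftrightarrow>
     (\<forall>j. has_weak_partial G f (axis j 1) (\<lambda>x. \<chi> i. J x $ i $ j))"

text \<open>Weak Jacobians are unique only up to null sets; this picks one representative.\<close>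

definition weak_jacobian ::
    "(real^'d::finite) set \<Rightarrow> (real^'d \<Rightarrow> real^'k::finite) \<Rightarrow> real^'d \<Rightarrow> ('k, 'd) matr" where
  "weak_jacobian G f = (SOME J. has_weak_jacobian G f J)"

text \<open>
  For a tensor-valued function of a matrix, \<open>DF X $ I $ J\<close> is the tensor of the derivatives with
  respect to the matrix entry \<open>X $ I $ J\<close>.
\<close>

definition has_weak_jacobian_matr ::
    "(('k::finite, 'd::finite) matr \<Rightarrow> ('k, 'd) tensor) \<Rightarrow>
     (('k, 'd) matr \<Rightarrow> ('k, 'd) tensor^'d^'k) \<Rightarrow> bool" where
  "has_weak_jacobian_matr F DF \<longleftrightarrow>
     (\<forall>I J. has_weak_partial UNIV F (axis I (axis J 1)) (\<lambda>X. DF X $ I $ J))"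

text \<open>
  Elements of the spaces below are functions rather than classes of functions, so the norms are
  seminorms, and equality in a space is equality up to seminorm zero (almost everywhere).
\<close>

definition L2_space :: "'a::euclidean_space set \<Rightarrow> ('a \<Rightarrow> 'b::euclidean_space) set" where
  "L2_space G = {f \<in> borel_measurable (lebesgue_on G).
     integrable (lebesgue_on G) (\<lambda>x. (norm (f x))\<^sup>2)}"

definition L2_norm :: "'a::euclidean_space set \<Rightarrow> ('a \<Rightarrow> 'b::euclidean_space) \<Rightarrow> real" where
  "L2_norm G f = sqrt (\<integral>x. (norm (f x))\<^sup>2 \<partial>(lebesgue_on G))"

definition Linf_space :: "'a::euclidean_space set \<Rightarrow> 'b::euclidean_space set \<Rightarrow> ('a \<Rightarrow> 'b) set" where
  "Linf_space G S = {f \<in> borel_measurable (lebesgue_on G).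
     (\<exists>C. AE x in lebesgue_on G. norm (f x) \<le> C) \<and> (AE x in lebesgue_on G. f x \<in> S)}"

definition Linf_norm :: "'a::euclidean_space set \<Rightarrow> ('a \<Rightarrow> 'b::euclidean_space) \<Rightarrow> real" where
  "Linf_norm G f = real_of_ereal (esssup (lebesgue_on G) (\<lambda>x. ereal (norm (f x))))"

definition H1_space :: "(real^'d::finite) set \<Rightarrow> (real^'d \<Rightarrow> real^'k::finite) set" where
  "H1_space G = {f \<in> L2_space G. \<exists>J. has_weak_jacobian G f J \<and> J \<in> L2_space G}"

definition H1_norm :: "(real^'d::finite) set \<Rightarrow> (real^'d \<Rightarrow> real^'k::finite) \<Rightarrow> real" where
  "H1_norm G f = sqrt ((L2_norm G f)\<^sup>2 + (L2_norm G (weak_jacobian G f))\<^sup>2)"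

definition H_space :: "(real^'d::finite) set \<Rightarrow> (real^'d \<Rightarrow> real^'k::finite) set" where
  "H_space G = {f \<in> L2_space G. (\<integral>x. f x \<partial>(lebesgue_on G)) = 0}"

definition V_space :: "(real^'d::finite) set \<Rightarrow> (real^'d \<Rightarrow> real^'k::finite) set" where
  "V_space G = H1_space G \<inter> H_space G"

definition V_dual ::
    "(real^'d::finite) set \<Rightarrow> ((real^'d \<Rightarrow> real^'k::finite) \<Rightarrow> real) set" where
  "V_dual G = {l.
     (\<forall>f\<in>V_space G. \<forall>g\<in>V_space G. \<forall>a b.
        l (\<lambda>x. a *\<^sub>R f x + b *\<^sub>R g x) = a * l f + b * l g) \<and>
     (\<exists>C. \<forall>f\<in>V_space G. \<bar>l f\<bar> \<le> C * H1_norm G f)}"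

definition V_dual_norm ::
    "(real^'d::finite) set \<Rightarrow> ((real^'d \<Rightarrow> real^'k::finite) \<Rightarrow> real) \<Rightarrow> real" where
  "V_dual_norm G l = (SUP f\<in>{f \<in> V_space G. H1_norm G f \<le> 1}. \<bar>l f\<bar>)"

text \<open>The embedding of the pivot space \<open>H\<close> into \<open>V'\<close> in the Gelfand triple.\<close>

definition gelfand_embed ::
    "(real^'d::finite) set \<Rightarrow> (real^'d \<Rightarrow> real^'k::finite) \<Rightarrow> (real^'d \<Rightarrow> real^'k) \<Rightarrow> real" where
  "gelfand_embed G f = (\<lambda>v. \<integral>x. f x \<bullet> v x \<partial>(lebesgue_on G))"

definition A_op ::
    "(real^'d::finite) set \<Rightarrow> (real^'d \<Rightarrow> ('k::finite, 'd) tensor) \<Rightarrow>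
     (real^'d \<Rightarrow> real^'k) \<Rightarrow> (real^'d \<Rightarrow> real^'k) \<Rightarrow> real" where
  "A_op G H f = (\<lambda>v. \<integral>x. tensor_app (H x) (weak_jacobian G f x) \<bullet> weak_jacobian G v x
     \<partial>(lebesgue_on G))"

text \<open>
  The library's Bochner integral needs a separable Banach space that is a type. The spaces above
  depend on the domain and \<open>L\<^sup>\<infinity>\<close> is not separable, so the same construction by simple functions is
  carried out for a set \<open>X\<close> of functions with pointwise operations and a seminorm \<open>N\<close> on it
  (the dual space consists of functions as well). The measure \<open>M\<close> is assumed to be finite.
\<close>

definition simple_into :: "'t measure \<Rightarrow> 'x set \<Rightarrow> ('t \<Rightarrow> 'x) \<Rightarrow> bool" where
  "simple_into M X s \<longleftrightarrow> simple_function M s \<and> s ` space M \<subseteq> X"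

definition simple_integral_into ::
    "'t measure \<Rightarrow> ('t \<Rightarrow> 'p \<Rightarrow> 'b::real_normed_vector) \<Rightarrow> 'p \<Rightarrow> 'b" where
  "simple_integral_into M s = (\<lambda>p. \<Sum>y\<in>s ` space M. measure M (s -` {y} \<inter> space M) *\<^sub>R y p)"

definition strongly_measurable ::
    "'t measure \<Rightarrow> ('p \<Rightarrow> 'b::real_normed_vector) set \<Rightarrow> (('p \<Rightarrow> 'b) \<Rightarrow> real) \<Rightarrow>
     ('t \<Rightarrow> 'p \<Rightarrow> 'b) \<Rightarrow> bool" where
  "strongly_measurable M X N f \<longleftrightarrow> (AE t in M. f t \<in> X) \<and>
     (\<exists>s. (\<forall>n. simple_into M X (s n)) \<and>
          (AE t in M. (\<lambda>n. N (\<lambda>p. f t p - s n t p)) \<longlonglongrightarrow> 0))"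

definition has_bochner_integral_in ::
    "'t measure \<Rightarrow> ('p \<Rightarrow> 'b::real_normed_vector) set \<Rightarrow> (('p \<Rightarrow> 'b) \<Rightarrow> real) \<Rightarrow>
     ('t \<Rightarrow> 'p \<Rightarrow> 'b) \<Rightarrow> ('p \<Rightarrow> 'b) \<Rightarrow> bool" where
  "has_bochner_integral_in M X N f y \<longleftrightarrow> strongly_measurable M X N f \<and> y \<in> X \<and>
     (\<exists>s. (\<forall>n. simple_into M X (s n)) \<and>
          (\<lambda>n. \<integral>\<^sup>+ t. ennreal (N (\<lambda>p. f t p - s n t p)) \<partial>M) \<longlonglongrightarrow> 0 \<and>
          (\<lambda>n. N (\<lambda>p. simple_integral_into M (s n) p - y p)) \<longlonglongrightarrow> 0)"

definition bochner_L2 ::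
    "real \<Rightarrow> ('p \<Rightarrow> 'b::real_normed_vector) set \<Rightarrow> (('p \<Rightarrow> 'b) \<Rightarrow> real) \<Rightarrow>
     (real \<Rightarrow> 'p \<Rightarrow> 'b) set" where
  "bochner_L2 T X N = {f. strongly_measurable (lebesgue_on {0<..<T}) X N f \<and>
     integrable (lebesgue_on {0<..<T}) (\<lambda>t. (N (f t))\<^sup>2)}"

text \<open>\<open>f \<in> H\<^sup>1(0,T;X)\<close> with weak time derivative \<open>g\<close>:\<close>

definition bochner_H1_deriv ::
    "real \<Rightarrow> ('p \<Rightarrow> 'b::real_normed_vector) set \<Rightarrow> (('p \<Rightarrow> 'b) \<Rightarrow> real) \<Rightarrow>
     (real \<Rightarrow> 'p \<Rightarrow> 'b) \<Rightarrow> (real \<Rightarrow> 'p \<Rightarrow> 'b) \<Rightarrow> bool" where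
  "bochner_H1_deriv T X N f g \<longleftrightarrow> f \<in> bochner_L2 T X N \<and> g \<in> bochner_L2 T X N \<and>
     (\<forall>\<phi>. test_function {0<..<T} \<phi> \<longrightarrow>
        (\<exists>y. has_bochner_integral_in (lebesgue_on {0<..<T}) X N (\<lambda>t p. deriv \<phi> t *\<^sub>R f t p) y \<and>
             has_bochner_integral_in (lebesgue_on {0<..<T}) X N (\<lambda>t p. - (\<phi> t *\<^sub>R g t p)) y))"

text \<open>The initial value is the value at \<open>0\<close> of the representative in \<open>C\<^sup>0([0,T],X)\<close>.\<close>

definition has_initial_value ::
    "real \<Rightarrow> ('p \<Rightarrow> 'b::real_normed_vector) set \<Rightarrow> (('p \<Rightarrow> 'b) \<Rightarrow> real) \<Rightarrow>
     (real \<Rightarrow> 'p \<Rightarrow> 'b) \<Rightarrow> ('p \<Rightarrow> 'b) \<Rightarrow> bool" where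
  "has_initial_value T X N f f0 \<longleftrightarrow>
     (\<exists>w. (\<forall>t\<in>{0..T}. w t \<in> X) \<and>
          (\<forall>t\<in>{0..T}. ((\<lambda>s. N (\<lambda>p. w s p - w t p)) \<longlongrightarrow> 0) (at t within {0..T})) \<and>
          (AE t in lebesgue_on {0<..<T}. f t \<in> X \<and> N (\<lambda>p. f t p - w t p) = 0) \<and>
          N (\<lambda>p. w 0 p - f0 p) = 0)"

text \<open>
  The functions \<open>u\<close> and \<open>H\<close> are representatives that are measurable on \<open>(0,T) \<times> G\<close>, so that
  statements about almost every point of \<open>(0,T) \<times> G\<close> make sense for them. In the second equation
  the choice of the representative of the Jacobian does not matter.
\<close>

definition weak_solution ::
    "real \<Rightarrow> (real^'d::finite) set \<Rightarrow> real \<Rightarrow> (('k::finite, 'd) matr \<Rightarrow> ('k, 'd) tensor) \<Rightarrow>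
     (real^'d \<Rightarrow> real^'k) \<Rightarrow> (real^'d \<Rightarrow> ('k, 'd) tensor) \<Rightarrow>
     (real \<Rightarrow> real^'d \<Rightarrow> real^'k) \<Rightarrow> (real \<Rightarrow> real^'d \<Rightarrow> ('k, 'd) tensor) \<Rightarrow> bool" where
  "weak_solution T G \<tau> F u0 H0 u H \<longleftrightarrow>
     (\<lambda>(t, x). u t x) \<in> borel_measurable (lebesgue_on ({0<..<T} \<times> G)) \<and>
     (\<lambda>(t, x). H t x) \<in> borel_measurable (lebesgue_on ({0<..<T} \<times> G)) \<and>
     (\<exists>\<kappa>>0. AE (t, x) in lebesgue_on ({0<..<T} \<times> G). H t x \<in> sym_tensors_ge \<kappa>) \<and>
     u \<in> bochner_L2 T (V_space G) (H1_norm G) \<and>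
     (\<exists>u'. bochner_H1_deriv T (V_dual G) (V_dual_norm G) (\<lambda>t. gelfand_embed G (u t)) u' \<and>
        (AE t in lebesgue_on {0<..<T}. \<forall>v\<in>V_space G. u' t v + A_op G (H t) (u t) v = 0)) \<and>
     (\<exists>H'. bochner_H1_deriv T (Linf_space G sym_tensors) (Linf_norm G) H H' \<and>
        (AE t in lebesgue_on {0<..<T}. AE x in lebesgue_on G.
           \<tau> *\<^sub>R H' t x + H t x - F (weak_jacobian G (u t) x) = 0)) \<and>
     has_initial_value T (H_space G) (L2_norm G) u u0 \<and>
     has_initial_value T (Linf_space G sym_tensors) (Linf_norm G) H H0"

text \<open>\<open>\<nabla>u \<in> L\<^sup>\<infinity>((0,T) \<times> G)\<close>, where \<open>\<nabla>u\<close> is the Jacobian with respect to the space variables.\<close>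

definition bounded_gradient ::
    "real \<Rightarrow> (real^'d::finite) set \<Rightarrow> (real \<Rightarrow> real^'d \<Rightarrow> real^'k::finite) \<Rightarrow> bool" where
  "bounded_gradient T G u \<longleftrightarrow>
     (\<exists>Du. (\<lambda>(t, x). Du t x) \<in> Linf_space ({0<..<T} \<times> G) UNIV \<and>
           (AE t in lebesgue_on {0<..<T}. has_weak_jacobian G (u t) (Du t)))"

end

theory Submission
  imports Defs
begin

text \<open>
  Write \<open>w = u\<^sub>1 - u\<^sub>2\<close>, \<open>\<delta> = H\<^sub>1 - H\<^sub>2\<close>, and let \<open>|\<cdot>|\<close> be the norm of \<open>L\<^sup>2(G)\<close>. The difference of the first
  equations, tested with \<open>w\<close>, reads
  \<open>d/dt |w|\<^sup>2 = - 2 \<integral> (H\<^sub>1 \<nabla>w + \<delta> \<nabla>u\<^sub>2) : \<nabla>w \<le> - \<kappa> |\<nabla>w|\<^sup>2 + (M\<^sup>2/\<kappa>) |\<delta>|\<^sup>2\<close>,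
  where \<open>\<kappa>\<close> is the coercivity constant of \<open>H\<^sub>1\<close> and \<open>M\<close> bounds \<open>\<nabla>u\<^sub>2\<close>. As \<open>F\<close> is Lipschitz continuous, the
  difference of the second equations gives \<open>|\<delta>(t)|\<^sup>2 \<le> C \<integral>\<^sub>0\<^sup>t (|\<nabla>w|\<^sup>2 + |\<delta>|\<^sup>2)\<close>. The first estimate,
  integrated in time, eliminates \<open>\<nabla>w\<close> from the second one; Gronwall's inequality yields \<open>\<delta> = 0\<close>, and the
  first estimate then yields \<open>w = 0\<close>. This is the content of \<open>integrated_solutions_unique\<close>.

  The point that needs an argument is the chain rule for \<open>|w|\<^sup>2\<close>, because \<open>w\<close> is differentiable in time
  only with values in \<open>V'\<close>. Bounded linear functionals commute with Bochner integrals
  (\<open>has_bochner_integral_in_functional\<close>), so for every fixed \<open>v \<in> V\<close> the scalar function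
  \<open>t \<mapsto> \<langle>w(t), v\<rangle>\<close> has the weak derivative \<open>- \<integral> q : \<nabla>v\<close> with the flux
  \<open>q = H\<^sub>1 \<nabla>u\<^sub>1 - H\<^sub>2 \<nabla>u\<^sub>2\<close>. For the continuous representative of \<open>w\<close> this can be integrated
  (\<open>integral_of_weak_derivative\<close>), and \<open>\<langle>w(b) - w(a), v\<rangle> = - \<integral>\<^sub>a\<^sup>b \<integral> q : \<nabla>v\<close> holds for all times
  \<open>a \<le> b\<close> and all \<open>v\<close> with a bounded Jacobian. For almost all \<open>a\<close> and \<open>b\<close> one may insert
  \<open>v = w(b) + w(a)\<close>. The flux is bounded and the gradient of \<open>w\<close> moves continuously in \<open>L\<^sup>1\<close> under
  translations in time, so the chain rule follows by averaging over \<open>a\<close> (\<open>energy_identity\<close>).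
  The tensor equation is treated in the same way with functionals \<open>H \<mapsto> \<integral> H : \<xi>\<close> for bounded \<open>\<xi>\<close>, and one tests with \<open>\<xi> = \<delta>(t)\<close>.

  Two technical points accompany this. A weak Jacobian is an arbitrary choice among functions that agree
  almost everywhere, so that its linearity rests on the fundamental lemma of the calculus of variations
  (\<open>AE_zero_if_test_integrals_zero\<close>). Functions on space-time are replaced by bounded Borel functions on
  the whole space, for which Fubini's theorem holds on every slice.
\<close>

section \<open>Smooth cut-off functions\<close>

lemma Ck_const: "Ck n (\<lambda>x. c)"
  by (induction n arbitrary: c) simp_all

lemma Ck_Suc_imp: "Ck (Suc n) f \<Longrightarrow> Ck n f"
proof (induction n arbitrary: f)
  case 0
  then show ?case
    by (auto intro!: continuous_at_imp_continuous_on differentiable_imp_continuous_within)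
next
  case (Suc n)
  then show ?case by (metis Ck.simps(2))
qed

lemma Ck_SucI:
  assumes "\<And>x. (f has_derivative f' x) (at x)" "\<And>e. e \<in> Basis \<Longrightarrow> Ck n (\<lambda>x. f' x e)"
  shows "Ck (Suc n) f"
proof -
  have "frechet_derivative f (at x) = f' x" for x
    using assms(1) frechet_derivative_at by metis
  with assms show ?thesis
    by (auto simp: differentiable_def)
qed

lemma Ck_SucD:
  assumes "Ck (Suc n) f"
  obtains f' where "\<And>x. (f has_derivative f' x) (at x)" "\<And>e. e \<in> Basis \<Longrightarrow> Ck n (\<lambda>x. f' x e)"
  using assms that[of "\<lambda>x. frechet_derivative f (at x)"]
  by (auto simp: frechet_derivative_works)

lemma Ck_add: "Ck n f \<Longrightarrow> Ck n g \<Longrightarrow> Ck n (\<lambda>x. f x + g x)"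
proof (induction n arbitrary: f g)
  case 0
  then show ?case by (auto intro: continuous_intros)
next
  case (Suc n)
  obtain f' g' where f': "\<And>x. (f has_derivative f' x) (at x)" "\<And>e. e \<in> Basis \<Longrightarrow> Ck n (\<lambda>x. f' x e)"
    and g': "\<And>x. (g has_derivative g' x) (at x)" "\<And>e. e \<in> Basis \<Longrightarrow> Ck n (\<lambda>x. g' x e)"
    using Suc.prems by (elim Ck_SucD) blast
  show ?case
    by (rule Ck_SucI[OF has_derivative_add[OF f'(1) g'(1)]]) (use Suc.IH f'(2) g'(2) in auto)
qed

lemma Ck_mult: "Ck n f \<Longrightarrow> Ck n g \<Longrightarrow> Ck n (\<lambda>x. f x * g x)"
proof (induction n arbitrary: f g)
  case 0
  then show ?case by (auto intro: continuous_intros)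
next
  case (Suc n)
  obtain f' g' where f': "\<And>x. (f has_derivative f' x) (at x)" "\<And>e. e \<in> Basis \<Longrightarrow> Ck n (\<lambda>x. f' x e)"
    and g': "\<And>x. (g has_derivative g' x) (at x)" "\<And>e. e \<in> Basis \<Longrightarrow> Ck n (\<lambda>x. g' x e)"
    using Suc.prems by (elim Ck_SucD) blast
  have "Ck n f" "Ck n g"
    using Suc.prems Ck_Suc_imp by blast+
  then show ?case
    by (intro Ck_SucI[OF has_derivative_mult[OF f'(1) g'(1)]] Ck_add Suc.IH f'(2) g'(2)) 
qed

lemma Ck_diff:
  assumes "Ck n f" "Ck n g"
  shows "Ck n (\<lambda>x. f x - g x)"
  using Ck_add[OF assms(1) Ck_mult[OF Ck_const[of n "-1"] assms(2)]] by simp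

lemma Ck_prod:
  assumes "finite I" "\<And>i. i \<in> I \<Longrightarrow> Ck n (f i)"
  shows "Ck n (\<lambda>x. \<Prod>i\<in>I. f i x)"
  using assms by (induction I) (auto intro: Ck_const Ck_mult)

lemma Ck_inverse:
  assumes "Ck n g" "\<And>x. g x \<noteq> 0"
  shows "Ck n (\<lambda>x. inverse (g x))"
  using assms(1)
proof (induction n)
  case 0
  then show ?case using assms(2) by (auto intro!: continuous_intros)
next
  case (Suc n)
  obtain g' where g': "\<And>x. (g has_derivative g' x) (at x)" "\<And>e. e \<in> Basis \<Longrightarrow> Ck n (\<lambda>x. g' x e)"
    using Suc.prems by (elim Ck_SucD) blast
  have inv: "Ck n (\<lambda>x. inverse (g x))"
    using Suc Ck_Suc_imp by blast
  have "((\<lambda>x. inverse (g x)) has_derivative (\<lambda>h. -1 * (inverse (g x) * g' x h * inverse (g x)))) (at x)" for x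
    using Deriv.has_derivative_inverse[OF assms(2) g'(1), of x] by simp
  then show ?case
    by (rule Ck_SucI) (intro Ck_mult Ck_const inv g'(2))
qed

lemma Ck_compose_affine:
  fixes f :: "real \<Rightarrow> real" and e :: "'a::euclidean_space"
  assumes "Ck n f"
  shows "Ck n (\<lambda>x. f (e \<bullet> x + d))"
  using assms
proof (induction n arbitrary: f)
  case 0
  have "continuous_on UNIV (\<lambda>x. f (e \<bullet> x + d))"
    by (rule continuous_on_compose2[of UNIV f]) (use 0 in \<open>auto intro!: continuous_intros\<close>)
  then show ?case by simp
next
  case (Suc n)
  obtain f' where f': "\<And>x. (f has_derivative f' x) (at x)" "\<And>e. e \<in> Basis \<Longrightarrow> Ck n (\<lambda>x. f' x e)"
    using Suc.prems by (elim Ck_SucD) blast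
  have lin: "f' x h = f' x 1 * h" for x h
    using linear_cmul[OF has_derivative_linear[OF f'(1)[of x]], of h 1] by simp
  have "((\<lambda>x. f (e \<bullet> x + d)) has_derivative (\<lambda>h. f' (e \<bullet> x + d) 1 * (e \<bullet> h))) (at x)" for x
  proof -
    have "((\<lambda>x. f (e \<bullet> x + d)) has_derivative (\<lambda>h. f' (e \<bullet> x + d) (e \<bullet> h))) (at x)"
      by (rule has_derivative_compose[of "\<lambda>x. e \<bullet> x + d", OF _ f'(1)])
         (auto intro!: derivative_eq_intros)
    then show ?thesis by (subst (asm) lin)
  qed
  then show ?case
  proof (rule Ck_SucI)
    fix b :: 'a
    show "Ck n (\<lambda>x. f' (e \<bullet> x + d) 1 * (e \<bullet> b))"
      by (intro Ck_mult Ck_const Suc.IH[of "\<lambda>x. f' x 1"] f'(2)) simp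
  qed
qed

text \<open>
  The functions \<open>P (1/x) exp (-1/x)\<close>, extended by \<open>0\<close> to the left of the origin, are smooth because
  this class is closed under differentiation: the exponential beats every power of \<open>1/x\<close> at the origin.
\<close>

lemma poly_exp_neg_tendsto_0:
  fixes P :: "real poly"
  shows "((\<lambda>x. poly P x * exp (- x)) \<longlongrightarrow> 0) at_top"
proof (induction P)
  case 0
  then show ?case by simp
next
  case (pCons a P)
  have *: "((\<lambda>x. x ^ n * exp (- x :: real)) \<longlongrightarrow> 0) at_top" for n :: nat
    using tendsto_power_div_exp_0[of n] by (simp only: exp_minus divide_inverse)
  have "((\<lambda>x. x ^ n * (poly Q x * exp (- x))) \<longlongrightarrow> 0) at_top" for n :: nat and Q :: "real poly"
  proof (induction Q arbitrary: n)
    case (pCons b Q)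
    have "((\<lambda>x. b * (x ^ n * exp (- x)) + x ^ Suc n * (poly Q x * exp (- x))) \<longlongrightarrow> b * 0 + 0) at_top"
      by (intro tendsto_intros * pCons.IH)
    then show ?case by (simp add: algebra_simps)
  qed simp
  from this[of 0 "pCons a P"] show ?case by simp
qed

definition poly_bump :: "real poly \<Rightarrow> real \<Rightarrow> real" where
  "poly_bump P x = (if x > 0 then poly P (1 / x) * exp (- (1 / x)) else 0)"

lemma poly_bump_deriv:
  "(poly_bump P has_real_derivative poly_bump ([:0, 0, 1:] * (P - pderiv P)) x) (at x)"
proof -
  consider "x > 0" | "x < 0" | "x = 0" by linarith
  then show ?thesis
  proof cases
    case 1
    have "((\<lambda>x. poly P (1 / x) * exp (- (1 / x))) has_real_derivative
        poly_bump ([:0, 0, 1:] * (P - pderiv P)) x) (at x)"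
      using 1 by (auto intro!: derivative_eq_intros DERIV_chain'[of "\<lambda>x. 1 / x" _ _ _ "poly P"] poly_DERIV
          simp: poly_bump_def field_simps power2_eq_square)
    moreover have "eventually (\<lambda>y. poly_bump P y = poly P (1 / y) * exp (- (1 / y))) (nhds x)"
      using 1 by (auto simp: poly_bump_def intro!: eventually_nhds_in_open[of "{0<..}", THEN eventually_mono])
    ultimately show ?thesis
      by (simp add: DERIV_cong_ev[OF refl _ refl])
  next
    case 2
    show ?thesis
      by (rule DERIV_cong_ev[THEN iffD2, OF refl _ refl DERIV_const[of 0, THEN DERIV_cong]])
         (use 2 in \<open>auto simp: poly_bump_def intro!: eventually_nhds_in_open[of "{..<0}", THEN eventually_mono]\<close>)
  next
    case 3
    have "((\<lambda>h. poly_bump P h / h) \<longlongrightarrow> 0) (at 0)"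
    proof (rule filterlim_split_at)
      show "((\<lambda>h. poly_bump P h / h) \<longlongrightarrow> 0) (at_left 0)"
        by (rule tendsto_eventually) (auto simp: poly_bump_def eventually_at_filter)
      have "((\<lambda>h. poly (pCons 0 P) (inverse h) * exp (- (inverse h))) \<longlongrightarrow> 0) (at_right 0)"
        using poly_exp_neg_tendsto_0 filterlim_inverse_at_top_right
        by (rule filterlim_compose)
      then show "((\<lambda>h. poly_bump P h / h) \<longlongrightarrow> 0) (at_right 0)"
        by (rule Lim_transform_eventually)
           (auto simp: poly_bump_def eventually_at_filter field_simps)
    qed
    then show ?thesis
      using 3 by (simp add: has_field_derivative_iff poly_bump_def)
  qed
qed

lemma Ck_poly_bump: "Ck n (poly_bump P)"
proof (induction n arbitrary: P)
  case 0
  then show ?case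
    using poly_bump_deriv by (auto intro!: continuous_at_imp_continuous_on DERIV_isCont)
next
  case (Suc n)
  have "(poly_bump P has_derivative (\<lambda>h. poly_bump ([:0, 0, 1:] * (P - pderiv P)) x * h)) (at x)" for x
    using poly_bump_deriv by (simp add: has_field_derivative_def)
  then show ?case
    by (rule Ck_SucI) (use Suc in simp)
qed

text \<open>
  With \<open>f x = exp (-1/x)\<close> for \<open>x > 0\<close> and \<open>f x = 0\<close> otherwise, the quotient \<open>f x / (f x + f (1 - x))\<close> has these
  properties: its denominator never vanishes.
\<close>

lemma smooth_step_exists:
  "\<exists>\<psi> :: real \<Rightarrow> real. (\<forall>n. Ck n \<psi>) \<and> (\<forall>x\<le>0. \<psi> x = 0) \<and> (\<forall>x\<ge>1. \<psi> x = 1) \<and> (\<forall>x. 0 \<le> \<psi> x \<and> \<psi> x \<le> 1)"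
proof -
  define f where "f = poly_bump 1"
  have f: "f x \<ge> 0" "f x > 0 \<longleftrightarrow> x > 0" "f x = 0 \<longleftrightarrow> x \<le> 0" for x
    by (auto simp: f_def poly_bump_def)
  define g where "g = (\<lambda>x. f x + f (1 - x))"
  have g: "g x > 0" for x
    using f[of x] f[of "1 - x"] unfolding g_def by (cases "x > 0") (auto intro: add_pos_nonneg add_nonneg_pos)
  have refl_smooth: "Ck n (\<lambda>x. f (1 - x))" for n
    using Ck_compose_affine[OF Ck_poly_bump, of n 1 "-1::real" 1] by (simp add: f_def inner_real_def)
  have f_smooth: "Ck n f" for n
    by (simp add: f_def Ck_poly_bump)
  then have "Ck n g" for n
    unfolding g_def by (intro Ck_add refl_smooth)
  then have "Ck n (\<lambda>x. f x * inverse (g x))" for n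
    using f_smooth by (intro Ck_mult Ck_inverse less_imp_neq[OF g, symmetric])
  moreover have "f x * inverse (g x) = 1" if "x \<ge> 1" for x
    using that g[of x] f(3)[of "1 - x"] by (simp add: g_def)
  moreover have "f x * inverse (g x) \<le> 1" for x
    using g[of x] f(1)[of "1 - x"] by (simp add: g_def field_simps)
  ultimately show ?thesis
    using f g by (intro exI[of _ "\<lambda>x. f x * inverse (g x)"])
      (auto simp: less_imp_le intro!: mult_nonneg_nonneg)
qed

definition smooth_step :: "real \<Rightarrow> real" where
  "smooth_step = (SOME \<psi>. (\<forall>n. Ck n \<psi>) \<and> (\<forall>x\<le>0. \<psi> x = 0) \<and> (\<forall>x\<ge>1. \<psi> x = 1) \<and>
     (\<forall>x. 0 \<le> \<psi> x \<and> \<psi> x \<le> 1))"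

lemma
  shows Ck_smooth_step: "Ck n smooth_step"
    and smooth_step_eq_0: "x \<le> 0 \<Longrightarrow> smooth_step x = 0"
    and smooth_step_eq_1: "x \<ge> 1 \<Longrightarrow> smooth_step x = 1"
    and smooth_step_nonneg: "smooth_step x \<ge> 0"
    and smooth_step_le_1: "smooth_step x \<le> 1"
  using someI_ex[OF smooth_step_exists] unfolding smooth_step_def[symmetric] by auto

lemma smooth_step_scaled_tendsto:
  "(\<lambda>n. smooth_step (real n * x - d)) \<longlonglongrightarrow> indicator {0<..} x" if "d \<ge> 0"
proof (cases "x > 0")
  case True
  obtain N :: nat where N: "real N \<ge> (1 + d) / x"
    using real_arch_simple by blast
  have "real n * x - d \<ge> 1" if "n \<ge> N" for n
  proof -
    have "(1 + d) / x * x \<le> real n * x"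
      using N that True by (intro mult_right_mono) auto
    then show ?thesis using True by simp
  qed
  then have "eventually (\<lambda>n. smooth_step (real n * x - d) = 1) sequentially"
    using smooth_step_eq_1 by (auto simp: eventually_sequentially)
  with True show ?thesis by (simp add: tendsto_eventually)
next
  case False
  then have "real n * x - d \<le> 0" for n
    using that by (smt (verit) mult_nonneg_nonpos of_nat_0_le_iff)
  then show ?thesis using False by (simp add: smooth_step_eq_0)
qed

text \<open>
  Products of steps in the coordinates that become steeper with \<open>n\<close>, vanish outside the box and converge
  to its indicator, so that integrals over boxes are limits of integrals against test functions.
\<close>

lemma box_cutoffs_exist:
  fixes c d :: "'a::euclidean_space"
  obtains \<phi> :: "nat \<Rightarrow> 'a \<Rightarrow> real"
    where "\<And>n m. Ck m (\<phi> n)" "\<And>n x. 0 \<le> \<phi> n x" "\<And>n x. \<phi> n x \<le> 1"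
      "\<And>n x. x \<notin> box c d \<Longrightarrow> \<phi> n x = 0"
      "\<And>x. (\<lambda>n. \<phi> n x) \<longlonglongrightarrow> indicator (box c d) x"
proof
  define \<phi> where "\<phi> n x = (\<Prod>b\<in>Basis.
      smooth_step ((real n *\<^sub>R b) \<bullet> x + - (real n * (c \<bullet> b))) *
      smooth_step ((- real n *\<^sub>R b) \<bullet> x + real n * (d \<bullet> b)))" for n and x :: 'a
  have \<phi>_eq: "\<phi> n x = (\<Prod>b\<in>Basis. smooth_step (real n * (x \<bullet> b - c \<bullet> b) - 0) *
      smooth_step (real n * (d \<bullet> b - x \<bullet> b) - 0))" for n x
    by (simp add: \<phi>_def algebra_simps inner_commute)
  show "Ck m (\<phi> n)" for n m
    unfolding \<phi>_def by (intro Ck_prod Ck_mult Ck_compose_affine Ck_smooth_step) auto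
  show "0 \<le> \<phi> n x" "\<phi> n x \<le> 1" for n x
    unfolding \<phi>_def
    by (auto intro!: prod_nonneg prod_le_1 mult_nonneg_nonneg mult_le_one smooth_step_nonneg smooth_step_le_1)
  show "\<phi> n x = 0" if "x \<notin> box c d" for n x
  proof -
    obtain b where b: "b \<in> Basis" "x \<bullet> b \<le> c \<bullet> b \<or> d \<bullet> b \<le> x \<bullet> b"
      using \<open>x \<notin> box c d\<close> by (auto simp: mem_box not_less)
    then have "smooth_step (real n * (x \<bullet> b - c \<bullet> b) - 0) * smooth_step (real n * (d \<bullet> b - x \<bullet> b) - 0) = 0"
      by (auto simp: smooth_step_eq_0 mult_nonneg_nonpos)
    with b(1) show ?thesis
      unfolding \<phi>_eq by (intro prod_zero) auto
  qed
  show "(\<lambda>n. \<phi> n x) \<longlonglongrightarrow> indicator (box c d) x" for x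
  proof -
    have "(\<lambda>n. \<phi> n x) \<longlonglongrightarrow> (\<Prod>b\<in>Basis. indicator {0<..} (x \<bullet> b - c \<bullet> b) * indicator {0<..} (d \<bullet> b - x \<bullet> b))"
      unfolding \<phi>_eq by (intro tendsto_prod tendsto_mult smooth_step_scaled_tendsto) auto
    also have "(\<Prod>b\<in>Basis. indicator {0<..} (x \<bullet> b - c \<bullet> b) * indicator {0<..} (d \<bullet> b - x \<bullet> b)) = (indicator (box c d) x :: real)"
    proof (cases "x \<in> box c d")
      case False
      then obtain b where b: "b \<in> Basis" "x \<bullet> b \<le> c \<bullet> b \<or> d \<bullet> b \<le> x \<bullet> b"
        by (auto simp: mem_box not_less)
      then have "(\<Prod>b\<in>Basis. indicator {0<..} (x \<bullet> b - c \<bullet> b) * indicator {0<..} (d \<bullet> b - x \<bullet> b)) = (0::real)"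
        by (intro prod_zero) (auto intro!: bexI[of _ b])
      with False show ?thesis by simp
    qed (auto simp: mem_box intro!: prod.neutral)
    finally show ?thesis .
  qed
qed

lemma borel_measurable_lebesgueI:
  fixes f :: "'a::euclidean_space \<Rightarrow> 'b::euclidean_space"
  shows "f \<in> borel_measurable borel \<Longrightarrow> f \<in> borel_measurable lebesgue"
  by (rule measurable_completion) simp

section \<open>The fundamental lemma of the calculus of variations\<close>

text \<open>
  The positive and the negative part of \<open>f\<close> are densities of finite measures that agree on boxes, which form
  a generator of the Borel sets that is stable under intersections. Hence the measures and their densities agree.
\<close>

lemma AE_zero_if_box_integrals_zero_real:
  fixes f :: "'a::euclidean_space \<Rightarrow> real"
  assumes f: "integrable lborel f" and zero: "\<And>a b. (LBINT x. indicator (box a b) x * f x) = 0"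
  shows "AE x in lborel. f x = 0"
proof -
  define P N where "P = (\<lambda>x. ennreal (max 0 (f x)))" and "N = (\<lambda>x. ennreal (max 0 (- f x)))"
  have [measurable]: "f \<in> borel_measurable borel" "P \<in> borel_measurable borel" "N \<in> borel_measurable borel"
    using f by (auto simp: P_def N_def)
  have part: "emeasure (density lborel (\<lambda>x. ennreal (max 0 (h x)))) X =
      ennreal (LBINT x. indicator X x * max 0 (h x))"
    if "integrable lborel h" "X \<in> sets borel" for h :: "'a \<Rightarrow> real" and X
  proof -
    have [measurable]: "h \<in> borel_measurable borel" "X \<in> sets borel" using that by auto
    have "integrable lborel (\<lambda>x. indicator X x * max 0 (h x))"
      using that(1) by (rule Bochner_Integration.integrable_bound)
        (auto simp: indicator_def intro!: AE_I2)
    then have "(\<integral>\<^sup>+x. ennreal (indicator X x * max 0 (h x)) \<partial>lborel) =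
        ennreal (LBINT x. indicator X x * max 0 (h x))"
      by (intro nn_integral_eq_integral) auto
    then show ?thesis
      by (simp add: emeasure_density ennreal_mult' ennreal_indicator mult.commute)
  qed
  have int: "integrable lborel (\<lambda>x. indicator X x * max 0 (h x))"
    if h: "integrable lborel h" and [measurable]: "X \<in> sets borel" for h :: "'a \<Rightarrow> real" and X
    using h by (rule Bochner_Integration.integrable_bound) (use h in \<open>auto simp: indicator_def\<close>)
  have "density lborel P = density lborel N"
  proof (rule measure_eqI_generator_eq)
    let ?E = "range (\<lambda>(a, b). box a b::'a set)"
    show "Int_stable ?E"
      by (auto simp: Int_stable_def box_Int_box)
    show "?E \<subseteq> Pow UNIV" "sets (density lborel P) = sigma_sets UNIV ?E"
      "sets (density lborel N) = sigma_sets UNIV ?E"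
      by (simp_all add: borel_eq_box)
    let ?A = "\<lambda>n::nat. box (- (real n *\<^sub>R One)) (real n *\<^sub>R One) :: 'a set"
    show "range ?A \<subseteq> ?E" "(\<Union>i. ?A i) = UNIV"
      unfolding UN_box_eq_UNIV by auto
    show "emeasure (density lborel P) (?A i) \<noteq> \<infinity>" for i
      unfolding P_def by (subst part) (use f in auto)
    fix X assume "X \<in> ?E"
    then obtain a b where X: "X = box a b" by auto
    have "(LBINT x. indicator X x * max 0 (f x)) - (LBINT x. indicator X x * max 0 (- f x)) =
        (LBINT x. indicator X x * max 0 (f x) - indicator X x * max 0 (- f x))"
      using f by (intro Bochner_Integration.integral_diff[symmetric] int) (auto simp: X)
    also have "\<dots> = (LBINT x. indicator X x * f x)"
      by (intro Bochner_Integration.integral_cong) (auto simp: algebra_simps max_def)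
    also have "\<dots> = 0"
      unfolding X by (rule zero)
    finally show "emeasure (density lborel P) X = emeasure (density lborel N) X"
      using f unfolding P_def N_def by (subst (1 2) part) (auto simp: X)
  qed
  then have "AE x in lborel. P x = N x"
    by (intro sigma_finite_measure.density_unique[OF sigma_finite_lborel]) auto
  then show ?thesis
    by (rule AE_mp) (auto simp: P_def N_def max_def split: if_splits intro!: AE_I2)
qed

lemma AE_zero_if_box_integrals_zero:
  fixes f :: "'a::euclidean_space \<Rightarrow> 'b::euclidean_space"
  assumes f: "integrable lebesgue f" and zero: "\<And>a b. (\<integral>x. indicator (box a b) x *\<^sub>R f x \<partial>lebesgue) = 0"
  shows "AE x in lebesgue. f x = 0"
proof -
  have "AE x in lebesgue. f x \<bullet> e = 0" if "e \<in> Basis" for e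
  proof -
    have fe: "integrable lebesgue (\<lambda>x. f x \<bullet> e)"
      using f by simp
    then obtain g where g[measurable]: "g \<in> borel_measurable lborel" and ae: "AE x in lborel. f x \<bullet> e = g x"
      using completion_ex_borel_measurable_real[of "\<lambda>x. f x \<bullet> e" lborel] by auto
    have ae': "AE x in lebesgue. g x = f x \<bullet> e"
      using ae AE_completion by (auto simp: eq_commute)
    have g_leb[measurable]: "g \<in> borel_measurable lebesgue"
      using g measurable_completion by blast
    have [measurable]: "f \<in> borel_measurable lebesgue" "box a b \<in> sets lebesgue" for a b
      using f by auto
    have "integrable lebesgue g"
      using fe ae' g_leb by (subst integrable_cong_AE) auto
    then have gi: "integrable lborel g"
      using integrable_completion[of g lborel] g by simp
    have "(LBINT x. indicator (box a b) x * g x) = 0" for a b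
    proof -
      have "(LBINT x. indicator (box a b) x * g x) = (\<integral>x. indicator (box a b) x * g x \<partial>lebesgue)"
        by (subst integral_completion) auto
      also have "\<dots> = (\<integral>x. (indicator (box a b) x *\<^sub>R f x) \<bullet> e \<partial>lebesgue)"
      proof (intro integral_cong_AE)
        show "AE x in lebesgue. indicator (box a b) x * g x = (indicator (box a b) x *\<^sub>R f x) \<bullet> e"
          using ae' by eventually_elim simp
      qed measurable
      also have "\<dots> = (\<integral>x. indicator (box a b) x *\<^sub>R f x \<partial>lebesgue) \<bullet> e"
        by (rule integral_inner_left) (use f in \<open>auto intro!: integrable_mult_indicator\<close>)
      finally show ?thesis using zero by simp
    qed
    then have "AE x in lborel. g x = 0"
      using AE_zero_if_box_integrals_zero_real gi by blast
    then have "AE x in lebesgue. g x = 0"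
      by (rule AE_completion)
    with ae' show ?thesis by eventually_elim simp
  qed
  then have "AE x in lebesgue. \<forall>e\<in>Basis. f x \<bullet> e = 0"
    by (simp add: AE_finite_all)
  then show ?thesis
    by eventually_elim (simp add: euclidean_all_zero_iff)
qed

lemma integrable_cutoff_mult:
  fixes g :: "'a::euclidean_space \<Rightarrow> 'b::euclidean_space"
  assumes S: "S \<in> sets lebesgue" and g: "locally_integrable S g"
    and \<phi>: "continuous_on UNIV \<phi>" and K: "compact K" "K \<subseteq> S" "\<And>x. x \<notin> K \<Longrightarrow> \<phi> x = (0::real)"
  shows "integrable (lebesgue_on S) (\<lambda>x. \<phi> x *\<^sub>R g x)"
proof -
  have gK: "integrable lebesgue (\<lambda>x. indicator K x *\<^sub>R g x)"
    using g K by (auto simp: locally_integrable_def set_integrable_def)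
  have "compact (\<phi> ` K)"
    using K(1) continuous_on_subset[OF \<phi>] by (intro compact_continuous_image) auto
  then obtain C where C: "\<And>x. x \<in> K \<Longrightarrow> \<bar>\<phi> x\<bar> \<le> C"
    by (meson compact_imp_bounded bounded_real imageI)
  have [measurable]: "\<phi> \<in> borel_measurable lebesgue"
    using borel_measurable_continuous_onI[OF \<phi>] by (rule borel_measurable_lebesgueI)
  have "integrable lebesgue (\<lambda>x. \<phi> x *\<^sub>R (indicator K x *\<^sub>R g x))"
  proof (rule Bochner_Integration.integrable_bound)
    show "integrable lebesgue (\<lambda>x. C *\<^sub>R (indicator K x *\<^sub>R g x))"
      using gK by (rule integrable_scaleR_right)
    show "(\<lambda>x. \<phi> x *\<^sub>R indicator K x *\<^sub>R g x) \<in> borel_measurable lebesgue"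
      by (rule borel_measurable_scaleR[OF _ borel_measurable_integrable[OF gK]]) simp
    show "AE x in lebesgue. norm (\<phi> x *\<^sub>R indicator K x *\<^sub>R g x) \<le> norm (C *\<^sub>R indicator K x *\<^sub>R g x)"
      using C by (intro AE_I2) (force simp: indicator_def intro!: mult_right_mono)
  qed
  also have "(\<lambda>x. \<phi> x *\<^sub>R (indicator K x *\<^sub>R g x)) = (\<lambda>x. indicator S x *\<^sub>R (\<phi> x *\<^sub>R g x))"
    using K by (fastforce simp: indicator_def)
  finally show ?thesis
    using S by (simp add: integrable_restrict_space)
qed

lemma integrable_test_function_mult:
  fixes g :: "'a::euclidean_space \<Rightarrow> 'b::euclidean_space"
  assumes "S \<in> sets lebesgue" "locally_integrable S g" "test_function S \<phi>"
  shows "integrable (lebesgue_on S) (\<lambda>x. \<phi> x *\<^sub>R g x)"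
  using assms(3) Ck.simps(1)[of \<phi>] closure_subset[of "{x. \<phi> x \<noteq> 0}"]
  by (intro integrable_cutoff_mult[OF assms(1,2), of _ "closure {x. \<phi> x \<noteq> 0}"])
     (auto simp: test_function_def simp del: Ck.simps)

lemma integrable_test_derivative_mult:
  fixes g :: "'a::euclidean_space \<Rightarrow> 'b::euclidean_space"
  assumes "S \<in> sets lebesgue" "locally_integrable S g" and \<phi>: "test_function S \<phi>" and e: "e \<in> Basis"
  shows "integrable (lebesgue_on S) (\<lambda>x. frechet_derivative \<phi> (at x) e *\<^sub>R g x)"
proof (rule integrable_cutoff_mult[OF assms(1,2)])
  let ?K = "closure {x. \<phi> x \<noteq> 0}"
  have "Ck (Suc 0) \<phi>"
    using \<phi> by (simp add: test_function_def del: Ck.simps)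
  then show "continuous_on UNIV (\<lambda>x. frechet_derivative \<phi> (at x) e)"
    using e by simp
  show "compact ?K" "?K \<subseteq> S"
    using \<phi> by (auto simp: test_function_def)
  show "frechet_derivative \<phi> (at x) e = 0" if "x \<notin> ?K" for x
  proof -
    have "(\<phi> has_derivative (\<lambda>_. 0)) (at x)"
    proof (rule has_derivative_transform_within_open[of "\<lambda>_. 0" _ _ UNIV "- ?K"])
      show "0 = \<phi> y" if "y \<in> - ?K" for y
        using that closure_subset[of "{x. \<phi> x \<noteq> 0}"] by auto
    qed (use that in auto)
    then show ?thesis
      using frechet_derivative_at by (metis)
  qed
qed

text \<open>
  Testing with smooth functions that increase to the indicator of a box shows that all box integrals
  vanish; a function with this property is zero, since boxes generate the Borel sets.
\<close>

lemma AE_zero_if_test_integrals_zero: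
  fixes g :: "'a::euclidean_space \<Rightarrow> 'b::euclidean_space"
  assumes S: "open S" and g: "locally_integrable S g"
    and zero: "\<And>\<phi>. test_function S \<phi> \<Longrightarrow> (LINT x|lebesgue_on S. \<phi> x *\<^sub>R g x) = 0"
  shows "AE x in lebesgue_on S. g x = 0"
proof -
  have Sl: "S \<in> sets lebesgue" using S by simp
  have on_box: "AE x in lebesgue. x \<in> cbox a b \<longrightarrow> g x = 0" if ab: "cbox a b \<subseteq> S" for a b
  proof -
    have gK: "integrable lebesgue (\<lambda>x. indicator (cbox a b) x *\<^sub>R g x)"
      using g ab by (auto simp: locally_integrable_def set_integrable_def)
    have gB: "integrable lebesgue (\<lambda>x. indicator (box p q) x *\<^sub>R g x)" if "box p q \<subseteq> cbox a b" for p q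
    proof -
      have "integrable lebesgue (\<lambda>x. indicator (box p q) x *\<^sub>R (indicator (cbox a b) x *\<^sub>R g x))"
        by (rule integrable_mult_indicator[OF _ gK]) simp
      moreover have "(\<lambda>x. indicator (box p q) x *\<^sub>R (indicator (cbox a b) x *\<^sub>R g x)) = (\<lambda>x. indicator (box p q) x *\<^sub>R g x)"
        using that by (fastforce simp: indicator_def)
      ultimately show ?thesis by simp
    qed
    have box0: "(\<integral>x. indicator (box p q) x *\<^sub>R g x \<partial>lebesgue) = 0" if pq: "box p q \<subseteq> box a b" for p q
    proof -
      obtain \<phi> :: "nat \<Rightarrow> 'a \<Rightarrow> real" where \<phi>: "\<And>n m. Ck m (\<phi> n)" "\<And>n x. 0 \<le> \<phi> n x" "\<And>n x. \<phi> n x \<le> 1"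
        "\<And>n x. x \<notin> box p q \<Longrightarrow> \<phi> n x = 0"
        "\<And>x. (\<lambda>n. \<phi> n x) \<longlonglongrightarrow> indicator (box p q) x"
        using box_cutoffs_exist[of p q] by metis
      have sub: "box p q \<subseteq> cbox a b"
        using pq box_subset_cbox by blast
      have test: "test_function S (\<phi> n)" for n
      proof -
        have "{x. \<phi> n x \<noteq> 0} \<subseteq> cbox a b"
          using \<phi>(4) sub by blast
        then have "closure {x. \<phi> n x \<noteq> 0} \<subseteq> cbox a b"
          by (simp add: closure_minimal closed_cbox)
        moreover from this have "compact (closure {x. \<phi> n x \<noteq> 0})"
          using compact_closure bounded_cbox bounded_subset closure_subset by (metis)
        ultimately show ?thesis
          using ab \<phi>(1) by (auto simp: test_function_def)
      qed
      have \<phi>_meas: "\<phi> n \<in> borel_measurable lebesgue" for n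
      proof -
        have "continuous_on UNIV (\<phi> n)"
          using \<phi>(1)[of 0 n] by simp
        then show ?thesis
          by (intro borel_measurable_lebesgueI borel_measurable_continuous_onI)
      qed
      have eq: "\<phi> n x *\<^sub>R (indicator (box p q) x *\<^sub>R g x) = indicator S x *\<^sub>R (\<phi> n x *\<^sub>R g x)" for n x
        using \<phi>(4)[of x n] sub ab by (auto simp: indicator_def)
      have "(\<integral>x. \<phi> n x *\<^sub>R (indicator (box p q) x *\<^sub>R g x) \<partial>lebesgue) = 0" for n
      proof -
        have "(\<integral>x. \<phi> n x *\<^sub>R (indicator (box p q) x *\<^sub>R g x) \<partial>lebesgue) =
            (LINT x|lebesgue_on S. \<phi> n x *\<^sub>R g x)"
          unfolding eq by (rule integral_restrict_space[symmetric]) (use Sl in simp)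
        with zero[OF test[of n]] show ?thesis by simp
      qed
      moreover have "(\<lambda>n. \<integral>x. \<phi> n x *\<^sub>R (indicator (box p q) x *\<^sub>R g x) \<partial>lebesgue)
          \<longlonglongrightarrow> (\<integral>x. indicator (box p q) x *\<^sub>R (indicator (box p q) x *\<^sub>R g x) \<partial>lebesgue)"
      proof (rule integral_dominated_convergence)
        show "integrable lebesgue (\<lambda>x. norm (indicator (box p q) x *\<^sub>R g x))"
          using gB[OF sub] by (rule integrable_norm)
        show "(\<lambda>x. \<phi> n x *\<^sub>R indicator (box p q) x *\<^sub>R g x) \<in> borel_measurable lebesgue" for n
          by (rule borel_measurable_scaleR[OF \<phi>_meas borel_measurable_integrable[OF gB[OF sub]]])
        show "(\<lambda>x. indicator (box p q) x *\<^sub>R indicator (box p q) x *\<^sub>R g x) \<in> borel_measurable lebesgue"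
          by (intro borel_measurable_scaleR borel_measurable_integrable[OF gB[OF sub]] borel_measurable_indicator) simp
        show "AE x in lebesgue. (\<lambda>n. \<phi> n x *\<^sub>R indicator (box p q) x *\<^sub>R g x)
            \<longlonglongrightarrow> indicator (box p q) x *\<^sub>R indicator (box p q) x *\<^sub>R g x"
          by (intro AE_I2 tendsto_scaleR \<phi>(5) tendsto_const)
        show "AE x in lebesgue. norm (\<phi> n x *\<^sub>R indicator (box p q) x *\<^sub>R g x) \<le> norm (indicator (box p q) x *\<^sub>R g x)" for n
          using \<phi>(2,3) by (intro AE_I2) (auto simp: mult.assoc intro!: mult_left_le_one_le)
      qed
      ultimately have "(\<integral>x. indicator (box p q) x *\<^sub>R (indicator (box p q) x *\<^sub>R g x) \<partial>lebesgue) = 0"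
        by (simp add: LIMSEQ_const_iff)
      moreover have "indicator (box p q) x *\<^sub>R (indicator (box p q) x *\<^sub>R g x) = indicator (box p q) x *\<^sub>R g x" for x
        by (simp add: indicator_def)
      ultimately show ?thesis by (simp only:)
    qed
    have "AE x in lebesgue. indicator (box a b) x *\<^sub>R g x = 0"
    proof (rule AE_zero_if_box_integrals_zero)
      show "integrable lebesgue (\<lambda>x. indicator (box a b) x *\<^sub>R g x)"
        by (rule gB) (rule box_subset_cbox)
      fix c d
      obtain p q where pq: "box c d \<inter> box a b = box p q"
        by (rule that[OF box_Int_box])
      then have eq: "indicator (box c d) x *\<^sub>R (indicator (box a b) x *\<^sub>R g x) = indicator (box p q) x *\<^sub>R g x" for x
        by (auto simp: indicator_def)
      have "box p q \<subseteq> box a b"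
        using pq by blast
      then show "(\<integral>x. indicator (box c d) x *\<^sub>R (indicator (box a b) x *\<^sub>R g x) \<partial>lebesgue) = 0"
        unfolding eq by (rule box0)
    qed
    moreover have "AE x in lebesgue. x \<notin> cbox a b - box a b"
    proof -
      have "cbox a b - box a b \<in> null_sets lebesgue"
        using negligible_frontier_interval[of a b] negligible_iff_null_sets by blast
      then show ?thesis by (rule AE_not_in)
    qed
    ultimately show ?thesis
      by eventually_elim (auto simp: indicator_def)
  qed
  obtain \<D> where D: "countable \<D>" "\<D> \<subseteq> Pow S" "\<And>X. X \<in> \<D> \<Longrightarrow> \<exists>a b. X = cbox a b" "\<Union>\<D> = S"
    using open_countable_Union_open_cbox[OF S] by metis
  have "AE x in lebesgue. \<forall>X\<in>\<D>. x \<in> X \<longrightarrow> g x = 0"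
    unfolding AE_ball_countable[OF D(1)] using on_box D by blast
  then have "AE x in lebesgue. x \<in> S \<longrightarrow> g x = 0"
    by eventually_elim (use D(4) in blast)
  then show ?thesis
    using Sl by (simp add: AE_restrict_space_iff)
qed

section \<open>Weak derivatives\<close>

lemma locally_integrable_linear:
  assumes "locally_integrable S f" "locally_integrable S g"
  shows "locally_integrable S (\<lambda>x. a *\<^sub>R f x + b *\<^sub>R g x)"
  using assms unfolding locally_integrable_def
  by (auto intro!: absolutely_integrable_scaleR_left set_integral_add(1))

lemma has_weak_partial_linear:
  assumes S: "S \<in> sets lebesgue" and e: "e \<in> Basis"
    and "has_weak_partial S f1 e g1" "has_weak_partial S f2 e g2"
  shows "has_weak_partial S (\<lambda>x. a *\<^sub>R f1 x + b *\<^sub>R f2 x) e (\<lambda>x. a *\<^sub>R g1 x + b *\<^sub>R g2 x)"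
proof -
  have f: "locally_integrable S f1" "locally_integrable S f2" and g: "locally_integrable S g1" "locally_integrable S g2"
    using assms by (auto simp: has_weak_partial_def)
  have split: "(LINT x|lebesgue_on S. \<theta> x *\<^sub>R (a *\<^sub>R h1 x + b *\<^sub>R h2 x)) =
      a *\<^sub>R (LINT x|lebesgue_on S. \<theta> x *\<^sub>R h1 x) + b *\<^sub>R (LINT x|lebesgue_on S. \<theta> x *\<^sub>R h2 x)"
    if "integrable (lebesgue_on S) (\<lambda>x. \<theta> x *\<^sub>R h1 x)" "integrable (lebesgue_on S) (\<lambda>x. \<theta> x *\<^sub>R h2 x)"
    for \<theta> :: "'a \<Rightarrow> real" and h1 h2 :: "'a \<Rightarrow> 'b"
  proof -
    have "\<theta> x *\<^sub>R (a *\<^sub>R h1 x + b *\<^sub>R h2 x) = a *\<^sub>R (\<theta> x *\<^sub>R h1 x) + b *\<^sub>R (\<theta> x *\<^sub>R h2 x)" for x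
      by (simp add: scaleR_right_distrib mult.commute)
    then show ?thesis using that by (simp only: Bochner_Integration.integral_add integrable_scaleR_right integral_scaleR_right)
  qed
  show ?thesis
    unfolding has_weak_partial_def
  proof (intro conjI allI impI locally_integrable_linear f g)
    fix \<phi> assume \<phi>: "test_function S \<phi>"
    show "(LINT x|lebesgue_on S. frechet_derivative \<phi> (at x) e *\<^sub>R (a *\<^sub>R f1 x + b *\<^sub>R f2 x)) =
        - (LINT x|lebesgue_on S. \<phi> x *\<^sub>R (a *\<^sub>R g1 x + b *\<^sub>R g2 x))"
      using assms(3,4) \<phi>
      by (simp only: split integrable_test_derivative_mult[OF S f(1) \<phi> e] integrable_test_function_mult[OF S g(1) \<phi>]
          integrable_test_derivative_mult[OF S f(2) \<phi> e] integrable_test_function_mult[OF S g(2) \<phi>])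
         (simp add: has_weak_partial_def)
  qed
qed

lemma has_weak_partial_unique:
  assumes S: "open S" and e: "e \<in> Basis"
    and "has_weak_partial S f e g1" "has_weak_partial S f e g2"
  shows "AE x in lebesgue_on S. g1 x = g2 x"
proof -
  have g: "locally_integrable S g1" "locally_integrable S g2"
    using assms by (auto simp: has_weak_partial_def)
  have Sl: "S \<in> sets lebesgue" using S by simp
  have "AE x in lebesgue_on S. 1 *\<^sub>R g1 x + (-1) *\<^sub>R g2 x = 0"
  proof (rule AE_zero_if_test_integrals_zero[OF S locally_integrable_linear[OF g]])
    fix \<phi> assume \<phi>: "test_function S \<phi>"
    have "(LINT x|lebesgue_on S. \<phi> x *\<^sub>R (1 *\<^sub>R g1 x + (-1) *\<^sub>R g2 x)) =
       (LINT x|lebesgue_on S. \<phi> x *\<^sub>R g1 x) - (LINT x|lebesgue_on S. \<phi> x *\<^sub>R g2 x)"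
      using integrable_test_function_mult[OF Sl g(1) \<phi>] integrable_test_function_mult[OF Sl g(2) \<phi>]
      by (simp add: scaleR_diff_right)
    then show "(LINT x|lebesgue_on S. \<phi> x *\<^sub>R (1 *\<^sub>R g1 x + (-1) *\<^sub>R g2 x)) = 0"
      using assms(3,4) \<phi> by (simp add: has_weak_partial_def)
  qed
  then show ?thesis by simp
qed

lemma has_weak_jacobian_linear:
  assumes "open G" "has_weak_jacobian G f1 J1" "has_weak_jacobian G f2 J2"
  shows "has_weak_jacobian G (\<lambda>x. a *\<^sub>R f1 x + b *\<^sub>R f2 x) (\<lambda>x. a *\<^sub>R J1 x + b *\<^sub>R J2 x)"
  unfolding has_weak_jacobian_def
proof
  fix j
  have "has_weak_partial G (\<lambda>x. a *\<^sub>R f1 x + b *\<^sub>R f2 x) (axis j 1)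
     (\<lambda>x. a *\<^sub>R (\<chi> i. J1 x $ i $ j) + b *\<^sub>R (\<chi> i. J2 x $ i $ j))"
    using assms by (intro has_weak_partial_linear) (auto simp: has_weak_jacobian_def axis_in_Basis_iff)
  also have "(\<lambda>x. a *\<^sub>R (\<chi> i. J1 x $ i $ j) + b *\<^sub>R (\<chi> i. J2 x $ i $ j)) = (\<lambda>x. \<chi> i. (a *\<^sub>R J1 x + b *\<^sub>R J2 x) $ i $ j)"
    by (simp add: vec_eq_iff fun_eq_iff)
  finally show "has_weak_partial G (\<lambda>x. a *\<^sub>R f1 x + b *\<^sub>R f2 x) (axis j 1) (\<lambda>x. \<chi> i. (a *\<^sub>R J1 x + b *\<^sub>R J2 x) $ i $ j)" .
qed

lemma has_weak_jacobian_unique: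
  assumes "open G" "has_weak_jacobian G f J1" "has_weak_jacobian G f J2"
  shows "AE x in lebesgue_on G. J1 x = J2 x"
proof -
  have "AE x in lebesgue_on G. (\<chi> i. J1 x $ i $ j) = (\<chi> i. J2 x $ i $ j)" for j
    using assms by (intro has_weak_partial_unique[of _ "axis j 1"])
      (auto simp: has_weak_jacobian_def axis_in_Basis_iff)
  then have "AE x in lebesgue_on G. \<forall>j\<in>UNIV. (\<chi> i. J1 x $ i $ j) = (\<chi> i. J2 x $ i $ j)"
    by (intro AE_finite_allI) auto
  then show ?thesis
    by eventually_elim (simp add: vec_eq_iff)
qed

lemma weak_jacobian_eq:
  assumes "open G" "has_weak_jacobian G f J"
  shows "AE x in lebesgue_on G. weak_jacobian G f x = J x"
  using has_weak_jacobian_unique[OF assms(1) _ assms(2)] assms(2)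
  unfolding weak_jacobian_def by (metis someI)

section \<open>Function spaces\<close>

lemma AE_eq_borel_measurable_lebesgue_on:
  fixes f g :: "'a::euclidean_space \<Rightarrow> 'b::euclidean_space"
  assumes S: "S \<in> sets lebesgue" and f: "f \<in> borel_measurable (lebesgue_on S)"
    and ae: "AE x in lebesgue_on S. f x = g x"
  shows "g \<in> borel_measurable (lebesgue_on S)"
proof -
  have "(\<lambda>x. if x \<in> S then f x else 0) \<in> borel_measurable lebesgue"
    using f S by (simp add: borel_measurable_if)
  moreover have "AE x in lebesgue. (if x \<in> S then f x else 0) = (if x \<in> S then g x else 0)"
    using ae S by (subst (asm) AE_restrict_space_iff) (auto elim: eventually_mono)
  ultimately have "(\<lambda>x. if x \<in> S then g x else 0) \<in> borel_measurable lebesgue"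
    by (rule borel_measurable_AE)
  then show ?thesis
    using S by (simp add: borel_measurable_if)
qed

lemma L2_space_inner:
  assumes "f \<in> L2_space G" "g \<in> L2_space G"
  shows "integrable (lebesgue_on G) (\<lambda>x. f x \<bullet> g x)"
proof (rule Bochner_Integration.integrable_bound)
  show "integrable (lebesgue_on G) (\<lambda>x. (norm (f x))\<^sup>2 + (norm (g x))\<^sup>2)"
    using assms by (auto simp: L2_space_def)
  show "(\<lambda>x. f x \<bullet> g x) \<in> borel_measurable (lebesgue_on G)"
    using assms by (auto simp: L2_space_def)
  have "\<bar>a \<bullet> b\<bar> \<le> (norm a)\<^sup>2 + (norm b)\<^sup>2" for a b :: 'b
  proof -
    have "\<bar>a \<bullet> b\<bar> \<le> norm a * norm b" by (rule Cauchy_Schwarz_ineq2)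
    moreover have "2 * (norm a * norm b) \<le> (norm a)\<^sup>2 + (norm b)\<^sup>2"
      using sum_squares_bound[of "norm a" "norm b"] by (simp only: mult.assoc)
    moreover have "0 \<le> norm a * norm b" by simp
    ultimately show ?thesis by linarith
  qed
  then show "AE x in lebesgue_on G. norm (f x \<bullet> g x) \<le> norm ((norm (f x))\<^sup>2 + (norm (g x))\<^sup>2)"
    by (intro AE_I2) auto
qed

lemma L2_space_linear:
  assumes "f \<in> L2_space G" "g \<in> L2_space G"
  shows "(\<lambda>x. a *\<^sub>R f x + b *\<^sub>R g x) \<in> L2_space G"
proof -
  have "(norm (a *\<^sub>R f x + b *\<^sub>R g x))\<^sup>2 = a\<^sup>2 * (norm (f x))\<^sup>2 + (2 * a * b) * (f x \<bullet> g x) + b\<^sup>2 * (norm (g x))\<^sup>2" for x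
    unfolding power2_norm_eq_inner by (simp add: inner_simps inner_commute power2_eq_square algebra_simps)
  moreover have "(\<lambda>x. a *\<^sub>R f x + b *\<^sub>R g x) \<in> borel_measurable (lebesgue_on G)"
    using assms by (intro borel_measurable_add borel_measurable_scaleR) (auto simp: L2_space_def)
  ultimately show ?thesis
    using assms L2_space_inner[OF assms] by (simp add: L2_space_def)
qed

lemma L2_norm_nonneg: "0 \<le> L2_norm G f"
  by (simp add: L2_norm_def)

lemma L2_norm_power2: "(L2_norm G f)\<^sup>2 = (LINT x|lebesgue_on G. (norm (f x))\<^sup>2)"
  by (simp add: L2_norm_def)

lemma L2_Cauchy_Schwarz:
  assumes "f \<in> L2_space G" "g \<in> L2_space G"
  shows "\<bar>\<integral>x. f x \<bullet> g x \<partial>(lebesgue_on G)\<bar> \<le> L2_norm G f * L2_norm G g"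
proof -
  define A B C where "A = (L2_norm G f)\<^sup>2" and "B = (LINT x|lebesgue_on G. f x \<bullet> g x)" and "C = (L2_norm G g)\<^sup>2"
  have int: "integrable (lebesgue_on G) (\<lambda>x. (norm (f x))\<^sup>2)" "integrable (lebesgue_on G) (\<lambda>x. (norm (g x))\<^sup>2)"
    using assms by (auto simp: L2_space_def)
  have quad: "0 \<le> A - 2 * r * B + r\<^sup>2 * C" for r
  proof -
    have "0 \<le> (LINT x|lebesgue_on G. (norm (f x - r *\<^sub>R g x))\<^sup>2)"
      by simp
    also have "\<dots> = (LINT x|lebesgue_on G. (norm (f x))\<^sup>2 - (2 * r) * (f x \<bullet> g x) + r\<^sup>2 * (norm (g x))\<^sup>2)"
      unfolding power2_norm_eq_inner by (simp add: inner_simps inner_commute power2_eq_square algebra_simps)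
    also have "\<dots> = A - 2 * r * B + r\<^sup>2 * C"
      using int L2_space_inner[OF assms] by (simp add: A_def B_def C_def L2_norm_power2)
    finally show ?thesis .
  qed
  have "B\<^sup>2 \<le> A * C"
  proof (cases "C = 0")
    case True
    have "B = 0"
    proof (rule ccontr)
      assume "B \<noteq> 0"
      then show False
        using quad[of "(A + 1) / (2 * B)"] True by simp
    qed
    then show ?thesis using True by simp
  next
    case False
    then have "C > 0" by (simp add: C_def)
    have "A - 2 * (B / C) * B + (B / C)\<^sup>2 * C = A - B\<^sup>2 / C"
      using False by (simp add: power2_eq_square field_simps)
    with quad[of "B / C"] have "B\<^sup>2 / C \<le> A" by simp
    then show ?thesis using \<open>C > 0\<close> by (simp add: field_simps)
  qed
  then have "\<bar>B\<bar>\<^sup>2 \<le> (L2_norm G f * L2_norm G g)\<^sup>2"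
    by (simp add: A_def C_def power_mult_distrib)
  then show ?thesis
    unfolding B_def by (rule power2_le_imp_le) (simp add: L2_norm_nonneg)
qed

lemma L2_triangle:
  assumes "f \<in> L2_space G" "g \<in> L2_space G"
  shows "L2_norm G (\<lambda>x. f x + g x) \<le> L2_norm G f + L2_norm G g"
proof (rule power2_le_imp_le)
  have int: "integrable (lebesgue_on G) (\<lambda>x. (norm (f x))\<^sup>2)" "integrable (lebesgue_on G) (\<lambda>x. (norm (g x))\<^sup>2)"
    using assms by (auto simp: L2_space_def)
  have "(L2_norm G (\<lambda>x. f x + g x))\<^sup>2 = (LINT x|lebesgue_on G. (norm (f x))\<^sup>2 + 2 * (f x \<bullet> g x) + (norm (g x))\<^sup>2)"
    unfolding L2_norm_power2 unfolding power2_norm_eq_inner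
    by (simp add: inner_simps inner_commute algebra_simps)
  also have "\<dots> = (L2_norm G f)\<^sup>2 + 2 * (LINT x|lebesgue_on G. f x \<bullet> g x) + (L2_norm G g)\<^sup>2"
    using int L2_space_inner[OF assms] by (simp add: L2_norm_power2)
  also have "\<dots> \<le> (L2_norm G f + L2_norm G g)\<^sup>2"
    using L2_Cauchy_Schwarz[OF assms] by (simp add: power2_sum)
  finally show "(L2_norm G (\<lambda>x. f x + g x))\<^sup>2 \<le> (L2_norm G f + L2_norm G g)\<^sup>2" .
qed (simp add: L2_norm_nonneg)

lemma L2_norm_scaleR: "L2_norm G (\<lambda>x. a *\<^sub>R f x) = \<bar>a\<bar> * L2_norm G f"
  by (simp add: L2_norm_def power_mult_distrib real_sqrt_mult)

lemma L2_norm_cong_AE: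
  assumes "f \<in> L2_space G" "g \<in> L2_space G" "AE x in lebesgue_on G. f x = g x"
  shows "L2_norm G f = L2_norm G g"
proof -
  have "(LINT x|lebesgue_on G. (norm (f x))\<^sup>2) = (LINT x|lebesgue_on G. (norm (g x))\<^sup>2)"
    using assms by (intro integral_cong_AE) (auto simp: L2_space_def)
  then show ?thesis by (simp add: L2_norm_def)
qed

lemma L2_norm_eq_0D:
  assumes "f \<in> L2_space G" "L2_norm G f = 0"
  shows "AE x in lebesgue_on G. f x = 0"
proof -
  have "(LINT x|lebesgue_on G. (norm (f x))\<^sup>2) = 0"
    using assms(2) by (simp add: L2_norm_def)
  then have "AE x in lebesgue_on G. (norm (f x))\<^sup>2 = 0"
    using assms(1) by (subst (asm) integral_nonneg_eq_0_iff_AE) (auto simp: L2_space_def)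
  then show ?thesis by eventually_elim simp
qed

text \<open>
  Some weak Jacobian of \<open>f\<close> is square integrable; by uniqueness almost everywhere, so is the one that is
  chosen in the definition of the norm.
\<close>

lemma H1_space_weak_jacobian:
  assumes G: "open G" and f: "f \<in> H1_space G"
  shows "has_weak_jacobian G f (weak_jacobian G f)" "weak_jacobian G f \<in> L2_space G"
proof -
  obtain J where J: "has_weak_jacobian G f J" "J \<in> L2_space G"
    using f by (auto simp: H1_space_def)
  show W: "has_weak_jacobian G f (weak_jacobian G f)"
    unfolding weak_jacobian_def by (rule someI[of "has_weak_jacobian G f", OF J(1)])
  have ae: "AE x in lebesgue_on G. J x = weak_jacobian G f x"
    using has_weak_jacobian_unique[OF G J(1) W] .
  have meas: "weak_jacobian G f \<in> borel_measurable (lebesgue_on G)"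
    using J(2) G ae by (elim AE_eq_borel_measurable_lebesgue_on[rotated 2]) (auto simp: L2_space_def)
  have "integrable (lebesgue_on G) (\<lambda>x. (norm (weak_jacobian G f x))\<^sup>2)"
  proof (rule integrable_cong_AE_imp[of _ "\<lambda>x. (norm (J x))\<^sup>2"])
    show "AE x in lebesgue_on G. (norm (J x))\<^sup>2 = (norm (weak_jacobian G f x))\<^sup>2"
      using ae by eventually_elim simp
  qed (use J meas in \<open>auto simp: L2_space_def\<close>)
  with meas show "weak_jacobian G f \<in> L2_space G"
    by (simp add: L2_space_def)
qed

lemma H1_space_linear:
  assumes G: "open G" and f: "f \<in> H1_space G" and g: "g \<in> H1_space G"
  shows "(\<lambda>x. a *\<^sub>R f x + b *\<^sub>R g x) \<in> H1_space G"
  using has_weak_jacobian_linear[OF G H1_space_weak_jacobian(1)[OF G f] H1_space_weak_jacobian(1)[OF G g], of a b]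
    L2_space_linear[OF H1_space_weak_jacobian(2)[OF G f] H1_space_weak_jacobian(2)[OF G g], of a b]
    L2_space_linear[of f G g a b] f g
  by (auto simp: H1_space_def)

lemma L2_space_integrable:
  assumes "finite_measure (lebesgue_on G)" and f: "f \<in> L2_space G"
  shows "integrable (lebesgue_on G) f"
proof (rule Bochner_Integration.integrable_bound)
  interpret finite_measure "lebesgue_on G" by fact
  show "integrable (lebesgue_on G) (\<lambda>x. 1 + (norm (f x))\<^sup>2)"
    using f by (auto simp: L2_space_def)
  show "f \<in> borel_measurable (lebesgue_on G)"
    using f by (auto simp: L2_space_def)
  have "norm y \<le> norm (1 + (norm y)\<^sup>2)" for y :: 'b
  proof -
    have "2 * norm y \<le> 1 + (norm y)\<^sup>2"
      using sum_squares_bound[of 1 "norm y"] by simp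
    with norm_ge_zero[of y] have "norm y \<le> 1 + (norm y)\<^sup>2" by linarith
    then show ?thesis by simp
  qed
  then show "AE x in lebesgue_on G. norm (f x) \<le> norm (1 + (norm (f x))\<^sup>2)"
    by simp
qed

lemma V_space_linear:
  assumes G: "open G" "finite_measure (lebesgue_on G)" and f: "f \<in> V_space G" and g: "g \<in> V_space G"
  shows "(\<lambda>x. a *\<^sub>R f x + b *\<^sub>R g x) \<in> V_space G"
proof -
  have L2: "f \<in> L2_space G" "g \<in> L2_space G"
    using f g by (auto simp: V_space_def H_space_def)
  have "(LINT x|lebesgue_on G. a *\<^sub>R f x + b *\<^sub>R g x) = 0"
    using f g L2_space_integrable[OF G(2) L2(1)] L2_space_integrable[OF G(2) L2(2)]
    by (simp add: V_space_def H_space_def)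
  then show ?thesis
    using H1_space_linear[OF G(1), of f g a b] L2_space_linear[OF L2, of a b] f g
    by (simp add: V_space_def H_space_def)
qed

lemma H1_norm_nonneg: "0 \<le> H1_norm G f"
  by (simp add: H1_norm_def)

lemma H1_norm_scaleR:
  assumes G: "open G" and f: "f \<in> H1_space G"
  shows "H1_norm G (\<lambda>x. a *\<^sub>R f x) = \<bar>a\<bar> * H1_norm G f"
proof -
  let ?J = "weak_jacobian G f"
  have af: "(\<lambda>x. a *\<^sub>R f x) \<in> H1_space G"
    using H1_space_linear[OF G f f, of a 0] by simp
  have "has_weak_jacobian G (\<lambda>x. a *\<^sub>R f x) (\<lambda>x. a *\<^sub>R ?J x)"
    using has_weak_jacobian_linear[OF G H1_space_weak_jacobian(1)[OF G f] H1_space_weak_jacobian(1)[OF G f], of a 0]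
    by simp
  then have "AE x in lebesgue_on G. weak_jacobian G (\<lambda>x. a *\<^sub>R f x) x = a *\<^sub>R ?J x"
    by (rule weak_jacobian_eq[OF G])
  moreover have "(\<lambda>x. a *\<^sub>R ?J x) \<in> L2_space G"
    using L2_space_linear[OF H1_space_weak_jacobian(2)[OF G f] H1_space_weak_jacobian(2)[OF G f], of a 0] by simp
  ultimately have "L2_norm G (weak_jacobian G (\<lambda>x. a *\<^sub>R f x)) = \<bar>a\<bar> * L2_norm G ?J"
    using L2_norm_cong_AE[OF H1_space_weak_jacobian(2)[OF G af]] by (simp add: L2_norm_scaleR)
  then have "H1_norm G (\<lambda>x. a *\<^sub>R f x) = sqrt (a\<^sup>2 * ((L2_norm G f)\<^sup>2 + (L2_norm G ?J)\<^sup>2))"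
    by (simp add: H1_norm_def L2_norm_scaleR power_mult_distrib distrib_left)
  then show ?thesis
    by (simp add: H1_norm_def real_sqrt_mult)
qed

text \<open>
  The summand \<open>1\<close> allows dividing \<open>v\<close> by the constant even if the seminorm of \<open>v\<close> vanishes.
\<close>

lemma V_dual_bound:
  assumes G: "open G" "finite_measure (lebesgue_on G)" and l: "l \<in> V_dual G" and v: "v \<in> V_space G"
  shows "\<bar>l v\<bar> \<le> (H1_norm G v + 1) * V_dual_norm G l"
proof -
  define c where "c = H1_norm G v + 1"
  have c: "c > 0"
    using H1_norm_nonneg[of G v] by (simp add: c_def)
  let ?v = "\<lambda>x. (1 / c) *\<^sub>R v x"
  have vV: "?v \<in> V_space G"
    using V_space_linear[OF G v v, of "1 / c" 0] by simp
  have "H1_norm G ?v = H1_norm G v / c"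
    using H1_norm_scaleR[OF G(1), of v "1 / c"] v c by (simp add: V_space_def)
  then have le1: "H1_norm G ?v \<le> 1"
    using c by (simp add: c_def)
  have "l ?v = (1 / c) * l v"
  proof -
    have "l (\<lambda>x. (1 / c) *\<^sub>R v x + 0 *\<^sub>R v x) = (1 / c) * l v + 0 * l v"
      using l v unfolding V_dual_def by blast
    then show ?thesis by simp
  qed
  then have "\<bar>l v\<bar> = c * \<bar>l ?v\<bar>"
    using c by (simp add: abs_mult)
  also have "\<bar>l ?v\<bar> \<le> V_dual_norm G l"
    unfolding V_dual_norm_def
  proof (rule cSUP_upper)
    show "?v \<in> {f \<in> V_space G. H1_norm G f \<le> 1}"
      using vV le1 by simp
    obtain C where C: "\<forall>f\<in>V_space G. \<bar>l f\<bar> \<le> C * H1_norm G f"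
      using l by (auto simp: V_dual_def)
    have "\<bar>l f\<bar> \<le> \<bar>C\<bar>" if "f \<in> V_space G" "H1_norm G f \<le> 1" for f
    proof -
      have "\<bar>l f\<bar> \<le> C * H1_norm G f" using C that by blast
      also have "\<dots> \<le> \<bar>C\<bar> * H1_norm G f"
        by (intro mult_right_mono) (auto simp: H1_norm_nonneg)
      also have "\<dots> \<le> \<bar>C\<bar> * 1"
        using that by (intro mult_left_mono) auto
      finally show ?thesis by simp
    qed
    then show "bdd_above ((\<lambda>f. \<bar>l f\<bar>) ` {f \<in> V_space G. H1_norm G f \<le> 1})"
      by (intro bdd_aboveI[of _ "\<bar>C\<bar>"]) auto
  qed
  finally show ?thesis
    using c unfolding c_def[symmetric] by (simp add: mult_left_mono)
qed

lemma V_dual_linear: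
  assumes "l1 \<in> V_dual G" "l2 \<in> V_dual G"
  shows "(\<lambda>v. a *\<^sub>R l1 v + b *\<^sub>R l2 v) \<in> V_dual G"
proof -
  obtain C1 C2 where C: "\<forall>f\<in>V_space G. \<bar>l1 f\<bar> \<le> C1 * H1_norm G f"
      "\<forall>f\<in>V_space G. \<bar>l2 f\<bar> \<le> C2 * H1_norm G f"
    using assms by (auto simp: V_dual_def)
  have "\<bar>a * l1 f + b * l2 f\<bar> \<le> (\<bar>a\<bar> * C1 + \<bar>b\<bar> * C2) * H1_norm G f" if "f \<in> V_space G" for f
  proof -
    have "\<bar>a * l1 f + b * l2 f\<bar> \<le> \<bar>a\<bar> * \<bar>l1 f\<bar> + \<bar>b\<bar> * \<bar>l2 f\<bar>"
      using abs_triangle_ineq[of "a * l1 f" "b * l2 f"] by (simp add: abs_mult)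
    also have "\<dots> \<le> \<bar>a\<bar> * (C1 * H1_norm G f) + \<bar>b\<bar> * (C2 * H1_norm G f)"
      by (intro add_mono mult_left_mono) (use C that in auto)
    finally show ?thesis by (simp add: algebra_simps)
  qed
  then have "\<exists>C. \<forall>f\<in>V_space G. \<bar>a * l1 f + b * l2 f\<bar> \<le> C * H1_norm G f" by blast
  then show ?thesis
    using assms by (auto simp: V_dual_def algebra_simps)
qed

lemma Linf_norm_AE:
  assumes "f \<in> Linf_space G S"
  shows "AE x in lebesgue_on G. norm (f x) \<le> Linf_norm G f"
proof -
  obtain C where C: "AE x in lebesgue_on G. norm (f x) \<le> C" and [measurable]: "f \<in> borel_measurable (lebesgue_on G)"
    using assms by (auto simp: Linf_space_def)
  have "esssup (lebesgue_on G) (\<lambda>x. ereal (norm (f x))) \<le> ereal C"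
    using C by (intro esssup_I) auto
  moreover have "AE x in lebesgue_on G. ereal (norm (f x)) \<le> esssup (lebesgue_on G) (\<lambda>x. ereal (norm (f x)))"
    by (rule esssup_AE)
  ultimately show ?thesis
    unfolding Linf_norm_def
    by (cases "esssup (lebesgue_on G) (\<lambda>x. ereal (norm (f x)))") (auto elim: eventually_mono)
qed

lemma Linf_norm_le:
  assumes "f \<in> borel_measurable (lebesgue_on G)" "AE x in lebesgue_on G. norm (f x) \<le> c" "0 \<le> c"
  shows "Linf_norm G f \<le> c"
proof -
  have "esssup (lebesgue_on G) (\<lambda>x. ereal (norm (f x))) \<le> ereal c"
    using assms by (intro esssup_I) auto
  with \<open>0 \<le> c\<close> show ?thesis
    unfolding Linf_norm_def by (cases "esssup (lebesgue_on G) (\<lambda>x. ereal (norm (f x)))") auto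
qed

lemma Linf_norm_nonneg:
  assumes "f \<in> Linf_space G S"
  shows "0 \<le> Linf_norm G f"
proof (rule ccontr)
  assume neg: "\<not> 0 \<le> Linf_norm G f"
  have "AE x in lebesgue_on G. False"
    using Linf_norm_AE[OF assms] by eventually_elim (use neg norm_ge_zero in \<open>smt (verit)\<close>)
  then have "ae_filter (lebesgue_on G) = bot"
    by (simp add: trivial_limit_def)
  then have "emeasure (lebesgue_on G) (space (lebesgue_on G)) = 0"
    by (simp only: ae_filter_eq_bot_iff)
  moreover have "(\<lambda>x. ereal (norm (f x))) \<in> borel_measurable (lebesgue_on G)"
    using assms by (auto simp: Linf_space_def)
  ultimately have "esssup (lebesgue_on G) (\<lambda>x. ereal (norm (f x))) = - \<infinity>"
    using esssup_zero_space by blast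
  with neg show False by (simp add: Linf_norm_def)
qed

lemma Linf_space_linear:
  assumes S: "subspace S" and f: "f \<in> Linf_space G S" and g: "g \<in> Linf_space G S"
  shows "(\<lambda>x. a *\<^sub>R f x + b *\<^sub>R g x) \<in> Linf_space G S"
proof -
  have "AE x in lebesgue_on G. norm (a *\<^sub>R f x + b *\<^sub>R g x) \<le> \<bar>a\<bar> * Linf_norm G f + \<bar>b\<bar> * Linf_norm G g"
    using Linf_norm_AE[OF f] Linf_norm_AE[OF g]
  proof eventually_elim
    case (elim x)
    have "norm (a *\<^sub>R f x + b *\<^sub>R g x) \<le> \<bar>a\<bar> * norm (f x) + \<bar>b\<bar> * norm (g x)"
      using norm_triangle_ineq[of "a *\<^sub>R f x" "b *\<^sub>R g x"] by simp
    also have "\<dots> \<le> \<bar>a\<bar> * Linf_norm G f + \<bar>b\<bar> * Linf_norm G g"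
      using elim by (intro add_mono mult_left_mono) auto
    finally show ?case .
  qed
  moreover have "AE x in lebesgue_on G. f x \<in> S" "AE x in lebesgue_on G. g x \<in> S"
    using f g by (auto simp: Linf_space_def)
  then have "AE x in lebesgue_on G. a *\<^sub>R f x + b *\<^sub>R g x \<in> S"
    by eventually_elim (use S in \<open>auto intro: subspace_add subspace_scale\<close>)
  ultimately show ?thesis
    using f g by (auto simp: Linf_space_def)
qed

lemma Linf_triangle:
  assumes "f \<in> Linf_space G S" "g \<in> Linf_space G S"
  shows "Linf_norm G (\<lambda>x. f x + g x) \<le> Linf_norm G f + Linf_norm G g"
proof (rule Linf_norm_le)
  show "(\<lambda>x. f x + g x) \<in> borel_measurable (lebesgue_on G)"
    using assms by (auto simp: Linf_space_def)
  show "AE x in lebesgue_on G. norm (f x + g x) \<le> Linf_norm G f + Linf_norm G g"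
    using Linf_norm_AE[OF assms(1)] Linf_norm_AE[OF assms(2)]
    by eventually_elim (use norm_triangle_mono in blast)
  show "0 \<le> Linf_norm G f + Linf_norm G g"
    using Linf_norm_nonneg assms by (metis add_nonneg_nonneg)
qed

lemma subspace_sym_tensors: "subspace sym_tensors"
  by (auto simp: subspace_def sym_tensors_def)

section \<open>Scalar consequences of vector-valued equations\<close>

text \<open>
  A bounded linear functional commutes with the Bochner integral: it does so for simple functions, and
  both sides pass to the limit. This reduces equations in \<open>V'\<close> and in \<open>L\<^sup>\<infinity>\<close> to equations between reals.
\<close>

lemma has_bochner_integral_in_functional:
  fixes l :: "('p \<Rightarrow> 'b::real_normed_vector) \<Rightarrow> real"
  assumes fin: "finite_measure M" and B: "has_bochner_integral_in M X N f y"
    and X: "\<And>f g a b. f \<in> X \<Longrightarrow> g \<in> X \<Longrightarrow> (\<lambda>p. a *\<^sub>R f p + b *\<^sub>R g p) \<in> X"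
    and lin: "\<And>f g a b. f \<in> X \<Longrightarrow> g \<in> X \<Longrightarrow> l (\<lambda>p. a *\<^sub>R f p + b *\<^sub>R g p) = a * l f + b * l g"
    and C: "C > 0" "\<And>f. f \<in> X \<Longrightarrow> \<bar>l f\<bar> \<le> C * N f"
    and m: "integrable M m" "AE t in M. l (f t) = m t"
  shows "integral\<^sup>L M m = l y"
proof -
  interpret finite_measure M by fact
  obtain s where s: "\<And>n. simple_into M X (s n)"
      "(\<lambda>n. \<integral>\<^sup>+ t. ennreal (N (\<lambda>p. f t p - s n t p)) \<partial>M) \<longlonglongrightarrow> 0"
      "(\<lambda>n. N (\<lambda>p. simple_integral_into M (s n) p - y p)) \<longlonglongrightarrow> 0"
    and y: "y \<in> X" and fX: "AE t in M. f t \<in> X"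
    using B by (auto simp: has_bochner_integral_in_def strongly_measurable_def)
  have X0: "(\<lambda>p. 0) \<in> X" and l0: "l (\<lambda>p. 0) = 0"
    using X[OF y y, of 0 0] lin[OF y y, of 0 0] by simp_all
  have combo: "(\<lambda>p. \<Sum>z\<in>A. c z *\<^sub>R z p) \<in> X \<and> l (\<lambda>p. \<Sum>z\<in>A. c z *\<^sub>R z p) = (\<Sum>z\<in>A. c z * l z)"
    if "finite A" "A \<subseteq> X" for A :: "('p \<Rightarrow> 'b) set" and c
    using that
  proof (induction A)
    case empty
    then show ?case using X0 l0 by simp
  next
    case (insert z A)
    then show ?case
      using X[of z "\<lambda>p. \<Sum>z\<in>A. c z *\<^sub>R z p" "c z" 1] lin[of z "\<lambda>p. \<Sum>z\<in>A. c z *\<^sub>R z p" "c z" 1] by simp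
  qed
  have sub: "(\<lambda>p. g p - h p) \<in> X" "l (\<lambda>p. g p - h p) = l g - l h" if "g \<in> X" "h \<in> X" for g h
    using X[OF that, of 1 "-1"] lin[OF that, of 1 "-1"] by simp_all
  have simple: "simple_function M (s n)" "s n ` space M \<subseteq> X" "finite (s n ` space M)" for n
    using s(1)[of n] by (auto simp: simple_into_def simple_function_def)
  have ls: "simple_function M (\<lambda>t. l (s n t))" for n
    by (rule simple_function_compose1[OF simple(1)])
  have ls_int: "integrable M (\<lambda>t. l (s n t))" for n
  proof (rule integrable_const_bound[of _ "\<Sum>z\<in>s n ` space M. \<bar>l z\<bar>"])
    show "AE t in M. norm (l (s n t)) \<le> (\<Sum>z\<in>s n ` space M. \<bar>l z\<bar>)"
      by (rule AE_I2) (use simple(3)[of n] in \<open>auto intro!: member_le_sum\<close>)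
    show "(\<lambda>t. l (s n t)) \<in> borel_measurable M"
      using ls borel_measurable_simple_function by blast
  qed
  have l_simple: "(\<integral>t. l (s n t) \<partial>M) = l (simple_integral_into M (s n))"
    and simple_X: "simple_integral_into M (s n) \<in> X" for n
  proof -
    let ?A = "s n ` space M"
    have sets: "s n -` {z} \<inter> space M \<in> sets M" if "z \<in> ?A" for z
      using simple(1)[of n] that by (auto simp: simple_function_def)
    have "l (simple_integral_into M (s n)) = (\<Sum>z\<in>?A. measure M (s n -` {z} \<inter> space M) * l z)"
      unfolding simple_integral_into_def by (rule combo[OF simple(3,2), THEN conjunct2])
    also have "\<dots> = (\<Sum>z\<in>?A. \<integral>t. l z * indicator (s n -` {z} \<inter> space M) t \<partial>M)"
      using sets by (intro sum.cong) auto
    also have "\<dots> = (\<integral>t. (\<Sum>z\<in>?A. l z * indicator (s n -` {z} \<inter> space M) t) \<partial>M)"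
      using sets by (intro Bochner_Integration.integral_sum[symmetric]) (auto simp: emeasure_finite less_top[symmetric])
    also have "\<dots> = (\<integral>t. l (s n t) \<partial>M)"
    proof (rule Bochner_Integration.integral_cong)
      fix t assume t: "t \<in> space M"
      have "(\<Sum>z\<in>?A. l z * indicator (s n -` {z} \<inter> space M) t) = (\<Sum>z\<in>?A. if z = s n t then l z else 0)"
        using t by (intro sum.cong) (auto simp: indicator_def)
      then show "(\<Sum>z\<in>?A. l z * indicator (s n -` {z} \<inter> space M) t) = l (s n t)"
        using t simple(3)[of n] by (simp add: sum.delta)
    qed simp
    finally show "(\<integral>t. l (s n t) \<partial>M) = l (simple_integral_into M (s n))" ..
    show "simple_integral_into M (s n) \<in> X"
      unfolding simple_integral_into_def by (rule combo[OF simple(3,2), THEN conjunct1])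
  qed
  have lim1: "(\<lambda>n. l (simple_integral_into M (s n))) \<longlonglongrightarrow> l y"
  proof (rule LIM_zero_cancel, rule Lim_null_comparison)
    show "\<forall>\<^sub>F n in sequentially. norm (l (simple_integral_into M (s n)) - l y)
        \<le> C * N (\<lambda>p. simple_integral_into M (s n) p - y p)"
      using C(2)[OF sub(1)[OF simple_X y]] sub(2)[OF simple_X y] by simp
    show "(\<lambda>n. C * N (\<lambda>p. simple_integral_into M (s n) p - y p)) \<longlonglongrightarrow> 0"
      using tendsto_mult_left[OF s(3), of C] by simp
  qed
  have lim2: "(\<lambda>n. \<integral>t. l (s n t) \<partial>M) \<longlonglongrightarrow> integral\<^sup>L M m"
  proof (rule LIM_zero_cancel)
    \<comment> \<open>The seminorm of \<open>f t - s n t\<close> need not be measurable in \<open>t\<close>, so \<open>C\<close> is divided out on the measurable side.\<close>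
    have bound: "ennreal (\<bar>(\<integral>t. l (s n t) \<partial>M) - integral\<^sup>L M m\<bar> / C) \<le> (\<integral>\<^sup>+ t. ennreal (N (\<lambda>p. f t p - s n t p)) \<partial>M)" for n
    proof -
      have int: "integrable M (\<lambda>t. (l (s n t) - m t) / C)"
        using ls_int m(1) by simp
      have "\<bar>(\<integral>t. l (s n t) \<partial>M) - integral\<^sup>L M m\<bar> / C = \<bar>\<integral>t. (l (s n t) - m t) / C \<partial>M\<bar>"
        using ls_int m(1) C(1) by simp
      also have "\<dots> \<le> (\<integral>t. \<bar>(l (s n t) - m t) / C\<bar> \<partial>M)"
        by (rule integral_abs_bound)
      finally have "ennreal (\<bar>(\<integral>t. l (s n t) \<partial>M) - integral\<^sup>L M m\<bar> / C) \<le> ennreal (\<integral>t. \<bar>(l (s n t) - m t) / C\<bar> \<partial>M)"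
        by (rule ennreal_leI)
      also have "\<dots> = (\<integral>\<^sup>+ t. ennreal \<bar>(l (s n t) - m t) / C\<bar> \<partial>M)"
        by (intro nn_integral_eq_integral[symmetric] integrable_abs int AE_I2) simp
      also have "\<dots> \<le> (\<integral>\<^sup>+ t. ennreal (N (\<lambda>p. f t p - s n t p)) \<partial>M)"
      proof (rule nn_integral_mono_AE)
        show "AE t in M. ennreal \<bar>(l (s n t) - m t) / C\<bar> \<le> ennreal (N (\<lambda>p. f t p - s n t p))"
          using fX m(2) AE_space
        proof eventually_elim
          case (elim t)
          then have st: "s n t \<in> X" using simple(2) by blast
          have "\<bar>l (s n t) - m t\<bar> \<le> C * N (\<lambda>p. f t p - s n t p)"
            using C(2)[OF sub(1)[OF elim(1) st]] sub(2)[OF elim(1) st] elim(2) by (simp add: abs_minus_commute)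
          then show ?case
            using C(1) by (intro ennreal_leI) (simp add: field_simps)
        qed
      qed
      finally show ?thesis .
    qed
    have "(\<lambda>n. ennreal (\<bar>(\<integral>t. l (s n t) \<partial>M) - integral\<^sup>L M m\<bar> / C)) \<longlonglongrightarrow> ennreal 0"
      unfolding ennreal_0 by (rule tendsto_sandwich[OF _ _ tendsto_const s(2)]) (use bound in auto)
    then have "(\<lambda>n. \<bar>(\<integral>t. l (s n t) \<partial>M) - integral\<^sup>L M m\<bar> / C) \<longlonglongrightarrow> 0"
      using C(1) by (subst (asm) tendsto_ennreal_iff) auto
    then have "(\<lambda>n. \<bar>(\<integral>t. l (s n t) \<partial>M) - integral\<^sup>L M m\<bar> / C * C) \<longlonglongrightarrow> 0 * C"
      by (rule tendsto_mult_right)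
    then show "(\<lambda>n. (\<integral>t. l (s n t) \<partial>M) - integral\<^sup>L M m) \<longlonglongrightarrow> 0"
      using C(1) by (simp add: tendsto_rabs_zero_iff)
  qed
  show ?thesis
    using LIMSEQ_unique[OF lim2] lim1 by (simp add: l_simple)
qed

lemma Ck_deriv:
  fixes f :: "real \<Rightarrow> real"
  assumes "Ck (Suc 0) f"
  shows "(f has_real_derivative deriv f x) (at x)" and "continuous_on UNIV (deriv f)"
proof -
  obtain f' where f': "\<And>x. (f has_derivative f' x) (at x)" "\<And>e. e \<in> Basis \<Longrightarrow> Ck 0 (\<lambda>x. f' x e)"
    using assms by (elim Ck_SucD) blast
  have D: "(f has_real_derivative f' x 1) (at x)" for x
  proof -
    have "f' x h = f' x 1 * h" for h
      using linear_cmul[OF has_derivative_linear[OF f'(1)[of x]], of h 1] by simp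
    then have "f' x = (*) (f' x 1)" by blast
    then show ?thesis
      using f'(1)[of x] by (simp add: has_field_derivative_def)
  qed
  then have eq: "deriv f = (\<lambda>x. f' x 1)"
    by (auto intro: DERIV_imp_deriv)
  show "(f has_real_derivative deriv f x) (at x)"
    using D unfolding eq .
  show "continuous_on UNIV (deriv f)"
    using f'(2)[of 1] by (simp add: eq)
qed

lemma smooth_step_deriv:
  shows "(smooth_step has_real_derivative deriv smooth_step x) (at x)"
    and "continuous_on UNIV (deriv smooth_step)"
    and "x \<notin> {0..1} \<Longrightarrow> deriv smooth_step x = 0"
proof -
  show "(smooth_step has_real_derivative deriv smooth_step x) (at x)" "continuous_on UNIV (deriv smooth_step)"
    using Ck_deriv[OF Ck_smooth_step] by auto
  show "deriv smooth_step x = 0" if "x \<notin> {0..1}"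
  proof (cases "x < 0")
    case True
    have "((\<lambda>_. 0) has_real_derivative 0) (at x)" by simp
    then have "(smooth_step has_real_derivative 0) (at x)"
      by (rule has_field_derivative_transform_within_open[of _ _ _ "{..<0}"])
         (use True in \<open>auto simp: smooth_step_eq_0\<close>)
    then show ?thesis by (rule DERIV_imp_deriv)
  next
    case False
    have "((\<lambda>_. 1) has_real_derivative 0) (at x)" by simp
    then have "(smooth_step has_real_derivative 0) (at x)"
      by (rule has_field_derivative_transform_within_open[of _ _ _ "{1<..}"])
         (use False that in \<open>auto simp: smooth_step_eq_1\<close>)
    then show ?thesis by (rule DERIV_imp_deriv)
  qed
qed

lemma smooth_step_deriv_integral:
  "integrable lborel (deriv smooth_step)" "(LBINT x. deriv smooth_step x) = 1"
proof -
  let ?\<eta> = "deriv smooth_step"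
  have "has_bochner_integral lborel (\<lambda>x. ?\<eta> x * indicator {0..1} x) (smooth_step 1 - smooth_step 0)"
    by (rule has_bochner_integral_FTC_Icc_real)
       (use smooth_step_deriv(1,2) in \<open>auto simp: continuous_on_eq_continuous_at\<close>)
  moreover have "(\<lambda>x. ?\<eta> x * indicator {0..1} x) = ?\<eta>"
    using smooth_step_deriv(3) by (fastforce simp: indicator_def)
  ultimately have "has_bochner_integral lborel ?\<eta> 1"
    by (simp add: smooth_step_eq_0 smooth_step_eq_1)
  then show "integrable lborel ?\<eta>" "(LBINT x. ?\<eta> x) = 1"
    by (auto simp: has_bochner_integral_iff)
qed

text \<open>
  The derivatives of the steps at \<open>s\<close> form an approximate identity there, concentrated on the interval
  from \<open>s + 1/n\<close> to \<open>s + 2/n\<close>.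
\<close>

lemma time_average_tendsto:
  assumes m: "continuous_on UNIV m" "\<And>x. \<bar>m x\<bar> \<le> B"
  shows "(\<lambda>n. \<integral>x. real (Suc n) * deriv smooth_step (real (Suc n) * (x - s) - 1) * m x \<partial>lborel) \<longlonglongrightarrow> m s"
proof -
  let ?\<eta> = "deriv smooth_step"
  have [measurable]: "m \<in> borel_measurable borel" "?\<eta> \<in> borel_measurable borel"
    using m smooth_step_deriv(2) by (auto intro: borel_measurable_continuous_onI)
  have eq: "(LBINT x. real (Suc n) * ?\<eta> (real (Suc n) * (x - s) - 1) * m x) =
      (LBINT y. ?\<eta> y * m (s + (y + 1) / real (Suc n)))" for n
  proof -
    have "(LBINT x. real (Suc n) * ?\<eta> (real (Suc n) * (x - s) - 1) * m x) =
      \<bar>1 / real (Suc n)\<bar> *\<^sub>R (LBINT y. real (Suc n) * ?\<eta> (real (Suc n) * ((s + 1 / real (Suc n)) + 1 / real (Suc n) * y - s) - 1)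
        * m ((s + 1 / real (Suc n)) + 1 / real (Suc n) * y))"
      by (rule lborel_integral_real_affine) simp
    also have "\<dots> = (LBINT y. \<bar>1 / real (Suc n)\<bar> *\<^sub>R (real (Suc n) * ?\<eta> (real (Suc n) * ((s + 1 / real (Suc n)) + 1 / real (Suc n) * y - s) - 1)
        * m ((s + 1 / real (Suc n)) + 1 / real (Suc n) * y)))"
      by (rule integral_scaleR_right[symmetric])
    also have "\<dots> = (LBINT y. ?\<eta> y * m (s + (y + 1) / real (Suc n)))"
    proof (intro Bochner_Integration.integral_cong refl)
      fix y
      have eqs: "real (Suc n) * ((s + 1 / real (Suc n)) + 1 / real (Suc n) * y - s) - 1 = y"
        "(s + 1 / real (Suc n)) + 1 / real (Suc n) * y = s + (y + 1) / real (Suc n)"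
        by (simp_all add: divide_simps)
      show "\<bar>1 / real (Suc n)\<bar> *\<^sub>R (real (Suc n) * ?\<eta> (real (Suc n) * ((s + 1 / real (Suc n)) + 1 / real (Suc n) * y - s) - 1)
        * m ((s + 1 / real (Suc n)) + 1 / real (Suc n) * y)) = ?\<eta> y * m (s + (y + 1) / real (Suc n))"
        unfolding eqs by simp
    qed
    finally show ?thesis .
  qed
  have "(\<lambda>n. \<integral>y. ?\<eta> y * m (s + (y + 1) / real (Suc n)) \<partial>lborel) \<longlonglongrightarrow> (LBINT y. ?\<eta> y * m s)"
  proof (rule integral_dominated_convergence)
    show "integrable lborel (\<lambda>y. B * \<bar>?\<eta> y\<bar>)"
      using smooth_step_deriv_integral(1) by simp
    show "AE y in lborel. (\<lambda>n. ?\<eta> y * m (s + (y + 1) / real (Suc n))) \<longlonglongrightarrow> ?\<eta> y * m s"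
    proof (rule AE_I2)
      fix y
      have "(\<lambda>n. (y + 1) * (1 / real (Suc n))) \<longlonglongrightarrow> (y + 1) * 0"
        using LIMSEQ_inverse_real_of_nat by (intro tendsto_mult tendsto_const) (simp add: inverse_eq_divide)
      then have "(\<lambda>n. s + (y + 1) / real (Suc n)) \<longlonglongrightarrow> s + 0"
        by (intro tendsto_add tendsto_const) simp
      moreover have "isCont m s"
        using m(1) by (simp add: continuous_on_eq_continuous_at)
      ultimately show "(\<lambda>n. ?\<eta> y * m (s + (y + 1) / real (Suc n))) \<longlonglongrightarrow> ?\<eta> y * m s"
        by (intro tendsto_mult tendsto_const isCont_tendsto_compose[of s m]) simp_all
    qed
    show "AE y in lborel. norm (?\<eta> y * m (s + (y + 1) / real (Suc n))) \<le> B * \<bar>?\<eta> y\<bar>" for n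
    proof (rule AE_I2)
      fix y
      have "\<bar>?\<eta> y\<bar> * \<bar>m (s + (y + 1) / real (Suc n))\<bar> \<le> \<bar>?\<eta> y\<bar> * B"
        by (intro mult_left_mono m(2)) simp
      then show "norm (?\<eta> y * m (s + (y + 1) / real (Suc n))) \<le> B * \<bar>?\<eta> y\<bar>"
        by (simp add: abs_mult mult.commute)
    qed
  qed measurable
  then show ?thesis
    unfolding eq using smooth_step_deriv_integral by simp
qed

text \<open>
  A continuous function with a bounded weak derivative is the integral of this derivative: test with
  smooth functions that rise from \<open>0\<close> to \<open>1\<close> just to the right of \<open>s\<close> and return to \<open>0\<close> just to the right
  of \<open>t\<close>. The shift to the right keeps their supports in the open interval even for \<open>s = 0\<close>.
\<close>

lemma integral_of_weak_derivative:
  fixes m \<gamma> :: "real \<Rightarrow> real"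
  assumes m: "continuous_on UNIV m" "\<And>x. \<bar>m x\<bar> \<le> B"
    and \<gamma>: "\<gamma> \<in> borel_measurable borel" "\<And>x. \<bar>\<gamma> x\<bar> \<le> B'"
    and weak: "\<And>\<phi>. test_function {0<..<T} \<phi> \<Longrightarrow>
      (\<integral>t. deriv \<phi> t * m t \<partial>(lebesgue_on {0<..<T})) = - (\<integral>t. \<phi> t * \<gamma> t \<partial>(lebesgue_on {0<..<T}))"
    and st: "0 \<le> s" "s \<le> t" "t < T"
  shows "m t - m s = (LBINT r. indicator {s<..t} r * \<gamma> r)"
proof -
  let ?\<eta> = "deriv smooth_step"
  have \<gamma>m[measurable]: "\<gamma> \<in> borel_measurable borel" by fact
  have mm[measurable]: "m \<in> borel_measurable borel" "?\<eta> \<in> borel_measurable borel" "smooth_step \<in> borel_measurable borel"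
    using m smooth_step_deriv(2) Ck_smooth_step[of 0] by (auto intro: borel_measurable_continuous_onI)
  define \<phi> where "\<phi> n x = smooth_step (real (Suc n) * (x - s) - 1) - smooth_step (real (Suc n) * (x - t) - 1)" for n x
  have \<phi>m[measurable]: "\<phi> n \<in> borel_measurable borel" for n
    unfolding \<phi>_def[abs_def] by measurable
  have \<phi>_deriv: "(\<phi> n has_real_derivative
      real (Suc n) * ?\<eta> (real (Suc n) * (x - s) - 1) - real (Suc n) * ?\<eta> (real (Suc n) * (x - t) - 1)) (at x)" for n x
    unfolding \<phi>_def
    by (auto intro!: derivative_eq_intros DERIV_chain2[OF smooth_step_deriv(1)])
  have \<phi>_zero: "\<phi> n x = 0" if "x \<notin> {s + 1 / real (Suc n) <..< t + 2 / real (Suc n)}" for n x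
  proof -
    consider "x \<le> s + 1 / real (Suc n)" | "x \<ge> t + 2 / real (Suc n)"
      using \<open>x \<notin> _\<close> by fastforce
    then show ?thesis
    proof cases
      case 1
      then have "real (Suc n) * (x - s) - 1 \<le> 0"
        using st by (simp add: field_simps)
      moreover have "real (Suc n) * (x - t) \<le> real (Suc n) * (x - s)"
        using st by (intro mult_left_mono) auto
      ultimately have "smooth_step (real (Suc n) * (x - s) - 1) = 0" "smooth_step (real (Suc n) * (x - t) - 1) = 0"
        by (intro smooth_step_eq_0; linarith)+
      then show ?thesis by (simp add: \<phi>_def)
    next
      case 2
      then have "real (Suc n) * (x - t) - 1 \<ge> 1"
        using st by (simp add: field_simps)
      moreover have "real (Suc n) * (x - t) \<le> real (Suc n) * (x - s)"
        using st by (intro mult_left_mono) auto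
      ultimately have "smooth_step (real (Suc n) * (x - s) - 1) = 1" "smooth_step (real (Suc n) * (x - t) - 1) = 1"
        by (intro smooth_step_eq_1; linarith)+
      then show ?thesis by (simp add: \<phi>_def)
    qed
  qed
  have \<phi>_bound: "\<bar>\<phi> n x\<bar> \<le> 1" for n x
    using smooth_step_nonneg smooth_step_le_1 unfolding \<phi>_def by (smt (verit))
  obtain N where N: "2 / real (Suc n) < T - t" if "n \<ge> N" for n
  proof -
    obtain N where "2 / (T - t) < real N"
      using reals_Archimedean2 by blast
    then have "2 / real (Suc n) < T - t" if "n \<ge> N" for n
    proof -
      have "2 / (T - t) < real (Suc n)"
        using \<open>2 / (T - t) < real N\<close> that by simp
      then show ?thesis using st by (simp add: field_simps)
    qed
    then show ?thesis using that by blast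
  qed
  have key: "(LBINT x. deriv (\<phi> n) x * m x) = - (LBINT x. \<phi> n x * \<gamma> x)" if n: "n \<ge> N" for n
  proof -
    let ?K = "{s + 1 / real (Suc n) .. t + 2 / real (Suc n)}"
    have K: "?K \<subseteq> {0<..<T}"
    proof -
      have "0 < 1 / real (Suc n)" by simp
      with N[OF n] st show ?thesis
        by (intro subsetI; simp only: greaterThanLessThan_iff atLeastAtMost_iff; linarith)
    qed
    have sub: "{x. \<phi> n x \<noteq> 0} \<subseteq> ?K"
    proof -
      have "{x. \<phi> n x \<noteq> 0} \<subseteq> {s + 1 / real (Suc n) <..< t + 2 / real (Suc n)}"
        using \<phi>_zero[of _ n] by blast
      also have "\<dots> \<subseteq> ?K" by (simp add: greaterThanLessThan_subseteq_atLeastAtMost_iff)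
      finally show ?thesis .
    qed
    then have cl: "closure {x. \<phi> n x \<noteq> 0} \<subseteq> ?K"
      by (intro closure_minimal) auto
    have "Ck k (\<phi> n)" for k
    proof -
      have "Ck k (\<lambda>x. smooth_step (real (Suc n) \<bullet> x + (- real (Suc n) * s - 1)) -
          smooth_step (real (Suc n) \<bullet> x + (- real (Suc n) * t - 1)))"
        by (intro Ck_diff Ck_compose_affine Ck_smooth_step)
      then show ?thesis
        by (simp add: \<phi>_def[abs_def] algebra_simps inner_real_def)
    qed
    then have test: "test_function {0<..<T} (\<phi> n)"
      using cl K compact_Icc[of "s + 1 / real (Suc n)" "t + 2 / real (Suc n)"]
      by (auto simp: test_function_def intro: compact_closure[THEN iffD2] bounded_subset[OF bounded_closed_interval sub])
    have \<phi>'0: "deriv (\<phi> n) x = 0" if "x \<notin> {0<..<T}" for x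
    proof -
      have "((\<lambda>_. 0) has_real_derivative 0) (at x)" by simp
      then have "(\<phi> n has_real_derivative 0) (at x)"
        by (rule has_field_derivative_transform_within_open[of _ _ _ "- ?K"])
           (use sub K that in \<open>auto simp: subset_iff\<close>)
      then show ?thesis by (rule DERIV_imp_deriv)
    qed
    have \<phi>0: "\<phi> n x = 0" if "x \<notin> {0<..<T}" for x
      using sub K that by blast
    have restr: "(\<integral>x. f x \<partial>(lebesgue_on {0<..<T})) = (LBINT x. f x)"
      if "f \<in> borel_measurable borel" "\<And>x. x \<notin> {0<..<T} \<Longrightarrow> f x = 0" for f :: "real \<Rightarrow> real"
    proof -
      have "(\<integral>x. f x \<partial>(lebesgue_on {0<..<T})) = (\<integral>x. indicator {0<..<T} x *\<^sub>R f x \<partial>lebesgue)"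
        by (rule integral_restrict_space) simp
      also have "(\<lambda>x. indicator {0<..<T} x *\<^sub>R f x) = f"
        using that(2) by (fastforce simp: indicator_def)
      also have "(\<integral>x. f x \<partial>lebesgue) = (LBINT x. f x)"
        using that(1) by (intro integral_completion) simp
      finally show ?thesis .
    qed
    have "deriv (\<phi> n) = (\<lambda>x. real (Suc n) * ?\<eta> (real (Suc n) * (x - s) - 1) - real (Suc n) * ?\<eta> (real (Suc n) * (x - t) - 1))"
      using DERIV_imp_deriv[OF \<phi>_deriv] by blast
    then have [measurable]: "deriv (\<phi> n) \<in> borel_measurable borel"
      by simp
    have "(LBINT x. deriv (\<phi> n) x * m x) = (\<integral>x. deriv (\<phi> n) x * m x \<partial>(lebesgue_on {0<..<T}))"
      by (rule restr[symmetric]) (simp_all add: \<phi>'0 del: greaterThanLessThan_iff)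
    also have "\<dots> = - (\<integral>x. \<phi> n x * \<gamma> x \<partial>(lebesgue_on {0<..<T}))"
      by (rule weak[OF test])
    also have "(\<integral>x. \<phi> n x * \<gamma> x \<partial>(lebesgue_on {0<..<T})) = (LBINT x. \<phi> n x * \<gamma> x)"
      by (rule restr) (simp_all add: \<phi>0 del: greaterThanLessThan_iff)
    finally show ?thesis .
  qed
  have "(\<lambda>n. \<integral>x. deriv (\<phi> n) x * m x \<partial>lborel) \<longlonglongrightarrow> m s - m t"
  proof -
    have int: "integrable lborel (\<lambda>x. real (Suc n) * ?\<eta> (real (Suc n) * (x - a) - 1) * m x)" for n a
    proof (rule Bochner_Integration.integrable_bound)
      have "integrable lborel (\<lambda>x. ?\<eta> ((- real (Suc n) * a - 1) + real (Suc n) * x))"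
        using smooth_step_deriv_integral(1) by (rule lborel_integrable_real_affine) simp
      then have "integrable lborel (\<lambda>x. ?\<eta> (real (Suc n) * (x - a) - 1))"
        by (simp add: algebra_simps)
      then show "integrable lborel (\<lambda>x. real (Suc n) * B * \<bar>?\<eta> (real (Suc n) * (x - a) - 1)\<bar>)"
        by simp
      show "AE x in lborel. norm (real (Suc n) * ?\<eta> (real (Suc n) * (x - a) - 1) * m x)
          \<le> norm (real (Suc n) * B * \<bar>?\<eta> (real (Suc n) * (x - a) - 1)\<bar>)"
      proof (rule AE_I2)
        fix x
        have "real (Suc n) * \<bar>?\<eta> (real (Suc n) * (x - a) - 1)\<bar> * \<bar>m x\<bar> \<le> real (Suc n) * \<bar>?\<eta> (real (Suc n) * (x - a) - 1)\<bar> * \<bar>B\<bar>"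
          using m(2)[of x] by (intro mult_left_mono) auto
        then show "norm (real (Suc n) * ?\<eta> (real (Suc n) * (x - a) - 1) * m x)
          \<le> norm (real (Suc n) * B * \<bar>?\<eta> (real (Suc n) * (x - a) - 1)\<bar>)"
          by (simp add: abs_mult mult.assoc mult.left_commute mult.commute del: of_nat_Suc)
      qed
    qed simp
    have "(LBINT x. deriv (\<phi> n) x * m x) =
       (LBINT x. real (Suc n) * ?\<eta> (real (Suc n) * (x - s) - 1) * m x) -
       (LBINT x. real (Suc n) * ?\<eta> (real (Suc n) * (x - t) - 1) * m x)" for n
      unfolding Bochner_Integration.integral_diff[OF int int, symmetric] DERIV_imp_deriv[OF \<phi>_deriv]
      by (simp only: left_diff_distrib)
    then show ?thesis
      using tendsto_diff[OF time_average_tendsto[OF m, of s] time_average_tendsto[OF m, of t]] by presburger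
  qed
  moreover have "(\<lambda>n. - (LBINT x. \<phi> n x * \<gamma> x)) \<longlonglongrightarrow> - (LBINT x. indicator {s<..t} x * \<gamma> x)"
  proof (intro tendsto_minus integral_dominated_convergence)
    show "integrable lborel (\<lambda>x. B' * indicator {s..t + 2} x)"
      by (intro integrable_mult_right integrable_real_indicator) (auto simp: emeasure_lborel_Icc_eq)
    show "AE x in lborel. (\<lambda>n. \<phi> n x * \<gamma> x) \<longlonglongrightarrow> indicator {s<..t} x * \<gamma> x"
    proof (intro AE_I2 tendsto_mult tendsto_const)
      fix x
      have "(\<lambda>n. \<phi> n x) \<longlonglongrightarrow> indicator {0<..} (x - s) - indicator {0<..} (x - t)"
        unfolding \<phi>_def by (intro tendsto_diff LIMSEQ_Suc[OF smooth_step_scaled_tendsto]) simp_all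
      also have "indicator {0<..} (x - s) - indicator {0<..} (x - t) = (indicator {s<..t} x :: real)"
        using st by (auto simp: indicator_def)
      finally show "(\<lambda>n. \<phi> n x) \<longlonglongrightarrow> indicator {s<..t} x" .
    qed
    show "AE x in lborel. norm (\<phi> n x * \<gamma> x) \<le> B' * indicator {s..t + 2} x" for n
    proof (rule AE_I2)
      fix x
      show "norm (\<phi> n x * \<gamma> x) \<le> B' * indicator {s..t + 2} x"
      proof (cases "x \<in> {s..t+2}")
        case True
        have "\<bar>\<phi> n x\<bar> * \<bar>\<gamma> x\<bar> \<le> 1 * B'"
          by (intro mult_mono \<phi>_bound \<gamma>(2)) auto
        with True show ?thesis by (simp add: abs_mult)
      next
        case False
        have "2 / real (Suc n) \<le> 2" "0 \<le> 1 / real (Suc n)"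
          by (simp_all add: field_simps)
        with False have "x \<notin> {s + 1 / real (Suc n) <..< t + 2 / real (Suc n)}"
          unfolding greaterThanLessThan_iff atLeastAtMost_iff by linarith
        then have "\<phi> n x = 0"
          by (rule \<phi>_zero)
        with False show ?thesis by simp
      qed
    qed
  qed measurable
  then have "(\<lambda>n. \<integral>x. deriv (\<phi> n) x * m x \<partial>lborel) \<longlonglongrightarrow> - (LBINT x. indicator {s<..t} x * \<gamma> x)"
    by (rule Lim_transform_eventually) (use key in \<open>auto simp: eventually_sequentially intro!: exI[of _ N]\<close>)
  ultimately have "m s - m t = - (LBINT x. indicator {s<..t} x * \<gamma> x)"
    using LIMSEQ_unique by blast
  then show ?thesis by simp
qed

text \<open>
  The combination of the two previous facts: a functional \<open>l\<close> applied to a function with a weak derivative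
  in \<open>X\<close> gives a primitive of \<open>l\<close> applied to the derivative. Here \<open>m\<close> is the continuous version of \<open>l \<circ> f\<close>,
  and \<open>\<gamma>\<close> is a version of \<open>l \<circ> g\<close> that is known to be Borel.
\<close>

lemma bochner_H1_deriv_functional:
  fixes l :: "('p \<Rightarrow> 'b::real_normed_vector) \<Rightarrow> real" and m \<gamma> :: "real \<Rightarrow> real"
  assumes H1: "bochner_H1_deriv T X N f g"
    and X: "\<And>f g a b. f \<in> X \<Longrightarrow> g \<in> X \<Longrightarrow> (\<lambda>p. a *\<^sub>R f p + b *\<^sub>R g p) \<in> X"
    and lin: "\<And>f g a b. f \<in> X \<Longrightarrow> g \<in> X \<Longrightarrow> l (\<lambda>p. a *\<^sub>R f p + b *\<^sub>R g p) = a * l f + b * l g"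
    and C: "C > 0" "\<And>f. f \<in> X \<Longrightarrow> \<bar>l f\<bar> \<le> C * N f"
    and m: "continuous_on {0..T} m" "AE t in lebesgue_on {0<..<T}. l (f t) = m t"
    and \<gamma>: "\<gamma> \<in> borel_measurable borel" "\<And>x. \<bar>\<gamma> x\<bar> \<le> B" "AE t in lebesgue_on {0<..<T}. l (g t) = \<gamma> t"
    and st: "0 \<le> s" "s \<le> t" "t < T"
  shows "m t - m s = (LBINT r. indicator {s<..t} r * \<gamma> r)"
proof -
  let ?M = "lebesgue_on {0<..<T}"
  have fin: "finite_measure ?M"
    using st by (intro finite_measureI) (simp add: space_restrict_space emeasure_restrict_space)
  interpret finite_measure ?M by fact
  define \<mu> where "\<mu> x = m (max 0 (min T x))" for x
  have \<mu>_cont: "continuous_on UNIV \<mu>"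
    unfolding \<mu>_def using st by (intro continuous_on_compose2[OF m(1)] continuous_intros) auto
  have \<mu>_eq: "\<mu> x = m x" if "x \<in> {0..T}" for x
    using that by (auto simp: \<mu>_def)
  have "bounded (m ` {0..T})"
    using m(1) by (intro compact_imp_bounded compact_continuous_image) auto
  then obtain Bm where "\<forall>x\<in>{0..T}. \<bar>m x\<bar> \<le> Bm"
    by (auto simp: bounded_real)
  then have \<mu>_bound: "\<bar>\<mu> x\<bar> \<le> Bm" for x
    using st by (auto simp: \<mu>_def)
  have meas: "h \<in> borel_measurable ?M" if "h \<in> borel_measurable borel" for h :: "real \<Rightarrow> real"
    using that by (intro measurable_restrict_space1 borel_measurable_lebesgueI)
  have fX: "AE t in ?M. f t \<in> X" and gX: "AE t in ?M. g t \<in> X"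
    using H1 by (auto simp: bochner_H1_deriv_def bochner_L2_def strongly_measurable_def)
  have scale: "l (\<lambda>p. a *\<^sub>R h p) = a * l h" if "h \<in> X" for a h
    using lin[OF that that, of a 0] by simp
  have "\<mu> t - \<mu> s = (LBINT r. indicator {s<..t} r * \<gamma> r)"
  proof (rule integral_of_weak_derivative[OF \<mu>_cont \<mu>_bound \<gamma>(1,2) _ st])
    fix \<phi> assume \<phi>: "test_function {0<..<T} \<phi>"
    obtain y where y: "has_bochner_integral_in ?M X N (\<lambda>t p. deriv \<phi> t *\<^sub>R f t p) y"
        "has_bochner_integral_in ?M X N (\<lambda>t p. - (\<phi> t *\<^sub>R g t p)) y"
      using H1 \<phi> by (auto simp: bochner_H1_deriv_def)
    have C01: "Ck (Suc 0) \<phi>"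
      using \<phi> by (simp add: test_function_def del: Ck.simps)
    then have cont: "continuous_on UNIV (deriv \<phi>)" "continuous_on UNIV \<phi>"
      using Ck_deriv(2)[OF C01] Ck_Suc_imp[OF C01] by simp_all
    have bdd: "\<exists>c. \<forall>x\<in>{0<..<T}. \<bar>h x\<bar> \<le> c" if "continuous_on UNIV h" for h :: "real \<Rightarrow> real"
    proof -
      have "bounded (h ` {0..T})"
        by (intro compact_imp_bounded compact_continuous_image continuous_on_subset[OF that]) auto
      then show ?thesis by (fastforce simp: bounded_real)
    qed
    obtain c1 c2 where c: "\<And>x. x \<in> {0<..<T} \<Longrightarrow> \<bar>deriv \<phi> x\<bar> \<le> c1" "\<And>x. x \<in> {0<..<T} \<Longrightarrow> \<bar>\<phi> x\<bar> \<le> c2"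
      using bdd[OF cont(1)] bdd[OF cont(2)] by blast
    have [measurable]: "deriv \<phi> \<in> borel_measurable borel" "\<phi> \<in> borel_measurable borel" "\<mu> \<in> borel_measurable borel" "\<gamma> \<in> borel_measurable borel"
      using cont \<mu>_cont \<gamma>(1) by (auto intro: borel_measurable_continuous_onI)
    have int: "integrable ?M (\<lambda>t. h1 t * h2 t)" if [measurable]: "h1 \<in> borel_measurable borel" "h2 \<in> borel_measurable borel"
      and b: "\<And>x. x \<in> {0<..<T} \<Longrightarrow> \<bar>h1 x\<bar> \<le> b1" "\<And>x. \<bar>h2 x\<bar> \<le> b2" for h1 h2 :: "real \<Rightarrow> real" and b1 b2
    proof (rule integrable_const_bound)
      show "AE t in ?M. norm (h1 t * h2 t) \<le> b1 * b2"
      proof (rule AE_I2)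
        fix t assume "t \<in> space ?M"
        then have "t \<in> {0<..<T}" by (simp add: space_restrict_space)
        from b(1)[OF this] b(2)[of t] show "norm (h1 t * h2 t) \<le> b1 * b2"
          unfolding real_norm_def abs_mult by (intro mult_mono) auto
      qed
    qed (intro meas, measurable)
    have "(\<integral>t. deriv \<phi> t * \<mu> t \<partial>?M) = l y"
    proof (rule has_bochner_integral_in_functional[OF fin y(1) X lin C])
      show "integrable ?M (\<lambda>t. deriv \<phi> t * \<mu> t)"
        by (rule int[OF _ _ c(1) \<mu>_bound]) measurable
      show "AE t in ?M. l (\<lambda>p. deriv \<phi> t *\<^sub>R f t p) = deriv \<phi> t * \<mu> t"
        using fX m(2) AE_space
        by eventually_elim (auto simp: scale \<mu>_eq space_restrict_space)
    qed
    moreover have "(\<integral>t. - \<phi> t * \<gamma> t \<partial>?M) = l y"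
    proof (rule has_bochner_integral_in_functional[OF fin y(2) X lin C])
      show "integrable ?M (\<lambda>t. - \<phi> t * \<gamma> t)"
        by (rule int[OF _ _ _ \<gamma>(2)]) (use c(2) in auto)
      show "AE t in ?M. l (\<lambda>p. - (\<phi> t *\<^sub>R g t p)) = - \<phi> t * \<gamma> t"
        using gX \<gamma>(3)
      proof eventually_elim
        case (elim t)
        then show ?case using scale[OF elim(1), of "- \<phi> t"] by simp
      qed
    qed
    ultimately show "(\<integral>t. deriv \<phi> t * \<mu> t \<partial>?M) = - (\<integral>t. \<phi> t * \<gamma> t \<partial>?M)"
      by simp
  qed
  then show ?thesis
    using st by (simp add: \<mu>_eq)
qed

section \<open>Borel representatives and product measure\<close>

lemma AE_lborel_lebesgue_on_iff:
  fixes S :: "'a::euclidean_space set"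
  assumes "S \<in> sets borel"
  shows "(AE x in lebesgue_on S. P x) \<longleftrightarrow> (AE x in lborel. x \<in> S \<longrightarrow> P x)"
  using assms by (simp add: AE_restrict_space_iff AE_completion_iff)

lemma borel_representative:
  fixes f :: "'a::euclidean_space \<Rightarrow> 'b::euclidean_space"
  assumes S: "S \<in> sets borel" and f: "f \<in> borel_measurable (lebesgue_on S)"
  obtains g where "g \<in> borel_measurable borel" "\<And>x. x \<notin> S \<Longrightarrow> g x = 0" "AE x in lborel. x \<in> S \<longrightarrow> f x = g x"
proof -
  define h where "h x = (if x \<in> S then f x else 0)" for x
  have h: "h \<in> borel_measurable lebesgue"
    using f S unfolding h_def[abs_def] by (simp add: borel_measurable_if)
  have "\<exists>g\<in>borel_measurable lborel. AE x in lborel. h x \<bullet> b = g x" for b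
    using h by (intro completion_ex_borel_measurable_real) simp
  then obtain g where g: "\<And>b. g b \<in> borel_measurable lborel" "\<And>b. AE x in lborel. h x \<bullet> b = g b x"
    by metis
  define k where "k x = (\<Sum>b\<in>Basis. g b x *\<^sub>R b)" for x
  have [measurable]: "k \<in> borel_measurable borel"
    using g(1) unfolding k_def[abs_def] by (intro borel_measurable_sum borel_measurable_scaleR) auto
  have "AE x in lborel. \<forall>b\<in>Basis. h x \<bullet> b = g b x"
    using g(2) by (simp add: AE_finite_all)
  then have k: "AE x in lborel. h x = k x"
  proof eventually_elim
    case (elim x)
    then have "k x = (\<Sum>b\<in>Basis. (h x \<bullet> b) *\<^sub>R b)" by (simp add: k_def)
    then show ?case by (simp add: euclidean_representation)
  qed
  show ?thesis
  proof
    show "(\<lambda>x. if x \<in> S then k x else 0) \<in> borel_measurable borel"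
      using S by (intro measurable_If_set) simp_all
    show "AE x in lborel. x \<in> S \<longrightarrow> f x = (if x \<in> S then k x else 0)"
      using k by eventually_elim (auto simp: h_def)
  qed simp
qed

lemma bounded_borel_representative:
  fixes f :: "'a::euclidean_space \<Rightarrow> 'b::euclidean_space"
  assumes S: "S \<in> sets borel" and f: "f \<in> borel_measurable (lebesgue_on S)"
    and C: "AE x in lebesgue_on S. norm (f x) \<le> C" "0 \<le> C"
  obtains g where "g \<in> borel_measurable borel" "\<And>x. x \<notin> S \<Longrightarrow> g x = 0" "AE x in lborel. x \<in> S \<longrightarrow> f x = g x"
    "\<And>x. norm (g x) \<le> C"
proof -
  obtain g where g: "g \<in> borel_measurable borel" "\<And>x. x \<notin> S \<Longrightarrow> g x = 0" "AE x in lborel. x \<in> S \<longrightarrow> f x = g x"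
    using borel_representative[OF S f] by blast
  have [measurable]: "g \<in> borel_measurable borel" by fact
  show ?thesis
  proof
    show "(\<lambda>x. if norm (g x) \<le> C then g x else 0) \<in> borel_measurable borel" by measurable
    show "AE x in lborel. x \<in> S \<longrightarrow> f x = (if norm (g x) \<le> C then g x else 0)"
      using g(3) C(1)[unfolded AE_lborel_lebesgue_on_iff[OF S]] by eventually_elim auto
  qed (use g(2) C(2) in auto)
qed

lemma AE_lborel_sections:
  fixes P :: "'a::euclidean_space \<times> 'b::euclidean_space \<Rightarrow> bool"
  assumes "AE z in lborel. P z"
  shows "AE t in lborel. AE x in lborel. P (t, x)"
  using assms unfolding lborel_prod[symmetric] by (rule lborel_pair.AE_pair)

lemma AE_lborel_pairI:
  fixes P :: "'a::euclidean_space \<times> 'b::euclidean_space \<Rightarrow> bool"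
  assumes "{z. P z} \<in> sets borel" "AE t in lborel. AE x in lborel. P (t, x)"
  shows "AE z in lborel. P z"
proof -
  have "{z \<in> space (lborel \<Otimes>\<^sub>M lborel). P z} \<in> sets (lborel \<Otimes>\<^sub>M lborel)"
    unfolding lborel_prod using assms(1) by simp
  then show ?thesis
    using lborel_pair.AE_pair_measure[of P] assms(2) unfolding lborel_prod by blast
qed

lemma nn_integral_lborel_pair:
  fixes f :: "'a::euclidean_space \<times> 'b::euclidean_space \<Rightarrow> ennreal"
  assumes "f \<in> borel_measurable borel"
  shows "(\<integral>\<^sup>+z. f z \<partial>lborel) = (\<integral>\<^sup>+t. \<integral>\<^sup>+x. f (t, x) \<partial>lborel \<partial>lborel)"
  using lborel.nn_integral_fst[of f lborel] assms unfolding lborel_prod by simp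

section \<open>Continuity of translations\<close>

text \<open>
  A measurable function is the limit almost everywhere of continuous functions. Projecting their values to
  the ball that contains the values of \<open>f\<close> and cutting them off outside a large ball makes the convergence
  dominated.
\<close>

lemma L1_approximation_by_continuous:
  fixes f :: "'a::euclidean_space \<Rightarrow> 'b::euclidean_space"
  assumes f: "f \<in> borel_measurable borel" "\<And>x. norm (f x) \<le> B" "\<And>x. norm x > R \<Longrightarrow> f x = 0" and "\<epsilon> > 0"
  obtains h where "continuous_on UNIV h" "\<And>x. norm x > R + 1 \<Longrightarrow> h x = 0"
    "(\<integral>\<^sup>+x. ennreal (norm (h x - f x)) \<partial>lborel) < ennreal \<epsilon>"
proof -
  have B: "B \<ge> 0" using f(2)[of 0] norm_ge_zero[of "f 0"] by linarith
  have "f measurable_on UNIV"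
    using f(1) by (intro lebesgue_measurable_imp_measurable_on borel_measurable_lebesgueI) auto
  then obtain N g where N: "negligible N" and g: "\<And>n. continuous_on UNIV (g n)" "\<And>x. x \<notin> N \<Longrightarrow> (\<lambda>n. g n x) \<longlonglongrightarrow> f x"
    unfolding measurable_on_def by auto
  define cut where "cut x = max 0 (min 1 (R + 1 - norm x))" for x :: 'a
  define h where "h n x = cut x *\<^sub>R closest_point (cball 0 B) (g n x)" for n x
  have cp: "continuous_on UNIV (closest_point (cball (0::'b) B))"
    using B by (intro continuous_on_closest_point) auto
  have cpB: "norm (closest_point (cball 0 B) y) \<le> B" for y :: 'b
    using closest_point_in_set[of "cball (0::'b) B" y] B by (auto simp: dist_norm)
  have h_cont: "continuous_on UNIV (h n)" for n
    unfolding h_def cut_def by (intro continuous_intros continuous_on_compose2[OF cp g(1)]) auto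
  have [measurable]: "h n \<in> borel_measurable borel" "f \<in> borel_measurable borel" for n
    using f(1) by (auto intro: borel_measurable_continuous_onI h_cont)
  have h0: "h n x = 0" if "norm x > R + 1" for n x
    using that by (simp add: h_def cut_def)
  have hB: "norm (h n x) \<le> B" for n x
  proof -
    have "norm (h n x) \<le> 1 * B"
      unfolding h_def norm_scaleR using cpB by (intro mult_mono) (auto simp: cut_def)
    then show ?thesis by simp
  qed
  have hf: "(\<lambda>n. h n x) \<longlonglongrightarrow> f x" if "x \<notin> N" for x
  proof -
    have "isCont (closest_point (cball 0 B)) (f x)"
      using cp by (simp add: continuous_on_eq_continuous_at)
    then have "(\<lambda>n. closest_point (cball 0 B) (g n x)) \<longlonglongrightarrow> closest_point (cball 0 B) (f x)"
      using g(2)[OF that] by (rule isCont_tendsto_compose)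
    moreover have "closest_point (cball 0 B) (f x) = f x"
      using f(2)[of x] by (intro closest_point_self) simp
    ultimately have "(\<lambda>n. h n x) \<longlonglongrightarrow> cut x *\<^sub>R f x"
      unfolding h_def using tendsto_scaleR[OF tendsto_const] by metis
    also have "cut x *\<^sub>R f x = f x"
      using f(3)[of x] by (cases "norm x > R") (auto simp: cut_def)
    finally show ?thesis .
  qed
  have "N \<in> null_sets lebesgue"
    using N negligible_iff_null_sets by blast
  from AE_not_in[OF this] have aeN: "AE x in lborel. x \<notin> N"
    by (simp only: AE_completion_iff)
  let ?w = "\<lambda>x. 2 * B * indicator (cball (0::'a) (R + 1)) x"
  have w: "integrable lborel ?w"
    by (intro integrable_mult_right integrable_real_indicator emeasure_bounded_finite) auto
  have dom: "norm (norm (h n x - f x)) \<le> ?w x" for n x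
  proof (cases "norm x > R + 1")
    case True
    then have "h n x = 0" "f x = 0" using h0 f(3) by auto
    then show ?thesis using B by simp
  next
    case False
    have "norm (h n x - f x) \<le> norm (h n x) + norm (f x)" by (rule norm_triangle_ineq4)
    with False hB[of n x] f(2)[of x] show ?thesis by (simp add: not_less)
  qed
  have "(\<lambda>n. \<integral>x. norm (h n x - f x) \<partial>lborel) \<longlonglongrightarrow> (\<integral>x. 0 \<partial>(lborel :: 'a measure))"
  proof (rule integral_dominated_convergence[OF _ _ w])
    show "AE x in lborel. (\<lambda>n. norm (h n x - f x)) \<longlonglongrightarrow> 0"
      using aeN
    proof eventually_elim
      case (elim x)
      from tendsto_norm[OF tendsto_diff[OF hf[OF elim] tendsto_const[of "f x"]]] show ?case by simp
    qed
  qed (use dom in \<open>auto intro!: AE_I2\<close>)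
  then have "eventually (\<lambda>n. (LBINT x. norm (h n x - f x)) < \<epsilon>) sequentially"
    using \<open>\<epsilon> > 0\<close> by (auto intro: order_tendstoD)
  then obtain n where n: "(LBINT x. norm (h n x - f x)) < \<epsilon>"
    by (auto simp: eventually_sequentially)
  have "integrable lborel (\<lambda>x. norm (h n x - f x))"
    using w by (rule Bochner_Integration.integrable_bound) (use dom[of n] B in \<open>auto intro!: AE_I2 simp: indicator_def\<close>)
  then have "(\<integral>\<^sup>+x. ennreal (norm (h n x - f x)) \<partial>lborel) = ennreal (LBINT x. norm (h n x - f x))"
    by (intro nn_integral_eq_integral) auto
  also have "\<dots> < ennreal \<epsilon>"
    using n \<open>\<epsilon> > 0\<close> by (intro ennreal_lessI) auto
  finally show ?thesis
    using h_cont[of n] h0[of _ n] that by blast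
qed

lemma nn_integral_lborel_shift:
  fixes f :: "'a::euclidean_space \<Rightarrow> ennreal"
  assumes "f \<in> borel_measurable borel"
  shows "(\<integral>\<^sup>+x. f (y + x) \<partial>lborel) = (\<integral>\<^sup>+x. f x \<partial>lborel)"
proof -
  have "(\<integral>\<^sup>+x. f x \<partial>lborel) = (\<integral>\<^sup>+x. f x \<partial>(distr lborel borel ((+) y)))"
    by (simp add: lborel_distr_plus)
  also have "\<dots> = (\<integral>\<^sup>+x. f (y + x) \<partial>lborel)"
    using assms by (intro nn_integral_distr) auto
  finally show ?thesis ..
qed

text \<open>
  For continuous functions with compact support this is uniform continuity; the general case follows by
  approximation, because translations preserve the \<open>L\<^sup>1\<close> norm.
\<close>

lemma L1_translation_continuous:
  fixes f :: "'a::euclidean_space \<Rightarrow> 'b::euclidean_space"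
  assumes f: "f \<in> borel_measurable borel" "\<And>x. norm (f x) \<le> B" "\<And>x. norm x > R \<Longrightarrow> f x = 0" and "\<epsilon> > 0"
  obtains \<delta> where "\<delta> > 0" "\<And>y. norm y < \<delta> \<Longrightarrow> (\<integral>\<^sup>+x. ennreal (norm (f (y + x) - f x)) \<partial>lborel) \<le> ennreal \<epsilon>"
proof -
  have [measurable]: "f \<in> borel_measurable borel" by fact
  obtain h where h: "continuous_on UNIV h" "\<And>x. norm x > R + 1 \<Longrightarrow> h x = 0"
    "(\<integral>\<^sup>+x. ennreal (norm (h x - f x)) \<partial>lborel) < ennreal (\<epsilon> / 4)"
    by (rule L1_approximation_by_continuous[OF f(1), of B R "\<epsilon> / 4"]) (use f \<open>\<epsilon> > 0\<close> in auto)
  have [measurable]: "h \<in> borel_measurable borel"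
    using h(1) by (rule borel_measurable_continuous_onI)
  define v where "v = measure lborel (cball (0::'a) (R + 2))"
  have v: "emeasure lborel (cball (0::'a) (R + 2)) = ennreal v" "v \<ge> 0"
    unfolding v_def using emeasure_bounded_finite[of "cball (0::'a) (R + 2)"]
    by (auto intro!: emeasure_eq_ennreal_measure)
  define \<epsilon>' where "\<epsilon>' = \<epsilon> / (2 * (v + 1))"
  have \<epsilon>': "\<epsilon>' > 0" "\<epsilon>' * v \<le> \<epsilon> / 2"
    using v(2) \<open>\<epsilon> > 0\<close> by (auto simp: \<epsilon>'_def field_simps)
  have "uniformly_continuous_on (cball 0 (R + 3)) h"
    by (intro compact_uniformly_continuous continuous_on_subset[OF h(1)]) auto
  then obtain \<delta> where \<delta>: "\<delta> > 0" "\<And>x x'. x \<in> cball 0 (R + 3) \<Longrightarrow> x' \<in> cball 0 (R + 3) \<Longrightarrow> dist x' x < \<delta> \<Longrightarrow> dist (h x') (h x) < \<epsilon>'"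
    using \<epsilon>'(1) unfolding uniformly_continuous_on_def by meson
  show ?thesis
  proof
    show "min \<delta> 1 > 0" using \<delta>(1) by simp
    fix y :: 'a assume y: "norm y < min \<delta> 1"
    have hd: "norm (h (y + x) - h x) \<le> \<epsilon>' * indicator (cball 0 (R + 2)) x" for x
    proof (cases "norm x \<le> R + 2")
      case True
      have "norm (y + x) \<le> R + 3"
        using norm_triangle_ineq[of y x] y True by linarith
      then have "dist (h (y + x)) (h x) < \<epsilon>'"
        using True y by (intro \<delta>(2); simp only: mem_cball_0) (auto simp: dist_norm)
      with True show ?thesis by (simp add: dist_norm)
    next
      case False
      have "norm (y + x) > R + 1"
        using norm_triangle_ineq4[of "y + x" y] y False by simp
      then show ?thesis using h(2) False by simp
    qed
    have "(\<integral>\<^sup>+x. ennreal (norm (f (y + x) - f x)) \<partial>lborel) \<le>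
      (\<integral>\<^sup>+x. ennreal (norm (h (y + x) - f (y + x))) + (ennreal (\<epsilon>') * indicator (cball 0 (R + 2)) x + ennreal (norm (h x - f x))) \<partial>lborel)"
    proof (rule nn_integral_mono)
      fix x
      have "norm (f (y + x) - f x) \<le> norm (h (y + x) - f (y + x)) + (norm (h (y + x) - h x) + norm (h x - f x))"
        using norm_triangle_ineq[of "f (y + x) - h (y + x)" "(h (y + x) - h x) + (h x - f x)"]
          norm_triangle_ineq[of "h (y + x) - h x" "h x - f x"] by (simp add: norm_minus_commute)
      also have "\<dots> \<le> norm (h (y + x) - f (y + x)) + (\<epsilon>' * indicator (cball 0 (R + 2)) x + norm (h x - f x))"
        using hd by simp
      finally have "ennreal (norm (f (y + x) - f x)) \<le> ennreal (norm (h (y + x) - f (y + x)) + (\<epsilon>' * indicator (cball 0 (R + 2)) x + norm (h x - f x)))"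
        by (rule ennreal_leI)
      also have "\<dots> = ennreal (norm (h (y + x) - f (y + x))) + (ennreal \<epsilon>' * indicator (cball 0 (R + 2)) x + ennreal (norm (h x - f x)))"
        using \<epsilon>'(1) by (simp add: ennreal_plus ennreal_mult' ennreal_indicator)
      finally show "ennreal (norm (f (y + x) - f x)) \<le> ennreal (norm (h (y + x) - f (y + x))) + (ennreal \<epsilon>' * indicator (cball 0 (R + 2)) x + ennreal (norm (h x - f x)))" .
    qed
    also have "\<dots> = (\<integral>\<^sup>+x. ennreal (norm (h x - f x)) \<partial>lborel) + (ennreal \<epsilon>' * ennreal v + (\<integral>\<^sup>+x. ennreal (norm (h x - f x)) \<partial>lborel))"
    proof -
      have shift: "(\<integral>\<^sup>+x. ennreal (norm (h (y + x) - f (y + x))) \<partial>lborel) = (\<integral>\<^sup>+x. ennreal (norm (h x - f x)) \<partial>lborel)"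
        by (rule nn_integral_lborel_shift[of "\<lambda>x. ennreal (norm (h x - f x))" y]) measurable
      have mid: "(\<integral>\<^sup>+x. ennreal \<epsilon>' * indicator (cball 0 (R + 2)) x \<partial>(lborel :: 'a measure)) = ennreal \<epsilon>' * ennreal v"
        by (subst nn_integral_cmult_indicator) (simp_all add: v(1))
      have [measurable]: "cball (0::'a) (R + 2) \<in> sets borel" by simp
      have meas: "(\<lambda>x. ennreal (norm (h (y + x) - f (y + x)))) \<in> borel_measurable lborel"
        "(\<lambda>x. ennreal (norm (h x - f x))) \<in> borel_measurable lborel"
        "(\<lambda>x. ennreal \<epsilon>' * indicator (cball 0 (R + 2)) x) \<in> borel_measurable (lborel :: 'a measure)"
        by measurable
      show ?thesis
        by (simp only: nn_integral_add[OF meas(1) borel_measurable_add[OF meas(3,2)]]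
            nn_integral_add[OF meas(3,2)] shift mid)
    qed
    also have "\<dots> \<le> ennreal (\<epsilon> / 4) + (ennreal (\<epsilon> / 2) + ennreal (\<epsilon> / 4))"
    proof (intro add_mono less_imp_le[OF h(3)])
      show "ennreal \<epsilon>' * ennreal v \<le> ennreal (\<epsilon> / 2)"
        using \<epsilon>' by (simp add: ennreal_mult'[symmetric] ennreal_leI)
    qed
    also have "\<dots> = ennreal \<epsilon>"
      using \<open>\<epsilon> > 0\<close> by (simp add: ennreal_plus[symmetric] del: ennreal_plus)
    finally show "(\<integral>\<^sup>+x. ennreal (norm (f (y + x) - f x)) \<partial>lborel) \<le> ennreal \<epsilon>" .
  qed
qed

section \<open>The energy identity\<close>

text \<open>
  The increments of \<open>e\<close> are controlled by \<open>D\<close>, and \<open>D\<close> is small in the mean near the diagonal. Averaging the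
  increments over a step \<open>h\<close> and over all starting times below \<open>s\<close> gives
  \<open>\<integral>\<^sub>0\<^sup>s (e (h + \<tau>) - e \<tau>) d\<tau> = o(h)\<close>. The left-hand side is also the difference of the integrals of \<open>e\<close> over the
  intervals of length \<open>h\<close> that start at \<open>s\<close> and at \<open>0\<close>, hence \<open>h (e s - e 0) + o(h)\<close>.
\<close>

lemma constant_if_increments_small:
  fixes e :: "real \<Rightarrow> real" and D :: "real \<Rightarrow> real \<Rightarrow> ennreal"
  assumes e: "continuous_on {0..T} e"
    and D[measurable]: "(\<lambda>(s, t). D s t) \<in> borel_measurable borel"
    and A: "AE t in lborel. t \<in> {0<..<T} \<longrightarrow> t \<in> A"
    and inc: "\<And>s t. s \<in> A \<Longrightarrow> t \<in> A \<Longrightarrow> 0 < s \<Longrightarrow> s < t \<Longrightarrow> t < T \<Longrightarrow>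
      ennreal \<bar>e t - e s\<bar> \<le> (\<integral>\<^sup>+\<rho>. indicator {s<..t} \<rho> * (D \<rho> t + D \<rho> s) \<partial>lborel)"
    and small: "\<And>\<epsilon>. \<epsilon> > 0 \<Longrightarrow> \<exists>\<delta>>0. \<forall>h. \<bar>h\<bar> < \<delta> \<longrightarrow> (\<integral>\<^sup>+\<tau>. D \<tau> (h + \<tau>) \<partial>lborel) \<le> ennreal \<epsilon>"
    and s: "0 \<le> s" "s < T"
  shows "e s = e 0"
proof (cases "s = 0")
  case False
  with s have s0: "s > 0" by simp
  have D'[measurable]: "(\<lambda>x. D (f x) (g x)) \<in> borel_measurable M"
    if [measurable]: "f \<in> borel_measurable M" "g \<in> borel_measurable M" for f g :: "'x \<Rightarrow> real" and M
    using measurable_compose[OF borel_measurable_Pair[OF that] D] by simp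
  have "\<bar>e s - e 0\<bar> \<le> 4 * \<epsilon>" if "\<epsilon> > 0" for \<epsilon>
  proof -
    obtain \<delta> where \<delta>: "\<delta> > 0" "\<And>h. \<bar>h\<bar> < \<delta> \<Longrightarrow> (\<integral>\<^sup>+\<tau>. D \<tau> (h + \<tau>) \<partial>lborel) \<le> ennreal \<epsilon>"
      using small[OF \<open>\<epsilon> > 0\<close>] by blast
    obtain \<delta>1 where \<delta>1: "\<delta>1 > 0" "\<And>x. x \<in> {0..T} \<Longrightarrow> dist x s < \<delta>1 \<Longrightarrow> dist (e x) (e s) < \<epsilon>"
      using e s \<open>\<epsilon> > 0\<close> unfolding continuous_on_iff by (meson atLeastAtMost_iff less_imp_le)
    obtain \<delta>2 where \<delta>2: "\<delta>2 > 0" "\<And>x. x \<in> {0..T} \<Longrightarrow> dist x 0 < \<delta>2 \<Longrightarrow> dist (e x) (e 0) < \<epsilon>"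
    proof -
      have "0 \<in> {0..T}" using s by simp
      then show ?thesis using e that \<open>\<epsilon> > 0\<close> unfolding continuous_on_iff by meson
    qed
    define h where "h = min (min \<delta> \<delta>1) (min \<delta>2 (T - s)) / 2"
    have h: "h > 0" "h < \<delta>" "h < \<delta>1" "h < \<delta>2" "s + h < T"
      using \<delta>(1) \<delta>1(1) \<delta>2(1) s unfolding h_def by (simp_all add: min_def field_simps)
    have cont: "continuous_on {a..b} e" if "0 \<le> a" "b \<le> T" for a b
      using e that by (elim continuous_on_subset) auto
    have cont_h: "continuous_on {0..s} (\<lambda>\<tau>. e (h + \<tau>))"
      using h s by (intro continuous_on_compose2[OF e] continuous_intros) auto
    have int: "e integrable_on {a..b}" if "0 \<le> a" "b \<le> T" for a b
      using cont[OF that] by (rule integrable_continuous_real)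

    have near: "\<bar>integral {a..a + h} e - h * e a\<bar> \<le> \<epsilon> * h"
      if a: "0 \<le> a" "a + h \<le> T" "\<And>x. x \<in> {a..a + h} \<Longrightarrow> dist (e x) (e a) < \<epsilon>" for a
    proof -
      have "integral {a..a + h} (\<lambda>x. e x - e a) = integral {a..a + h} e - integral {a..a + h} (\<lambda>x. e a)"
        using int a by (intro integral_diff) auto
      moreover have "norm (integral {a..a + h} (\<lambda>x. e x - e a)) \<le> \<epsilon> * (a + h - a)"
        using a h cont[of a "a + h"] by (intro integral_bound continuous_intros) (auto simp: dist_real_def less_imp_le)
      ultimately show ?thesis using h by simp
    qed
    have near1: "\<bar>integral {s..s + h} e - h * e s\<bar> \<le> \<epsilon> * h"
      using h s \<delta>1(2) by (intro near) (auto simp: dist_real_def)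
    have near2: "\<bar>integral {0..0 + h} e - h * e 0\<bar> \<le> \<epsilon> * h"
      using h s \<delta>2(2) by (intro near) (auto simp: dist_real_def)

    have "integral {0..h} e + integral {h..s + h} e = integral {0..s + h} e"
      using h s int by (intro Henstock_Kurzweil_Integration.integral_combine) auto
    moreover have "integral {0..s} e + integral {s..s + h} e = integral {0..s + h} e"
      using h s int by (intro Henstock_Kurzweil_Integration.integral_combine) auto
    moreover have "integral {0..s} (\<lambda>\<tau>. e (h + \<tau>)) = integral {h..s + h} e"
      using integral_shift_Icc_real[of 0 s e h] by (simp add: o_def)
    moreover have "integral {0..s} (\<lambda>\<tau>. e (h + \<tau>) - e \<tau>) = integral {0..s} (\<lambda>\<tau>. e (h + \<tau>)) - integral {0..s} e"
      using cont_h s cont[of 0 s] by (intro integral_diff integrable_continuous_real) auto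
    ultimately have shifted: "integral {0..s} (\<lambda>\<tau>. e (h + \<tau>) - e \<tau>) = integral {s..s + h} e - integral {0..h} e"
      by linarith

    have contd: "continuous_on {0..s} (\<lambda>\<tau>. e (h + \<tau>) - e \<tau>)"
      using cont_h cont[of 0 s] s by (intro continuous_intros) auto
    then have absint: "((\<lambda>\<tau>. \<bar>e (h + \<tau>) - e \<tau>\<bar>) has_integral integral {0..s} (\<lambda>\<tau>. \<bar>e (h + \<tau>) - e \<tau>\<bar>)) {0..s}"
      by (intro integrable_integral integrable_continuous_real continuous_on_rabs)
    \<comment> \<open>A Borel null set contains the bad times, so that its translate is a null set as well.\<close>
    obtain N where N: "N \<in> null_sets lborel" "{t. \<not> (t \<in> {0<..<T} \<longrightarrow> t \<in> A)} \<subseteq> N"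
      using A by (auto simp: eventually_ae_filter)
    have NA: "t \<in> A" if "t \<notin> N" "0 < t" "t < T" for t
      using N(2) that by auto
    have [measurable]: "N \<in> sets borel" using N(1) by auto
    have aeN: "AE \<tau> in lborel. \<tau> \<notin> N \<and> h + \<tau> \<notin> N \<and> \<tau> \<noteq> 0 \<and> \<tau> \<noteq> s"
    proof -
      have 1: "AE \<tau> in lborel. \<tau> \<notin> N"
        by (rule AE_not_in[OF N(1)])
      have "AE \<tau> in lborel. h + 1 * \<tau> \<notin> N"
        by (rule AE_borel_affine[OF _ _ 1]) simp_all
      with 1 AE_lborel_singleton[of 0] AE_lborel_singleton[of s] show ?thesis
        by eventually_elim simp
    qed
    have "ennreal \<bar>integral {0..s} (\<lambda>\<tau>. e (h + \<tau>) - e \<tau>)\<bar> \<le> ennreal (integral {0..s} (\<lambda>\<tau>. \<bar>e (h + \<tau>) - e \<tau>\<bar>))"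
      unfolding real_norm_def[symmetric]
      by (intro ennreal_leI Henstock_Kurzweil_Integration.integral_norm_bound_integral
            integrable_continuous_real continuous_on_norm contd order_refl)
    also have "\<dots> = (\<integral>\<^sup>+\<tau>. ennreal (indicator {0..s} \<tau> * \<bar>e (h + \<tau>) - e \<tau>\<bar>) \<partial>lborel)"
      using nn_integral_has_integral_lebesgue[OF _ absint] by (simp add: nn_integral_completion)
    also have "\<dots> \<le> (\<integral>\<^sup>+\<tau>. \<integral>\<^sup>+\<sigma>. indicator {0<..h} \<sigma> * (D (\<tau> + \<sigma>) (h + \<tau>) + D (\<tau> + \<sigma>) \<tau>) \<partial>lborel \<partial>lborel)"
    proof (rule nn_integral_mono_AE)
      show "AE \<tau> in lborel. ennreal (indicator {0..s} \<tau> * \<bar>e (h + \<tau>) - e \<tau>\<bar>)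
          \<le> (\<integral>\<^sup>+\<sigma>. indicator {0<..h} \<sigma> * (D (\<tau> + \<sigma>) (h + \<tau>) + D (\<tau> + \<sigma>) \<tau>) \<partial>lborel)"
        using aeN
      proof eventually_elim
        case (elim \<tau>)
        show ?case
        proof (cases "\<tau> \<in> {0<..<s}")
          case True
          then have "ennreal \<bar>e (h + \<tau>) - e \<tau>\<bar> \<le> (\<integral>\<^sup>+\<rho>. indicator {\<tau><..h + \<tau>} \<rho> * (D \<rho> (h + \<tau>) + D \<rho> \<tau>) \<partial>lborel)"
            using elim h by (intro inc NA) auto
          also have "\<dots> = (\<integral>\<^sup>+\<sigma>. indicator {\<tau><..h + \<tau>} (\<tau> + \<sigma>) * (D (\<tau> + \<sigma>) (h + \<tau>) + D (\<tau> + \<sigma>) \<tau>) \<partial>lborel)"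
            by (rule nn_integral_lborel_shift[symmetric]) measurable
          also have "\<dots> = (\<integral>\<^sup>+\<sigma>. indicator {0<..h} \<sigma> * (D (\<tau> + \<sigma>) (h + \<tau>) + D (\<tau> + \<sigma>) \<tau>) \<partial>lborel)"
            by (intro nn_integral_cong) (auto simp: indicator_def)
          finally show ?thesis using True by simp
        next
          case False
          with elim show ?thesis by (auto simp: indicator_def)
        qed
      qed
    qed
    also have "\<dots> = (\<integral>\<^sup>+\<sigma>. \<integral>\<^sup>+\<tau>. indicator {0<..h} \<sigma> * (D (\<tau> + \<sigma>) (h + \<tau>) + D (\<tau> + \<sigma>) \<tau>) \<partial>lborel \<partial>lborel)"
      by (rule lborel_pair.Fubini') measurable
    also have "\<dots> \<le> (\<integral>\<^sup>+\<sigma>. (ennreal (2 * \<epsilon>)) * indicator {0<..h} \<sigma> \<partial>lborel)"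
    proof (rule nn_integral_mono)
      fix \<sigma>
      show "(\<integral>\<^sup>+\<tau>. indicator {0<..h} \<sigma> * (D (\<tau> + \<sigma>) (h + \<tau>) + D (\<tau> + \<sigma>) \<tau>) \<partial>lborel) \<le> ennreal (2 * \<epsilon>) * indicator {0<..h} \<sigma>"
      proof (cases "\<sigma> \<in> {0<..h}")
        case True
        have "(\<integral>\<^sup>+\<tau>. D (\<tau> + \<sigma>) (h + \<tau>) \<partial>lborel) = (\<integral>\<^sup>+\<tau>. D \<tau> ((h - \<sigma>) + \<tau>) \<partial>lborel)"
          using nn_integral_lborel_shift[of "\<lambda>\<tau>. D \<tau> ((h - \<sigma>) + \<tau>)" \<sigma>] by (simp add: add.commute add.left_commute)
        also have "\<dots> \<le> ennreal \<epsilon>"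
          using True h by (intro \<delta>(2)) auto
        finally have 1: "(\<integral>\<^sup>+\<tau>. D (\<tau> + \<sigma>) (h + \<tau>) \<partial>lborel) \<le> ennreal \<epsilon>" .
        have "(\<integral>\<^sup>+\<tau>. D (\<tau> + \<sigma>) \<tau> \<partial>lborel) = (\<integral>\<^sup>+\<tau>. D \<tau> ((- \<sigma>) + \<tau>) \<partial>lborel)"
          using nn_integral_lborel_shift[of "\<lambda>\<tau>. D \<tau> ((- \<sigma>) + \<tau>)" \<sigma>] by (simp add: add.commute add.left_commute)
        also have "\<dots> \<le> ennreal \<epsilon>"
          using True h by (intro \<delta>(2)) auto
        finally have 2: "(\<integral>\<^sup>+\<tau>. D (\<tau> + \<sigma>) \<tau> \<partial>lborel) \<le> ennreal \<epsilon>" .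
        have "(\<integral>\<^sup>+\<tau>. D (\<tau> + \<sigma>) (h + \<tau>) + D (\<tau> + \<sigma>) \<tau> \<partial>lborel) \<le> ennreal \<epsilon> + ennreal \<epsilon>"
          by (subst nn_integral_add) (auto intro!: add_mono 1 2)
        also have "\<dots> = ennreal (2 * \<epsilon>)"
          using \<open>\<epsilon> > 0\<close> by (simp add: ennreal_plus[symmetric] del: ennreal_plus)
        finally show ?thesis using True by simp
      qed simp
    qed
    also have "\<dots> = ennreal (2 * \<epsilon> * h)"
      using h \<open>\<epsilon> > 0\<close> by (simp add: nn_integral_cmult_indicator ennreal_mult')
    finally have "\<bar>integral {0..s} (\<lambda>\<tau>. e (h + \<tau>) - e \<tau>)\<bar> \<le> 2 * \<epsilon> * h"
      using h \<open>\<epsilon> > 0\<close> by (subst (asm) ennreal_le_iff) auto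
    with near1 near2 shifted have "\<bar>h * e s - h * e 0\<bar> \<le> 4 * \<epsilon> * h"
      by simp
    then have "h * \<bar>e s - e 0\<bar> \<le> h * (4 * \<epsilon>)"
      using h by (simp add: right_diff_distrib[symmetric] abs_mult mult.commute)
    then show ?thesis using h by simp
  qed
  note le = this
  show ?thesis
  proof (rule ccontr)
    assume "e s \<noteq> e 0"
    then show False using le[of "\<bar>e s - e 0\<bar> / 8"] by simp
  qed
qed simp

lemma integrable_bounded_Ioc:
  fixes \<beta> :: "real \<Rightarrow> real"
  assumes "\<beta> \<in> borel_measurable borel" "\<And>x. \<bar>\<beta> x\<bar> \<le> C"
  shows "integrable lborel (\<lambda>x. indicator {a<..b} x * \<beta> x)"
proof (rule Bochner_Integration.integrable_bound)
  show "integrable lborel (\<lambda>x. C * indicator {a<..b} x)"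
    by (intro integrable_mult_right integrable_real_indicator emeasure_bounded_finite) auto
  show "AE x in lborel. norm (indicator {a<..b} x * \<beta> x) \<le> norm (C * indicator {a<..b} x)"
    using assms(2) by (intro AE_I2) (auto simp: indicator_def intro: order_trans[OF _ abs_ge_self])
qed (use assms(1) in measurable)

lemma integral_Ioc_diff:
  fixes \<beta> :: "real \<Rightarrow> real"
  assumes \<beta>: "\<beta> \<in> borel_measurable borel" "\<And>x. \<bar>\<beta> x\<bar> \<le> C" and "a \<le> s" "s \<le> t"
  shows "(LBINT x. indicator {a<..t} x * \<beta> x) - (LBINT x. indicator {a<..s} x * \<beta> x) = (LBINT x. indicator {s<..t} x * \<beta> x)"
  unfolding Bochner_Integration.integral_diff[OF integrable_bounded_Ioc[OF \<beta>] integrable_bounded_Ioc[OF \<beta>], symmetric]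
  using assms(3,4) by (intro Bochner_Integration.integral_cong) (auto simp: indicator_def)

lemma continuous_on_integral_Ioc:
  fixes \<beta> :: "real \<Rightarrow> real"
  assumes \<beta>: "\<beta> \<in> borel_measurable borel" "\<And>x. \<bar>\<beta> x\<bar> \<le> C"
  shows "continuous_on {0..T} (\<lambda>t. \<integral>x. indicator {0<..t} x * \<beta> x \<partial>lborel)" (is "continuous_on _ ?B")
proof -
  have C: "C \<ge> 0" using \<beta>(2)[of 0] by linarith
  have le: "\<bar>?B t - ?B s\<bar> \<le> C * (t - s)" if "0 \<le> s" "s \<le> t" for s t
  proof -
    have "?B t - ?B s = (LBINT x. indicator {s<..t} x * \<beta> x)"
      using that by (intro integral_Ioc_diff[OF \<beta>])
    also have "\<bar>\<dots>\<bar> \<le> (LBINT x. C * indicator {s<..t} x)"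
    proof -
      have "integrable lborel (\<lambda>x. C * indicator {s<..t} x)"
        by (intro integrable_mult_right integrable_real_indicator emeasure_bounded_finite) auto
      moreover have "norm (indicator {s<..t} x * \<beta> x) \<le> C * indicator {s<..t} x" for x
        using \<beta>(2) by (simp add: indicator_def)
      ultimately show ?thesis
        unfolding real_norm_def[symmetric]
        by (rule Bochner_Integration.integral_norm_bound_integral[OF integrable_bounded_Ioc[OF \<beta>]])
    qed
    also have "\<dots> = C * (t - s)" using that by simp
    finally show ?thesis .
  qed
  have "C-lipschitz_on {0..T} ?B"
  proof (rule lipschitz_onI[OF _ C])
    fix x y assume "x \<in> {0..T}" "y \<in> {0..T}"
    then show "dist (?B x) (?B y) \<le> C * dist x y"
      using le[of x y] le[of y x] by (cases "x \<le> y") (auto simp: dist_real_def abs_minus_commute)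
  qed
  then show ?thesis by (rule lipschitz_on_continuous_on)
qed

lemma L2_norm_minus_commute: "L2_norm G (\<lambda>x. f x - g x) = L2_norm G (\<lambda>x. g x - f x)"
  by (simp add: L2_norm_def norm_minus_commute)

lemma L2_reverse_triangle:
  assumes "f \<in> L2_space G" "g \<in> L2_space G"
  shows "\<bar>L2_norm G f - L2_norm G g\<bar> \<le> L2_norm G (\<lambda>x. f x - g x)"
proof -
  have d: "(\<lambda>x. f x - g x) \<in> L2_space G" "(\<lambda>x. g x - f x) \<in> L2_space G"
    using L2_space_linear[OF assms, of 1 "-1"] L2_space_linear[OF assms(2,1), of 1 "-1"] by simp_all
  show ?thesis
    using L2_triangle[OF assms(2) d(1)] L2_triangle[OF assms(1) d(2)] L2_norm_minus_commute[of G f g] by simp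
qed

lemma continuous_on_L2_norm:
  assumes W: "\<And>t. t \<in> I \<Longrightarrow> W t \<in> L2_space G"
    and cont: "\<And>t. t \<in> I \<Longrightarrow> ((\<lambda>s. L2_norm G (\<lambda>x. W s x - W t x)) \<longlongrightarrow> 0) (at t within I)"
  shows "continuous_on I (\<lambda>t. L2_norm G (W t))"
  unfolding continuous_on_def
proof
  fix t assume t: "t \<in> I"
  have ev: "\<forall>\<^sub>F s in at t within I. s \<in> I"
    by (simp add: eventually_at_filter)
  show "((\<lambda>s. L2_norm G (W s)) \<longlongrightarrow> L2_norm G (W t)) (at t within I)"
  proof (rule LIM_zero_cancel, rule Lim_null_comparison[OF _ cont[OF t]])
    show "\<forall>\<^sub>F s in at t within I. norm (L2_norm G (W s) - L2_norm G (W t)) \<le> L2_norm G (\<lambda>x. W s x - W t x)"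
      using ev by eventually_elim (use W t in \<open>auto intro!: L2_reverse_triangle\<close>)
  qed
qed

text \<open>
  If the increments of \<open>W\<close> are given by \<open>q\<close> when they are tested with \<open>W t\<close> itself, where \<open>p (t, _)\<close> stands
  for the gradient of \<open>W t\<close>, then \<open>|W|\<^sup>2\<close> can be differentiated as usual. Indeed
  \<open>|W t|\<^sup>2 - |W s|\<^sup>2 = \<langle>W t - W s, W t + W s\<rangle>\<close>, and by the continuity of translations in \<open>L\<^sup>1\<close> replacing
  \<open>p (s, _)\<close> and \<open>p (t, _)\<close> by \<open>p (\<rho>, _)\<close> for the times \<open>\<rho>\<close> in between costs, on average, \<open>o(t - s)\<close>.
\<close>

lemma energy_identity:
  fixes W :: "real \<Rightarrow> 'e::euclidean_space \<Rightarrow> 'v::euclidean_space"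
    and p q :: "real \<times> 'e \<Rightarrow> 'm::euclidean_space"
  assumes G: "bounded G" "T > 0"
    and W: "\<And>t. t \<in> {0..T} \<Longrightarrow> W t \<in> L2_space G"
    and Wc: "\<And>t. t \<in> {0..T} \<Longrightarrow> ((\<lambda>s. L2_norm G (\<lambda>x. W s x - W t x)) \<longlongrightarrow> 0) (at t within {0..T})"
    and p: "p \<in> borel_measurable borel" "\<And>z. norm (p z) \<le> P" "\<And>z. z \<notin> {0<..<T} \<times> G \<Longrightarrow> p z = 0"
    and q: "q \<in> borel_measurable borel" "\<And>z. norm (q z) \<le> Q" "\<And>z. z \<notin> {0<..<T} \<times> G \<Longrightarrow> q z = 0"
    and weak: "AE t in lborel. t \<in> {0<..<T} \<longrightarrow> (\<forall>a b. 0 \<le> a \<longrightarrow> a \<le> b \<longrightarrow> b < T \<longrightarrow>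
      (LINT x|lebesgue_on G. (W b x - W a x) \<bullet> W t x) =
      - (LBINT \<rho>. indicator {a<..b} \<rho> * (LBINT x. q (\<rho>, x) \<bullet> p (t, x))))"
    and t: "0 \<le> t" "t < T"
  shows "(L2_norm G (W t))\<^sup>2 = (L2_norm G (W 0))\<^sup>2 - 2 * (LBINT \<rho>. indicator {0<..t} \<rho> * (LBINT x. q (\<rho>, x) \<bullet> p (\<rho>, x)))"
proof -
  have [measurable]: "p \<in> borel_measurable borel" "q \<in> borel_measurable borel" by fact+
  have PQ: "P \<ge> 0" "Q \<ge> 0"
    using p(2)[of 0] q(2)[of 0] norm_ge_zero order_trans by blast+
  obtain R where R: "{0<..<T} \<times> G \<subseteq> cball 0 R" "G \<subseteq> cball 0 R"
  proof -
    have "bounded ({0<..<T} \<times> G)" "bounded G"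
      using G by (auto intro: bounded_Times)
    then obtain R1 R2 where R12: "\<forall>z\<in>{0<..<T} \<times> G. norm z \<le> R1" "\<forall>x\<in>G. norm x \<le> R2"
      unfolding bounded_iff by blast
    show ?thesis
    proof
      show "{0<..<T} \<times> G \<subseteq> cball 0 (max R1 R2)" "G \<subseteq> cball 0 (max R1 R2)"
        using R12 by (auto simp: le_max_iff_disj simp del: mem_Times_iff)
    qed
  qed
  have zero_R: "p (r, x) = 0" if "x \<notin> cball 0 R" for r x
    using that R(2) by (intro p(3)) blast
  have int_slice: "integrable lborel (\<lambda>x. q (\<rho>, x) \<bullet> p (r, x))" and slice_bound: "\<bar>\<integral>x. q (\<rho>, x) \<bullet> p (r, x) \<partial>lborel\<bar> \<le> Q * P * measure lborel (cball (0::'e) R)" for \<rho> r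
  proof -
    have le: "\<bar>q (\<rho>, x) \<bullet> p (r, x)\<bar> \<le> Q * P * indicator (cball 0 R) x" for x
    proof (cases "x \<in> cball 0 R")
      case True
      have "\<bar>q (\<rho>, x) \<bullet> p (r, x)\<bar> \<le> norm (q (\<rho>, x)) * norm (p (r, x))"
        by (rule Cauchy_Schwarz_ineq2)
      also have "\<dots> \<le> Q * P"
        using p(2) q(2) PQ by (intro mult_mono) auto
      finally show ?thesis using True by simp
    next
      case False
      then have "p (r, x) = 0"
        by (rule zero_R)
      with False show ?thesis by simp
    qed
    have ii: "integrable lborel (\<lambda>x. Q * P * indicator (cball (0::'e) R) x)"
      by (intro integrable_mult_right integrable_real_indicator emeasure_bounded_finite) auto
    show int: "integrable lborel (\<lambda>x. q (\<rho>, x) \<bullet> p (r, x))"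
      using ii by (rule Bochner_Integration.integrable_bound) (use le PQ in \<open>auto simp: abs_mult\<close>)
    have "\<bar>\<integral>x. q (\<rho>, x) \<bullet> p (r, x) \<partial>lborel\<bar> \<le> (LBINT x. Q * P * indicator (cball (0::'e) R) x)"
      using Bochner_Integration.integral_norm_bound_integral[OF int ii] le by simp
    then show "\<bar>\<integral>x. q (\<rho>, x) \<bullet> p (r, x) \<partial>lborel\<bar> \<le> Q * P * measure lborel (cball (0::'e) R)"
      by simp
  qed
  define g where "g \<rho> r = (LBINT x. q (\<rho>, x) \<bullet> p (r, x))" for \<rho> r
  define C where "C = Q * P * measure lborel (cball (0::'e) R)"
  have gC: "\<bar>g \<rho> r\<bar> \<le> C" for \<rho> r
    unfolding g_def C_def by (rule slice_bound)
  have g_meas[measurable]: "(\<lambda>\<rho>. g \<rho> r) \<in> borel_measurable borel" "(\<lambda>\<rho>. g \<rho> \<rho>) \<in> borel_measurable borel" for r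
    unfolding g_def by measurable
  \<comment> \<open>\<open>D \<rho> r\<close> bounds the error from replacing the gradient at time \<open>r\<close> by the one at time \<open>\<rho>\<close>.\<close>
  define D where "D \<rho> r = ennreal Q * (\<integral>\<^sup>+x. ennreal (norm (p (r, x) - p (\<rho>, x))) \<partial>lborel)" for \<rho> r
  have D_meas: "(\<lambda>(\<rho>, r). D \<rho> r) \<in> borel_measurable borel"
  proof -
    have "(\<lambda>z. ennreal Q * (\<integral>\<^sup>+x. ennreal (norm (p (snd z, x) - p (fst z, x))) \<partial>lborel)) \<in> borel_measurable (borel \<Otimes>\<^sub>M borel)"
      by measurable
    then show ?thesis by (simp add: D_def borel_prod case_prod_beta')
  qed
  have gD: "ennreal \<bar>g \<rho> \<rho> - g \<rho> r\<bar> \<le> D \<rho> r" for \<rho> r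
  proof -
    have eq: "g \<rho> \<rho> - g \<rho> r = (LBINT x. q (\<rho>, x) \<bullet> (p (\<rho>, x) - p (r, x)))"
      unfolding g_def using int_slice by (simp add: inner_diff_right)
    have "integrable lborel (\<lambda>x. q (\<rho>, x) \<bullet> (p (\<rho>, x) - p (r, x)))"
      using int_slice by (simp add: inner_diff_right)
    then have "ennreal \<bar>g \<rho> \<rho> - g \<rho> r\<bar> \<le> (\<integral>\<^sup>+x. ennreal \<bar>q (\<rho>, x) \<bullet> (p (\<rho>, x) - p (r, x))\<bar> \<partial>lborel)"
      unfolding eq using integral_norm_bound_ennreal by fastforce
    also have "\<dots> \<le> (\<integral>\<^sup>+x. ennreal Q * ennreal (norm (p (r, x) - p (\<rho>, x))) \<partial>lborel)"
    proof (rule nn_integral_mono)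
      fix x
      have "\<bar>q (\<rho>, x) \<bullet> (p (\<rho>, x) - p (r, x))\<bar> \<le> norm (q (\<rho>, x)) * norm (p (\<rho>, x) - p (r, x))"
        by (rule Cauchy_Schwarz_ineq2)
      also have "\<dots> \<le> Q * norm (p (r, x) - p (\<rho>, x))"
        using q(2) by (auto simp: norm_minus_commute intro!: mult_right_mono)
      finally show "ennreal \<bar>q (\<rho>, x) \<bullet> (p (\<rho>, x) - p (r, x))\<bar> \<le> ennreal Q * ennreal (norm (p (r, x) - p (\<rho>, x)))"
        using PQ by (simp add: ennreal_mult'[symmetric] ennreal_leI)
    qed
    also have "\<dots> = D \<rho> r"
      unfolding D_def by (rule nn_integral_cmult) measurable
    finally show ?thesis .
  qed
  define B where "B t = (LBINT \<rho>. indicator {0<..t} \<rho> * g \<rho> \<rho>)" for t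
  define e where "e t = (L2_norm G (W t))\<^sup>2 + 2 * B t" for t
  define A where "A = {t. \<forall>a b. 0 \<le> a \<longrightarrow> a \<le> b \<longrightarrow> b < T \<longrightarrow>
      (LINT x|lebesgue_on G. (W b x - W a x) \<bullet> W t x) = - (LBINT \<rho>. indicator {a<..b} \<rho> * g \<rho> t)}"
  have aeA: "AE t in lborel. t \<in> {0<..<T} \<longrightarrow> t \<in> A"
    using weak unfolding A_def g_def mem_Collect_eq .
  have "e t = e 0"
  proof (rule constant_if_increments_small[OF _ D_meas aeA _ _ t])
    show "continuous_on {0..T} e"
      unfolding e_def B_def
      by (intro continuous_intros continuous_on_L2_norm[OF W Wc] continuous_on_integral_Ioc[OF g_meas(2) gC])
  next
    fix s r
    assume good: "s \<in> A" "r \<in> A"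
    assume sr: "0 < s" "s < r" "r < T"
    have Wsr: "W s \<in> L2_space G" "W r \<in> L2_space G" "(\<lambda>x. W r x - W s x) \<in> L2_space G"
      using W sr L2_space_linear[of "W r" G "W s" 1 "-1"] by auto
    have "(L2_norm G (W r))\<^sup>2 - (L2_norm G (W s))\<^sup>2 = (LINT x|lebesgue_on G. (W r x - W s x) \<bullet> W r x + (W r x - W s x) \<bullet> W s x)"
    proof -
      have "(L2_norm G (W r))\<^sup>2 - (L2_norm G (W s))\<^sup>2 = (LINT x|lebesgue_on G. (norm (W r x))\<^sup>2 - (norm (W s x))\<^sup>2)"
        using Wsr by (simp add: L2_norm_power2 L2_space_def)
      also have "\<dots> = (LINT x|lebesgue_on G. (W r x - W s x) \<bullet> W r x + (W r x - W s x) \<bullet> W s x)"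
        by (intro Bochner_Integration.integral_cong refl) (simp add: power2_norm_eq_inner inner_diff_left inner_diff_right inner_commute)
      finally show ?thesis .
    qed
    also have "\<dots> = (LINT x|lebesgue_on G. (W r x - W s x) \<bullet> W r x) + (LINT x|lebesgue_on G. (W r x - W s x) \<bullet> W s x)"
      using Wsr by (intro Bochner_Integration.integral_add L2_space_inner)
    also have "\<dots> = - (LBINT \<rho>. indicator {s<..r} \<rho> * g \<rho> r) - (LBINT \<rho>. indicator {s<..r} \<rho> * g \<rho> s)"
      using good sr unfolding A_def by simp
    finally have a: "(L2_norm G (W r))\<^sup>2 - (L2_norm G (W s))\<^sup>2 =
      - (LBINT \<rho>. indicator {s<..r} \<rho> * g \<rho> r) - (LBINT \<rho>. indicator {s<..r} \<rho> * g \<rho> s)" .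
    have b: "B r - B s = (LBINT \<rho>. indicator {s<..r} \<rho> * g \<rho> \<rho>)"
      unfolding B_def using sr by (intro integral_Ioc_diff[OF g_meas(2) gC]) auto
    note int = integrable_bounded_Ioc[OF g_meas(1) gC] integrable_bounded_Ioc[OF g_meas(2) gC]
    let ?f = "\<lambda>\<rho>. indicator {s<..r} \<rho> * ((g \<rho> \<rho> - g \<rho> r) + (g \<rho> \<rho> - g \<rho> s))"
    have "e r - e s = (LBINT \<rho>. indicator {s<..r} \<rho> * g \<rho> \<rho>) - (LBINT \<rho>. indicator {s<..r} \<rho> * g \<rho> r)
       + ((LBINT \<rho>. indicator {s<..r} \<rho> * g \<rho> \<rho>) - (LBINT \<rho>. indicator {s<..r} \<rho> * g \<rho> s))"
      using a b by (simp add: e_def)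
    also have "\<dots> = (LBINT \<rho>. (indicator {s<..r} \<rho> * g \<rho> \<rho> - indicator {s<..r} \<rho> * g \<rho> r) +
        (indicator {s<..r} \<rho> * g \<rho> \<rho> - indicator {s<..r} \<rho> * g \<rho> s))"
      by (simp only: Bochner_Integration.integral_add Bochner_Integration.integral_diff
          Bochner_Integration.integrable_diff int)
    also have f_eq: "(\<lambda>\<rho>. (indicator {s<..r} \<rho> * g \<rho> \<rho> - indicator {s<..r} \<rho> * g \<rho> r) +
        (indicator {s<..r} \<rho> * g \<rho> \<rho> - indicator {s<..r} \<rho> * g \<rho> s)) = ?f"
      by (simp add: fun_eq_iff indicator_def)
    finally have eq: "e r - e s = (LBINT \<rho>. ?f \<rho>)" .
    have "integrable lborel ?f"
      unfolding f_eq[symmetric]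
      by (intro Bochner_Integration.integrable_add Bochner_Integration.integrable_diff int)
    then have "ennreal \<bar>e r - e s\<bar> \<le> (\<integral>\<^sup>+\<rho>. ennreal \<bar>?f \<rho>\<bar> \<partial>lborel)"
      unfolding eq using integral_norm_bound_ennreal by fastforce
    also have "\<dots> \<le> (\<integral>\<^sup>+\<rho>. indicator {s<..r} \<rho> * (D \<rho> r + D \<rho> s) \<partial>lborel)"
    proof (rule nn_integral_mono)
      fix \<rho>
      have "ennreal \<bar>(g \<rho> \<rho> - g \<rho> r) + (g \<rho> \<rho> - g \<rho> s)\<bar> \<le> ennreal (\<bar>g \<rho> \<rho> - g \<rho> r\<bar> + \<bar>g \<rho> \<rho> - g \<rho> s\<bar>)"
        by (intro ennreal_leI abs_triangle_ineq)
      also have "\<dots> \<le> D \<rho> r + D \<rho> s"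
        using gD by (simp add: add_mono)
      finally show "ennreal \<bar>?f \<rho>\<bar> \<le> indicator {s<..r} \<rho> * (D \<rho> r + D \<rho> s)"
        by (simp add: indicator_def)
    qed
    finally show "ennreal \<bar>e r - e s\<bar> \<le> (\<integral>\<^sup>+\<rho>. indicator {s<..r} \<rho> * (D \<rho> r + D \<rho> s) \<partial>lborel)" .
  next
    fix \<epsilon> :: real assume "\<epsilon> > 0"
    then have \<epsilon>': "\<epsilon> / (Q + 1) > 0" using PQ by simp
    have pR: "p z = 0" if "norm z > R" for z
      using p(3)[of z] R(1) that by force
    obtain \<delta> where \<delta>: "\<delta> > 0" "\<And>y. norm y < \<delta> \<Longrightarrow> (\<integral>\<^sup>+z. ennreal (norm (p (y + z) - p z)) \<partial>lborel) \<le> ennreal (\<epsilon> / (Q + 1))"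
      using L1_translation_continuous[OF p(1,2) pR \<epsilon>'] by blast
    show "\<exists>\<delta>>0. \<forall>h. \<bar>h\<bar> < \<delta> \<longrightarrow> (\<integral>\<^sup>+\<tau>. D \<tau> (h + \<tau>) \<partial>lborel) \<le> ennreal \<epsilon>"
    proof (intro exI[of _ \<delta>] conjI allI impI \<delta>(1))
      fix h :: real assume h: "\<bar>h\<bar> < \<delta>"
      have "(\<integral>\<^sup>+\<tau>. D \<tau> (h + \<tau>) \<partial>lborel) = ennreal Q * (\<integral>\<^sup>+\<tau>. \<integral>\<^sup>+x. ennreal (norm (p (h + \<tau>, x) - p (\<tau>, x))) \<partial>lborel \<partial>lborel)"
        unfolding D_def by (rule nn_integral_cmult) measurable
      also have "(\<integral>\<^sup>+\<tau>. \<integral>\<^sup>+x. ennreal (norm (p (h + \<tau>, x) - p (\<tau>, x))) \<partial>lborel \<partial>lborel) =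
         (\<integral>\<^sup>+z. ennreal (norm (p ((h, 0) + z) - p z)) \<partial>lborel)"
        by (subst nn_integral_lborel_pair) simp_all
      also have "\<dots> \<le> ennreal (\<epsilon> / (Q + 1))"
        using h by (intro \<delta>(2)) (simp add: norm_Pair)
      also have "ennreal Q * ennreal (\<epsilon> / (Q + 1)) = ennreal (Q * (\<epsilon> / (Q + 1)))"
        by (rule ennreal_mult'[OF PQ(2), symmetric])
      also have "\<dots> \<le> ennreal \<epsilon>"
        using PQ \<open>\<epsilon> > 0\<close> by (intro ennreal_leI) (simp add: field_simps)
      finally show "(\<integral>\<^sup>+\<tau>. D \<tau> (h + \<tau>) \<partial>lborel) \<le> ennreal \<epsilon>"
        by (simp add: mult_left_mono)
    qed
  qed
  then show ?thesis
    unfolding e_def B_def g_def by simp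
qed

section \<open>Gronwall's inequality and linear equations in time\<close>

text \<open>
  The supremum \<open>S\<close> of \<open>exp (- 2 C r) z r\<close> satisfies \<open>S \<le> S / 2\<close>, because the exponential weight gains the
  factor \<open>1/2\<close> under the integral.
\<close>

lemma gronwall_zero:
  fixes z :: "real \<Rightarrow> real"
  assumes z: "z \<in> borel_measurable borel" "\<And>t. 0 \<le> t \<Longrightarrow> t < T \<Longrightarrow> 0 \<le> z t" "\<And>t. 0 \<le> t \<Longrightarrow> t < T \<Longrightarrow> z t \<le> B"
    and C: "C > 0" "\<And>t. 0 \<le> t \<Longrightarrow> t < T \<Longrightarrow> z t \<le> C * (LBINT r. indicator {0<..t} r * z r)"
    and t: "0 \<le> t" "t < T"
  shows "z t = 0"
proof -
  have [measurable]: "z \<in> borel_measurable borel" by fact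
  have B: "B \<ge> 0" using z(2,3)[OF t] by linarith
  define lam where "lam = 2 * C"
  have lam: "lam > 0" using C by (simp add: lam_def)
  define S where "S = (SUP r\<in>{0..<T}. exp (- (lam * r)) * z r)"
  have bdd: "bdd_above ((\<lambda>r. exp (- (lam * r)) * z r) ` {0..<T})"
  proof (rule bdd_aboveI2)
    fix r assume "r \<in> {0..<T}"
    then show "exp (- (lam * r)) * z r \<le> 1 * B"
      using z(2,3)[of r] lam B by (intro mult_mono) auto
  qed
  have upper: "exp (- (lam * r)) * z r \<le> S" if "0 \<le> r" "r < T" for r
    unfolding S_def using bdd that by (intro cSUP_upper) auto
  have S0: "S \<ge> 0"
    using upper[OF t] z(2)[OF t] by (smt (verit) exp_ge_zero mult_nonneg_nonneg)
  have half: "exp (- (lam * r)) * z r \<le> S / 2" if r: "0 \<le> r" "r < T" for r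
  proof -
    have FTC: "has_bochner_integral lborel (\<lambda>x. (S * exp (lam * x)) * indicator {0..r} x) (S * exp (lam * r) / lam - S * exp (lam * 0) / lam)"
      by (rule has_bochner_integral_FTC_Icc_real[where F="\<lambda>x. S * exp (lam * x) / lam"])
         (use r lam in \<open>auto intro!: derivative_eq_intros continuous_intros\<close>)
    have le: "norm (indicator {0<..r} x * z x) \<le> (S * exp (lam * x)) * indicator {0..r} x" for x
    proof (cases "x \<in> {0<..r}")
      case True
      then have "exp (lam * x) * (exp (- (lam * x)) * z x) \<le> exp (lam * x) * S"
        using upper[of x] r by (intro mult_left_mono) auto
      also have "exp (lam * x) * (exp (- (lam * x)) * z x) = z x"
        by (simp add: exp_minus)
      finally show ?thesis using True z(2)[of x] r by (simp add: mult.commute)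
    next
      case False
      then show ?thesis using S0 by simp
    qed
    have int: "integrable lborel (\<lambda>x. (S * exp (lam * x)) * indicator {0..r} x)"
      and val: "(LBINT x. (S * exp (lam * x)) * indicator {0..r} x) = S * exp (lam * r) / lam - S / lam"
      using FTC by (auto simp: has_bochner_integral_iff)
    have iz: "integrable lborel (\<lambda>x. indicator {0<..r} x * z x)"
      using int by (rule Bochner_Integration.integrable_bound)
        (measurable, use le in \<open>auto intro!: AE_I2 intro: order_trans[OF _ abs_ge_self]\<close>)
    have "(LBINT x. indicator {0<..r} x * z x) \<le> (LBINT x. (S * exp (lam * x)) * indicator {0..r} x)"
      using iz int le by (intro integral_mono) (auto intro: order_trans[OF abs_ge_self])
    also have "\<dots> \<le> S * exp (lam * r) / lam"
      unfolding val using S0 lam by simp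
    finally have "z r \<le> C * (S * exp (lam * r) / lam)"
      using C(2)[OF r] C(1) by (meson mult_left_mono less_imp_le order_trans)
    also have "\<dots> = S / 2 * exp (lam * r)"
      using C(1) by (simp add: lam_def)
    finally have "exp (- (lam * r)) * z r \<le> exp (- (lam * r)) * (S / 2 * exp (lam * r))"
      by (intro mult_left_mono) auto
    also have "\<dots> = S / 2"
      by (simp add: exp_minus field_simps)
    finally show ?thesis .
  qed
  have "S \<le> S / 2"
    unfolding S_def[of] using half t by (intro cSUP_least) (auto simp: S_def)
  with S0 have "S = 0" by simp
  then have "z t \<le> 0"
    using upper[OF t] by (simp add: mult_le_0_iff)
  with z(2)[OF t] show ?thesis by simp
qed

text \<open>
  This replaces the integrands of the weak formulation by their Borel representatives.
\<close>

lemma integral_lebesgue_on_eq_lborel: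
  fixes f g :: "'a::euclidean_space \<Rightarrow> 'b::euclidean_space"
  assumes G: "G \<in> sets borel" and f: "f \<in> borel_measurable borel" "\<And>x. x \<notin> G \<Longrightarrow> f x = 0"
    and ae: "AE x in lebesgue_on G. g x = f x"
  shows "(LINT x|lebesgue_on G. g x) = (LBINT x. f x)"
proof -
  have Gl: "G \<in> sets lebesgue" using G by auto
  have fm: "f \<in> borel_measurable (lebesgue_on G)"
    using f(1) by (intro measurable_restrict_space1 borel_measurable_lebesgueI)
  have "g \<in> borel_measurable (lebesgue_on G)"
    using ae by (intro AE_eq_borel_measurable_lebesgue_on[OF Gl fm]) (auto elim: eventually_mono)
  then have "(LINT x|lebesgue_on G. g x) = (LINT x|lebesgue_on G. f x)"
    using fm ae by (intro integral_cong_AE)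
  also have "\<dots> = (\<integral>x. indicator G x *\<^sub>R f x \<partial>lebesgue)"
    using Gl by (intro integral_restrict_space) simp
  also have "(\<lambda>x. indicator G x *\<^sub>R f x) = f"
    using f(2) by (fastforce simp: indicator_def)
  also have "(\<integral>x. f x \<partial>lebesgue) = (LBINT x. f x)"
    using f(1) by (intro integral_completion) simp
  finally show ?thesis .
qed

lemma integrable_bounded_support:
  fixes f :: "'a::euclidean_space \<Rightarrow> real"
  assumes G: "bounded G" and f: "f \<in> borel_measurable borel" "\<And>x. \<bar>f x\<bar> \<le> B" "\<And>x. x \<notin> G \<Longrightarrow> f x = 0"
  shows "integrable lborel f"
    and "G \<subseteq> cball 0 R \<Longrightarrow> \<bar>\<integral>x. f x \<partial>lborel\<bar> \<le> B * measure lborel (cball (0::'a) R)"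
proof -
  have gen: "integrable lborel f \<and> \<bar>\<integral>x. f x \<partial>lborel\<bar> \<le> B * measure lborel (cball (0::'a) R)" if R: "G \<subseteq> cball 0 R" for R
  proof -
    have B: "B \<ge> 0" using f(2)[of 0] by linarith
    have le: "norm (f x) \<le> B * indicator (cball 0 R) x" for x
      using f(2)[of x] f(3)[of x] R B by (cases "x \<in> G") (auto simp: indicator_def)
    have ii: "integrable lborel (\<lambda>x. B * indicator (cball (0::'a) R) x)"
      by (intro integrable_mult_right integrable_real_indicator emeasure_bounded_finite) auto
    have int: "integrable lborel f"
      using ii by (rule Bochner_Integration.integrable_bound)
        (use f(1) le B in \<open>auto simp: abs_mult intro!: AE_I2\<close>)
    have "norm (LBINT x. f x) \<le> (LBINT x. B * indicator (cball (0::'a) R) x)"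
      using int ii le by (rule Bochner_Integration.integral_norm_bound_integral)
    with int show ?thesis by simp
  qed
  obtain R0 where "G \<subseteq> cball 0 R0"
    using G unfolding bounded_iff by (metis mem_cball_0 subsetI)
  then show "integrable lborel f" using gen by blast
  show "\<bar>\<integral>x. f x \<partial>lborel\<bar> \<le> B * measure lborel (cball (0::'a) R)" if "G \<subseteq> cball 0 R"
    using gen[OF that] by blast
qed

text \<open>
  Testing \<open>K t = \<integral>\<^sub>0\<^sup>t R\<close> with \<open>K t\<close> itself and absorbing half of the square by Young's inequality
  bounds \<open>K t\<close> in \<open>L\<^sup>2\<close>.
\<close>

lemma L2_norm_time_integral_le:
  fixes K :: "'e::euclidean_space \<Rightarrow> 'h::euclidean_space" and R :: "real \<times> 'e \<Rightarrow> 'h"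
  assumes G: "G \<in> sets borel" "bounded G"
    and K: "K \<in> borel_measurable (lebesgue_on G)" "AE x in lebesgue_on G. norm (K x) \<le> B" "0 \<le> B"
    and R: "R \<in> borel_measurable borel" "\<And>z. norm (R z) \<le> M" "\<And>r x. x \<notin> G \<Longrightarrow> R (r, x) = 0"
    and eq: "\<And>\<xi>. \<xi> \<in> borel_measurable borel \<Longrightarrow> (\<And>x. norm (\<xi> x) \<le> B) \<Longrightarrow>
      (LINT x|lebesgue_on G. K x \<bullet> \<xi> x) = (LBINT \<rho>. indicator {0<..t} \<rho> * (LBINT x. R (\<rho>, x) \<bullet> \<xi> x))"
    and t: "0 \<le> t"
  shows "(L2_norm G K)\<^sup>2 \<le> t * (LBINT \<rho>. indicator {0<..t} \<rho> * (LBINT x. (norm (R (\<rho>, x)))\<^sup>2))"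
proof -
  have [measurable]: "R \<in> borel_measurable borel" by fact
  have M: "M \<ge> 0" using R(2)[of 0] norm_ge_zero order_trans by blast
  obtain \<xi> where \<xi>[measurable]: "\<xi> \<in> borel_measurable borel" and \<xi>0: "\<And>x. x \<notin> G \<Longrightarrow> \<xi> x = 0"
    and ae: "AE x in lborel. x \<in> G \<longrightarrow> K x = \<xi> x" and \<xi>B: "\<And>x. norm (\<xi> x) \<le> B"
    using bounded_borel_representative[OF G(1) K] by blast
  have ae': "AE x in lebesgue_on G. K x = \<xi> x"
    using ae by (simp add: AE_lborel_lebesgue_on_iff[OF G(1)])
  define n where "n = (LBINT x. (norm (\<xi> x))\<^sup>2)"
  define S where "S \<rho> = (LBINT x. (norm (R (\<rho>, x)))\<^sup>2)" for \<rho>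
  obtain R0 where R0: "G \<subseteq> cball 0 R0"
    using G(2) unfolding bounded_iff by (metis mem_cball_0 subsetI)
  let ?V = "measure lborel (cball (0::'e) R0)"
  have n1: "(L2_norm G K)\<^sup>2 = n"
    unfolding L2_norm_power2 n_def
    by (rule integral_lebesgue_on_eq_lborel[OF G(1)]) (use ae' \<xi>0 in \<open>auto elim: eventually_mono\<close>)
  have "n = (LINT x|lebesgue_on G. K x \<bullet> \<xi> x)"
    unfolding n_def
    by (rule integral_lebesgue_on_eq_lborel[OF G(1), symmetric])
       (use ae' \<xi>0 in \<open>auto elim!: eventually_mono simp: power2_norm_eq_inner\<close>)
  then have n2: "n = (LBINT \<rho>. indicator {0<..t} \<rho> * (LBINT x. R (\<rho>, x) \<bullet> \<xi> x))"
    using eq[OF \<xi> \<xi>B] by simp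
  have in2: "integrable lborel (\<lambda>x. (norm (\<xi> x))\<^sup>2)"
    by (rule integrable_bounded_support[OF G(2), where B="B\<^sup>2"]) (use \<xi>B \<xi>0 in \<open>auto intro: power_mono\<close>)
  have iS: "integrable lborel (\<lambda>x. (norm (R (\<rho>, x)))\<^sup>2)" and Sb: "\<bar>S \<rho>\<bar> \<le> M\<^sup>2 * ?V" for \<rho>
    unfolding S_def
    by (rule integrable_bounded_support[OF G(2), where B="M\<^sup>2"]; use R R0 in \<open>auto intro: power_mono\<close>)+
  have Rx: "\<bar>R (\<rho>, x) \<bullet> \<xi> x\<bar> \<le> M * B" for \<rho> x
    using Cauchy_Schwarz_ineq2[of "R (\<rho>, x)" "\<xi> x"] mult_mono[OF R(2) \<xi>B M norm_ge_zero, of "(\<rho>, x)" x]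
    by (rule order_trans)
  have iR: "integrable lborel (\<lambda>x. R (\<rho>, x) \<bullet> \<xi> x)"
    and Rb: "\<bar>\<integral>x. R (\<rho>, x) \<bullet> \<xi> x \<partial>lborel\<bar> \<le> M * B * ?V" for \<rho>
    by (rule integrable_bounded_support[OF G(2), where B="M * B"]; use Rx R(3) R0 in auto)+
  have Sm[measurable]: "S \<in> borel_measurable borel" and Rm: "(\<lambda>\<rho>. \<integral>x. R (\<rho>, x) \<bullet> \<xi> x \<partial>lborel) \<in> borel_measurable borel"
    unfolding S_def by measurable
  show ?thesis
  proof (cases "t = 0")
    case True
    then show ?thesis using n1 n2 by simp
  next
    case False
    with t have t: "t > 0" by simp
    have young: "(LBINT x. R (\<rho>, x) \<bullet> \<xi> x) \<le> t / 2 * S \<rho> + n / (2 * t)" for \<rho>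
    proof -
      have "(LBINT x. R (\<rho>, x) \<bullet> \<xi> x) \<le> (LBINT x. t / 2 * (norm (R (\<rho>, x)))\<^sup>2 + (1 / (2 * t)) * (norm (\<xi> x))\<^sup>2)"
      proof (rule integral_mono)
        fix x
        have "0 \<le> (norm (t *\<^sub>R R (\<rho>, x) - \<xi> x))\<^sup>2" by simp
        also have "\<dots> = t\<^sup>2 * (norm (R (\<rho>, x)))\<^sup>2 - 2 * t * (R (\<rho>, x) \<bullet> \<xi> x) + (norm (\<xi> x))\<^sup>2"
          unfolding power2_norm_eq_inner by (simp add: inner_simps inner_commute power2_eq_square algebra_simps)
        finally have "2 * t * (R (\<rho>, x) \<bullet> \<xi> x) \<le> t\<^sup>2 * (norm (R (\<rho>, x)))\<^sup>2 + (norm (\<xi> x))\<^sup>2"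
          by simp
        then have "(2 * t * (R (\<rho>, x) \<bullet> \<xi> x)) / (2 * t) \<le> (t\<^sup>2 * (norm (R (\<rho>, x)))\<^sup>2 + (norm (\<xi> x))\<^sup>2) / (2 * t)"
          using t by (intro divide_right_mono) auto
        then show "R (\<rho>, x) \<bullet> \<xi> x \<le> t / 2 * (norm (R (\<rho>, x)))\<^sup>2 + (1 / (2 * t)) * (norm (\<xi> x))\<^sup>2"
          using t by (simp add: add_divide_distrib power2_eq_square)
      qed (use iR iS in2 in auto)
      also have "\<dots> = t / 2 * S \<rho> + n / (2 * t)"
        using iS in2 by (simp add: S_def n_def)
      finally show ?thesis .
    qed
    note iSt = integrable_bounded_Ioc[OF Sm Sb, of 0 t]
    have i1: "integrable lborel (\<lambda>\<rho>. indicator {0<..t} \<rho> :: real)"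
      by (intro integrable_real_indicator emeasure_bounded_finite) auto
    have "n \<le> (LBINT \<rho>. t / 2 * (indicator {0<..t} \<rho> * S \<rho>) + n / (2 * t) * indicator {0<..t} \<rho>)"
      unfolding n2
    proof (rule integral_mono)
      show "integrable lborel (\<lambda>\<rho>. indicator {0<..t} \<rho> * (LBINT x. R (\<rho>, x) \<bullet> \<xi> x))"
        by (rule integrable_bounded_Ioc[OF Rm Rb])
      show "integrable lborel (\<lambda>\<rho>. t / 2 * (indicator {0<..t} \<rho> * S \<rho>) + (LBINT \<rho>. indicator {0<..t} \<rho> * (LBINT x. R (\<rho>, x) \<bullet> \<xi> x)) / (2 * t) * indicator {0<..t} \<rho>)"
        using iSt i1 by (intro Bochner_Integration.integrable_add integrable_mult_right)
      show "indicator {0<..t} \<rho> * (LBINT x. R (\<rho>, x) \<bullet> \<xi> x)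
          \<le> t / 2 * (indicator {0<..t} \<rho> * S \<rho>) + (LBINT \<rho>. indicator {0<..t} \<rho> * (LBINT x. R (\<rho>, x) \<bullet> \<xi> x)) / (2 * t) * indicator {0<..t} \<rho>" for \<rho>
        using young[of \<rho>] unfolding n2 by (simp add: indicator_def)
    qed
    also have "\<dots> = t / 2 * (LBINT \<rho>. indicator {0<..t} \<rho> * S \<rho>) + n / (2 * t) * t"
    proof -
      have "(LBINT \<rho>. indicator {0<..t} \<rho>) = t"
        using t by simp
      then show ?thesis using iSt i1 by simp
    qed
    finally have "n \<le> t * (LBINT \<rho>. indicator {0<..t} \<rho> * S \<rho>)"
      using t by simp
    then show ?thesis unfolding n1 S_def .
  qed
qed

section \<open>Weak solutions in integrated form\<close>

lemma tensor_app_inner_rows: "tensor_app H D $ i $ j = H $ i $ j \<bullet> D"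
  by (simp add: tensor_app_def inner_vec_def)

lemma norm_tensor_app_le: "norm (tensor_app H D) \<le> norm H * norm D"
proof -
  have "(norm (tensor_app H D))\<^sup>2 = tensor_app H D \<bullet> tensor_app H D"
    by (rule power2_norm_eq_inner)
  also have "\<dots> = (\<Sum>i\<in>UNIV. \<Sum>j\<in>UNIV. (H $ i $ j \<bullet> D)\<^sup>2)"
    by (simp only: inner_vec_def[of "tensor_app H D"] inner_vec_def[of "tensor_app H D $ i" for i]
        tensor_app_inner_rows power2_eq_square inner_real_def)
  also have "\<dots> \<le> (\<Sum>i\<in>UNIV. \<Sum>j\<in>UNIV. (H $ i $ j \<bullet> H $ i $ j) * (D \<bullet> D))"
    by (intro sum_mono Cauchy_Schwarz_ineq)
  also have "\<dots> = (H \<bullet> H) * (D \<bullet> D)"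
    by (simp only: inner_vec_def[of H] inner_vec_def[of "H $ i" for i] sum_distrib_right)
  also have "\<dots> = (norm H * norm D)\<^sup>2"
    by (simp add: power_mult_distrib power2_norm_eq_inner)
  finally show ?thesis
    by (auto intro: power2_le_imp_le)
qed

lemma bounded_bilinear_tensor_app: "bounded_bilinear tensor_app"
proof
  show "tensor_app (a + a') b = tensor_app a b + tensor_app a' b" for a a' b
    by (simp add: vec_eq_iff tensor_app_inner_rows inner_add_left)
  show "tensor_app a (b + b') = tensor_app a b + tensor_app a b'" for a b b'
    by (simp add: vec_eq_iff tensor_app_inner_rows inner_add_right)
  show "tensor_app (r *\<^sub>R a) b = r *\<^sub>R tensor_app a b" for r a b
    by (simp add: vec_eq_iff tensor_app_inner_rows)
  show "tensor_app a (r *\<^sub>R b) = r *\<^sub>R tensor_app a b" for r a b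
    by (simp add: vec_eq_iff tensor_app_inner_rows)
  show "\<exists>K. \<forall>a b. norm (tensor_app a b) \<le> norm a * norm b * K"
    by (intro exI[of _ 1] allI) (simp add: norm_tensor_app_le)
qed

text \<open>
  Pairing with a bounded \<open>\<xi>\<close> is a bounded functional on \<open>L\<^sup>\<infinity>\<close>. Adding \<open>1\<close> keeps its bound positive even for
  \<open>\<xi> = 0\<close>.
\<close>

lemma Linf_inner_bound:
  assumes fin: "finite_measure (lebesgue_on G)" and K: "K \<in> Linf_space G S"
    and \<xi>: "\<xi> \<in> borel_measurable (lebesgue_on G)" "\<And>x. norm (\<xi> x) \<le> B"
  shows "integrable (lebesgue_on G) (\<lambda>x. K x \<bullet> \<xi> x)"
    and "\<bar>\<integral>x. K x \<bullet> \<xi> x \<partial>(lebesgue_on G)\<bar> \<le> (B * measure (lebesgue_on G) (space (lebesgue_on G)) + 1) * Linf_norm G K"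
proof -
  interpret finite_measure "lebesgue_on G" by fact
  let ?N = "Linf_norm G K"
  have N: "?N \<ge> 0" using Linf_norm_nonneg[OF K] .
  have B: "B \<ge> 0" using \<xi>(2) norm_ge_zero order_trans by blast
  have ae: "AE x in lebesgue_on G. norm (K x \<bullet> \<xi> x) \<le> ?N * B"
    using Linf_norm_AE[OF K]
  proof eventually_elim
    case (elim x)
    have "norm (K x \<bullet> \<xi> x) \<le> norm (K x) * norm (\<xi> x)"
      using Cauchy_Schwarz_ineq2 by auto
    also have "\<dots> \<le> ?N * B"
      using elim \<xi>(2) N by (intro mult_mono) auto
    finally show ?case .
  qed
  have m: "(\<lambda>x. K x \<bullet> \<xi> x) \<in> borel_measurable (lebesgue_on G)"
    using K \<xi>(1) by (intro borel_measurable_inner) (auto simp: Linf_space_def)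
  show int: "integrable (lebesgue_on G) (\<lambda>x. K x \<bullet> \<xi> x)"
    by (rule integrable_const_bound[OF ae m])
  have "\<bar>\<integral>x. K x \<bullet> \<xi> x \<partial>(lebesgue_on G)\<bar> \<le> (LINT x|lebesgue_on G. ?N * B)"
  proof -
    have "norm (LINT x|lebesgue_on G. K x \<bullet> \<xi> x) \<le> (LINT x|lebesgue_on G. norm (K x \<bullet> \<xi> x))"
      by (rule integral_norm_bound)
    also have "\<dots> \<le> (LINT x|lebesgue_on G. ?N * B)"
      using int ae by (intro integral_mono_AE) auto
    finally show ?thesis by simp
  qed
  also have "\<dots> = B * measure (lebesgue_on G) (space (lebesgue_on G)) * ?N"
    by simp
  also have "\<dots> \<le> (B * measure (lebesgue_on G) (space (lebesgue_on G)) + 1) * ?N"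
    using N by (simp add: distrib_right)
  finally show "\<bar>\<integral>x. K x \<bullet> \<xi> x \<partial>(lebesgue_on G)\<bar> \<le> (B * measure (lebesgue_on G) (space (lebesgue_on G)) + 1) * ?N" .
qed

lemma Linf_norm_bounded_on_interval:
  fixes T :: real
  assumes S: "subspace S" and K: "\<And>t. t \<in> {0..T} \<Longrightarrow> K t \<in> Linf_space G S"
    and cont: "\<And>t. t \<in> {0..T} \<Longrightarrow> ((\<lambda>s. Linf_norm G (\<lambda>x. K s x - K t x)) \<longlongrightarrow> 0) (at t within {0..T})"
  obtains B where "B \<ge> 0" "\<And>t. t \<in> {0..T} \<Longrightarrow> Linf_norm G (K t) \<le> B"
proof -
  have sub: "(\<lambda>x. f x - g x) \<in> Linf_space G S" if "f \<in> Linf_space G S" "g \<in> Linf_space G S" for f g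
    using Linf_space_linear[OF S that, of 1 "-1"] by simp
  have comm: "Linf_norm G (\<lambda>x. f x - g x) = Linf_norm G (\<lambda>x. g x - f x)" for f g
    by (simp add: Linf_norm_def norm_minus_commute)
  have tri: "\<bar>Linf_norm G f - Linf_norm G g\<bar> \<le> Linf_norm G (\<lambda>x. f x - g x)" if "f \<in> Linf_space G S" "g \<in> Linf_space G S" for f g
    using Linf_triangle[OF that(2) sub[OF that]] Linf_triangle[OF that(1) sub[OF that(2,1)]] comm[of f g] by simp
  have "continuous_on {0..T} (\<lambda>t. Linf_norm G (K t))"
    unfolding continuous_on_def
  proof
    fix t assume t: "t \<in> {0..T}"
    have ev: "\<forall>\<^sub>F s in at t within {0..T}. s \<in> {0..T}"
      by (simp add: eventually_at_filter)
    show "((\<lambda>s. Linf_norm G (K s)) \<longlongrightarrow> Linf_norm G (K t)) (at t within {0..T})"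
    proof (rule LIM_zero_cancel, rule Lim_null_comparison[OF _ cont[OF t]])
      show "\<forall>\<^sub>F s in at t within {0..T}. norm (Linf_norm G (K s) - Linf_norm G (K t)) \<le> Linf_norm G (\<lambda>x. K s x - K t x)"
        using ev by eventually_elim (use K t in \<open>auto intro!: tri\<close>)
    qed
  qed
  then have "bounded ((\<lambda>t. Linf_norm G (K t)) ` {0..T})"
    by (intro compact_imp_bounded compact_continuous_image) auto
  then obtain B where "\<forall>t\<in>{0..T}. \<bar>Linf_norm G (K t)\<bar> \<le> B"
    by (auto simp: bounded_real)
  then show ?thesis
    by (intro that[of "max B 0"]) (auto simp: le_max_iff_disj dest!: bspec)
qed

lemma AE_time_space:
  fixes P :: "real \<times> 'a::euclidean_space \<Rightarrow> bool"
  assumes "AE z in lborel. z \<in> {0<..<T} \<times> G \<longrightarrow> P z"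
  shows "AE t in lborel. t \<in> {0<..<T} \<longrightarrow> (AE x in lborel. x \<in> G \<longrightarrow> P (t, x))"
  using AE_lborel_sections[OF assms]
proof eventually_elim
  case (elim t)
  show ?case
  proof
    assume "t \<in> {0<..<T}"
    then show "AE x in lborel. x \<in> G \<longrightarrow> P (t, x)"
      using elim by (auto elim: eventually_mono)
  qed
qed

text \<open>
  The converse of Fubini's theorem for null sets; it is the reason for working with Borel sets of space-time.
\<close>

lemma AE_time_spaceI:
  fixes P :: "real \<times> 'a::euclidean_space \<Rightarrow> bool"
  assumes P: "{z. P z} \<in> sets borel" and G: "G \<in> sets borel"
    and ae: "AE t in lborel. t \<in> {0<..<T} \<longrightarrow> (AE x in lborel. x \<in> G \<longrightarrow> P (t, x))"
  shows "AE z in lborel. z \<in> {0<..<T} \<times> G \<longrightarrow> P z"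
proof (rule AE_lborel_pairI)
  have "{z. z \<in> {0<..<T} \<times> G \<longrightarrow> P z} = (- ({0<..<T} \<times> G)) \<union> {z. P z}" by auto
  moreover have "{0<..<T} \<times> G \<in> sets borel"
    using G by (intro borel_Times) auto
  ultimately show "{z. z \<in> {0<..<T} \<times> G \<longrightarrow> P z} \<in> sets borel"
    using P by (simp add: borel_comp sets.Un)
  show "AE t in lborel. AE x in lborel. (t, x) \<in> {0<..<T} \<times> G \<longrightarrow> P (t, x)"
    using ae
  proof eventually_elim
    case (elim t)
    then show ?case by (cases "t \<in> {0<..<T}") (auto elim: eventually_mono)
  qed
qed

text \<open>
  The equations are tested with fixed functions, elements \<open>v\<close> of \<open>V\<close> with a bounded Jacobian \<open>j\<close> and bounded
  tensor fields \<open>\<xi>\<close>, which turns them into scalar equations that hold at all times for the continuous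
  representatives \<open>W\<close> of \<open>u\<close> and \<open>K\<close> of \<open>H\<close>. The coefficients \<open>h\<close> and \<open>p\<close> are bounded
  Borel representatives of \<open>H\<close> and \<open>\<nabla>u\<close>, so that Fubini's theorem applies to them.
\<close>

definition integrated_solution ::
    "real \<Rightarrow> (real^'d::finite) set \<Rightarrow> real \<Rightarrow> (('k::finite, 'd) matr \<Rightarrow> ('k, 'd) tensor) \<Rightarrow>
     (real \<Rightarrow> real^'d \<Rightarrow> real^'k) \<Rightarrow> (real \<Rightarrow> real^'d \<Rightarrow> real^'k) \<Rightarrow> (real \<Rightarrow> real^'d \<Rightarrow> ('k, 'd) tensor) \<Rightarrow>
     (real \<times> (real^'d) \<Rightarrow> ('k, 'd) matr) \<Rightarrow> (real \<times> (real^'d) \<Rightarrow> ('k, 'd) tensor) \<Rightarrow> bool" where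
  "integrated_solution T G \<tau> F u W K p h \<longleftrightarrow>
     (\<forall>t\<in>{0..T}. W t \<in> H_space G) \<and>
     (\<forall>t\<in>{0..T}. ((\<lambda>s. L2_norm G (\<lambda>x. W s x - W t x)) \<longlongrightarrow> 0) (at t within {0..T})) \<and>
     (\<forall>t\<in>{0..T}. K t \<in> Linf_space G sym_tensors) \<and>
     p \<in> borel_measurable borel \<and> bounded (range p) \<and> (\<forall>z. z \<notin> {0<..<T} \<times> G \<longrightarrow> p z = 0) \<and>
     h \<in> borel_measurable borel \<and> bounded (range h) \<and> (\<forall>z. z \<notin> {0<..<T} \<times> G \<longrightarrow> h z = 0) \<and>
     (AE t in lborel. t \<in> {0<..<T} \<longrightarrow> u t \<in> V_space G \<and>
        (AE x in lebesgue_on G. u t x = W t x) \<and>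
        (AE x in lebesgue_on G. weak_jacobian G (u t) x = p (t, x)) \<and>
        (AE x in lebesgue_on G. K t x = h (t, x))) \<and>
     (\<forall>v j. v \<in> V_space G \<longrightarrow> j \<in> borel_measurable borel \<longrightarrow> bounded (range j) \<longrightarrow>
        (AE x in lebesgue_on G. weak_jacobian G v x = j x) \<longrightarrow>
        (\<forall>a b. 0 \<le> a \<longrightarrow> a \<le> b \<longrightarrow> b < T \<longrightarrow>
           (LINT x|lebesgue_on G. (W b x - W a x) \<bullet> v x) =
           - (LBINT \<rho>. indicator {a<..b} \<rho> * (LBINT x. tensor_app (h (\<rho>, x)) (p (\<rho>, x)) \<bullet> j x)))) \<and>
     (\<forall>\<xi>. \<xi> \<in> borel_measurable borel \<longrightarrow> bounded (range \<xi>) \<longrightarrow>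
        (\<forall>a b. 0 \<le> a \<longrightarrow> a \<le> b \<longrightarrow> b < T \<longrightarrow>
           (LINT x|lebesgue_on G. (K b x - K a x) \<bullet> \<xi> x) =
           (LBINT \<rho>. indicator {a<..b} \<rho> *
              (LBINT x. (indicator G x / \<tau>) *\<^sub>R (F (p (\<rho>, x)) - h (\<rho>, x)) \<bullet> \<xi> x))))"

lemma finite_measure_lebesgue_on_bounded:
  assumes "open G" "bounded G"
  shows "finite_measure (lebesgue_on G)"
proof (rule finite_measureI)
  have "emeasure lborel G < \<infinity>"
    using assms(2) by (rule emeasure_bounded_finite)
  then show "emeasure (lebesgue_on G) (space (lebesgue_on G)) \<noteq> \<infinity>"
    using assms(1) by (simp add: space_restrict_space emeasure_restrict_space)
qed

text \<open>
  The functional is the evaluation at \<open>v\<close>. The gradients and the tensors are bounded, hence so is the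
  derivative of \<open>\<langle>W t, v\<rangle>\<close>.
\<close>

lemma momentum_equation_integrated:
  fixes G :: "(real^'d::finite) set" and u W :: "real \<Rightarrow> real^'d \<Rightarrow> real^'k::finite"
    and p :: "real \<times> (real^'d) \<Rightarrow> ('k, 'd) matr" and h :: "real \<times> (real^'d) \<Rightarrow> ('k, 'd) tensor"
  assumes G: "open G" "bounded G" and T: "T > 0"
    and u': "bochner_H1_deriv T (V_dual G) (V_dual_norm G) (\<lambda>t. gelfand_embed G (u t)) u'"
      "AE t in lebesgue_on {0<..<T}. \<forall>v\<in>V_space G. u' t v + A_op G (H t) (u t) v = 0"
    and W: "\<And>t. t \<in> {0..T} \<Longrightarrow> W t \<in> L2_space G"
      "\<And>t. t \<in> {0..T} \<Longrightarrow> ((\<lambda>s. L2_norm G (\<lambda>x. W s x - W t x)) \<longlongrightarrow> 0) (at t within {0..T})"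
    and p: "p \<in> borel_measurable borel" "\<And>z. norm (p z) \<le> P" "\<And>z. z \<notin> {0<..<T} \<times> G \<Longrightarrow> p z = 0"
    and h: "h \<in> borel_measurable borel" "\<And>z. norm (h z) \<le> B" "\<And>z. z \<notin> {0<..<T} \<times> G \<Longrightarrow> h z = 0"
    and ae: "AE t in lborel. t \<in> {0<..<T} \<longrightarrow> u t \<in> V_space G \<and> (AE x in lebesgue_on G. u t x = W t x) \<and>
        (AE x in lebesgue_on G. weak_jacobian G (u t) x = p (t, x)) \<and>
        (AE x in lebesgue_on G. H t x = h (t, x))"
    and v: "v \<in> V_space G" and j: "j \<in> borel_measurable borel" "\<And>x. norm (j x) \<le> J"
      "AE x in lebesgue_on G. weak_jacobian G v x = j x"
    and ab: "0 \<le> a" "a \<le> b" "b < T"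
  shows "(LINT x|lebesgue_on G. (W b x - W a x) \<bullet> v x) =
      - (LBINT \<rho>. indicator {a<..b} \<rho> * (LBINT x. tensor_app (h (\<rho>, x)) (p (\<rho>, x)) \<bullet> j x))"
proof -
  have [measurable]: "p \<in> borel_measurable borel" "h \<in> borel_measurable borel" "j \<in> borel_measurable borel" by fact+
  have fin: "finite_measure (lebesgue_on G)"
    using G by (rule finite_measure_lebesgue_on_bounded)
  have Gb: "G \<in> sets borel" using G by auto
  have vL: "v \<in> L2_space G" using v by (simp add: V_space_def H_space_def)
  have nn: "P \<ge> 0" "B \<ge> 0" "J \<ge> 0"
    using p(2) h(2) j(2) norm_ge_zero order_trans by blast+
  define q where "q = (\<lambda>z. tensor_app (h z) (p z))"
  have q_meas[measurable]: "q \<in> borel_measurable borel"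
  proof -
    have "continuous_on UNIV (\<lambda>z. tensor_app (fst z :: ('k, 'd) tensor) (snd z))"
      by (intro bounded_bilinear.continuous_on[OF bounded_bilinear_tensor_app] continuous_intros)
    then have "(\<lambda>z. tensor_app (fst z :: ('k, 'd) tensor) (snd z)) \<in> borel_measurable borel"
      by (rule borel_measurable_continuous_onI)
    from measurable_compose[OF borel_measurable_Pair[OF h(1) p(1)] this] show ?thesis
      by (simp add: q_def)
  qed
  have q_bound: "norm (q z) \<le> B * P" for z
    unfolding q_def using norm_tensor_app_le h(2) p(2) nn by (meson mult_mono norm_ge_zero order_trans)
  have q0: "q z = 0" if "z \<notin> {0<..<T} \<times> G" for z
    using p(3)[OF that] by (simp add: q_def bounded_bilinear.zero_right[OF bounded_bilinear_tensor_app])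
  define \<gamma> where "\<gamma> \<rho> = - (LBINT x. q (\<rho>, x) \<bullet> j x)" for \<rho>
  obtain R where R: "G \<subseteq> cball 0 R"
    using G(2) unfolding bounded_iff by (metis mem_cball_0 subsetI)
  have qj: "\<bar>q (\<rho>, x) \<bullet> j x\<bar> \<le> B * P * J" for \<rho> x
    using Cauchy_Schwarz_ineq2[of "q (\<rho>, x)" "j x"]
      mult_mono[OF q_bound j(2) mult_nonneg_nonneg[OF nn(2,1)] norm_ge_zero, of "(\<rho>, x)" x] by (rule order_trans)
  have \<gamma>: "\<gamma> \<in> borel_measurable borel" "\<bar>\<gamma> \<rho>\<bar> \<le> B * P * J * measure lborel (cball (0::real^'d) R)" for \<rho>
  proof -
    show "\<gamma> \<in> borel_measurable borel"
      unfolding \<gamma>_def by measurable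
    show "\<bar>\<gamma> \<rho>\<bar> \<le> B * P * J * measure lborel (cball (0::real^'d) R)"
      unfolding \<gamma>_def abs_minus_cancel
      by (rule integrable_bounded_support(2)[OF G(2)]) (use qj q0 R in auto)
  qed
  define m where "m t = (LINT x|lebesgue_on G. W t x \<bullet> v x)" for t
  have Wd: "(\<lambda>x. W s x - W t x) \<in> L2_space G" if "s \<in> {0..T}" "t \<in> {0..T}" for s t
    using L2_space_linear[OF W(1)[OF that(1)] W(1)[OF that(2)], of 1 "-1"] by simp
  have m_diff: "m s - m t = (LINT x|lebesgue_on G. (W s x - W t x) \<bullet> v x)" if "s \<in> {0..T}" "t \<in> {0..T}" for s t
    unfolding m_def inner_diff_left using that
    by (intro Bochner_Integration.integral_diff[symmetric] L2_space_inner W vL)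
  have m_cont: "continuous_on {0..T} m"
    unfolding continuous_on_def
  proof
    fix t assume t: "t \<in> {0..T}"
    have ev: "\<forall>\<^sub>F s in at t within {0..T}. s \<in> {0..T}"
      by (simp add: eventually_at_filter)
    show "(m \<longlongrightarrow> m t) (at t within {0..T})"
    proof (rule LIM_zero_cancel, rule Lim_null_comparison)
      show "\<forall>\<^sub>F s in at t within {0..T}. norm (m s - m t) \<le> L2_norm G (\<lambda>x. W s x - W t x) * L2_norm G v"
        using ev
      proof eventually_elim
        case (elim s)
        show ?case
          unfolding m_diff[OF elim t] real_norm_def by (rule L2_Cauchy_Schwarz[OF Wd[OF elim t] vL])
      qed
      show "((\<lambda>s. L2_norm G (\<lambda>x. W s x - W t x) * L2_norm G v) \<longlongrightarrow> 0) (at t within {0..T})"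
        using tendsto_mult_left_zero[OF W(2)[OF t]] by simp
    qed
  qed
  have m_ae: "AE t in lebesgue_on {0<..<T}. gelfand_embed G (u t) v = m t"
  proof -
    have "AE t in lborel. t \<in> {0<..<T} \<longrightarrow> gelfand_embed G (u t) v = m t"
      using ae
    proof eventually_elim
      case (elim t)
      show ?case
      proof
        assume t: "t \<in> {0<..<T}"
        then have V: "u t \<in> L2_space G" "W t \<in> L2_space G" and eq: "AE x in lebesgue_on G. u t x = W t x"
          using elim W(1)[of t] by (auto simp: V_space_def H_space_def)
        show "gelfand_embed G (u t) v = m t"
          unfolding gelfand_embed_def m_def using V vL eq
          by (intro integral_cong_AE borel_measurable_inner) (auto simp: L2_space_def elim: eventually_mono)
      qed
    qed
    then show ?thesis by (simp add: AE_lborel_lebesgue_on_iff)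
  qed
  have \<gamma>_ae: "AE t in lebesgue_on {0<..<T}. u' t v = \<gamma> t"
  proof -
    have "AE t in lborel. t \<in> {0<..<T} \<longrightarrow> (\<forall>v\<in>V_space G. u' t v + A_op G (H t) (u t) v = 0)"
      using u'(2) by (simp add: AE_lborel_lebesgue_on_iff)
    then have "AE t in lborel. t \<in> {0<..<T} \<longrightarrow> u' t v = \<gamma> t"
      using ae
    proof eventually_elim
      case (elim t)
      show ?case
      proof
        assume t: "t \<in> {0<..<T}"
        have "A_op G (H t) (u t) v = (LBINT x. q (t, x) \<bullet> j x)"
          unfolding A_op_def
        proof (rule integral_lebesgue_on_eq_lborel[OF Gb])
          have "AE x in lebesgue_on G. weak_jacobian G (u t) x = p (t, x)" "AE x in lebesgue_on G. H t x = h (t, x)"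
            using elim t by auto
          with j(3) show "AE x in lebesgue_on G. tensor_app (H t x) (weak_jacobian G (u t) x) \<bullet> weak_jacobian G v x = q (t, x) \<bullet> j x"
            by eventually_elim (simp add: q_def)
        qed (use q0 in simp_all)
        with elim(1) t v show "u' t v = \<gamma> t"
          unfolding \<gamma>_def by force
      qed
    qed
    then show ?thesis by (simp add: AE_lborel_lebesgue_on_iff)
  qed
  have "m b - m a = (LBINT r. indicator {a<..b} r * \<gamma> r)"
  proof (rule bochner_H1_deriv_functional[where l="\<lambda>f. f v" and C="H1_norm G v + 1",
        OF u'(1) _ _ _ _ m_cont m_ae \<gamma> \<gamma>_ae ab])
    show "\<And>f g a b. f \<in> V_dual G \<Longrightarrow> g \<in> V_dual G \<Longrightarrow> (\<lambda>v. a *\<^sub>R f v + b *\<^sub>R g v) \<in> V_dual G"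
      by (rule V_dual_linear)
    show "\<And>f. f \<in> V_dual G \<Longrightarrow> \<bar>f v\<bar> \<le> (H1_norm G v + 1) * V_dual_norm G f"
      by (rule V_dual_bound[OF G(1) fin _ v])
    show "0 < H1_norm G v + 1" using H1_norm_nonneg[of G v] by simp
  qed simp
  moreover have "m b - m a = (LINT x|lebesgue_on G. (W b x - W a x) \<bullet> v x)"
    using ab by (intro m_diff) auto
  ultimately show ?thesis
    by (simp add: \<gamma>_def q_def)
qed

text \<open>
  The functional is the pairing with \<open>\<xi>\<close>. The derivative is read off from the differential equation, solved
  for \<open>H'\<close>.
\<close>

lemma tensor_equation_integrated:
  fixes G :: "(real^'d::finite) set" and K H :: "real \<Rightarrow> real^'d \<Rightarrow> ('k::finite, 'd) tensor"
    and p :: "real \<times> (real^'d) \<Rightarrow> ('k, 'd) matr" and h :: "real \<times> (real^'d) \<Rightarrow> ('k, 'd) tensor"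
  assumes G: "open G" "bounded G" and T: "T > 0" and \<tau>: "\<tau> > 0"
    and H': "bochner_H1_deriv T (Linf_space G sym_tensors) (Linf_norm G) H H'"
      "AE t in lebesgue_on {0<..<T}. AE x in lebesgue_on G. \<tau> *\<^sub>R H' t x + H t x - F (weak_jacobian G (u t) x) = 0"
    and K: "\<And>t. t \<in> {0..T} \<Longrightarrow> K t \<in> Linf_space G sym_tensors"
      "\<And>t. t \<in> {0..T} \<Longrightarrow> ((\<lambda>s. Linf_norm G (\<lambda>x. K s x - K t x)) \<longlongrightarrow> 0) (at t within {0..T})"
    and F: "continuous_on UNIV F" "\<And>z. norm (F (p z)) \<le> c"
    and p: "p \<in> borel_measurable borel"
    and h: "h \<in> borel_measurable borel" "\<And>z. norm (h z) \<le> B"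
    and ae: "AE t in lborel. t \<in> {0<..<T} \<longrightarrow>
        (AE x in lebesgue_on G. weak_jacobian G (u t) x = p (t, x)) \<and>
        (AE x in lebesgue_on G. H t x = h (t, x)) \<and> (AE x in lebesgue_on G. H t x = K t x)"
    and \<xi>: "\<xi> \<in> borel_measurable borel" "\<And>x. norm (\<xi> x) \<le> J"
    and ab: "0 \<le> a" "a \<le> b" "b < T"
  shows "(LINT x|lebesgue_on G. (K b x - K a x) \<bullet> \<xi> x) =
      (LBINT \<rho>. indicator {a<..b} \<rho> * (LBINT x. (indicator G x / \<tau>) *\<^sub>R (F (p (\<rho>, x)) - h (\<rho>, x)) \<bullet> \<xi> x))"
proof -
  have [measurable]: "p \<in> borel_measurable borel" "h \<in> borel_measurable borel" "\<xi> \<in> borel_measurable borel"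
    "F \<in> borel_measurable borel"
    using p h \<xi> F by (auto intro: borel_measurable_continuous_onI)
  have fin: "finite_measure (lebesgue_on G)"
    using G by (rule finite_measure_lebesgue_on_bounded)
  have Gb[measurable]: "G \<in> sets borel" using G by auto
  have \<xi>G: "\<xi> \<in> borel_measurable (lebesgue_on G)"
    using \<xi>(1) by (intro measurable_restrict_space1 borel_measurable_lebesgueI)
  have nn: "c \<ge> 0" "B \<ge> 0" "J \<ge> 0"
    using F(2) h(2) \<xi>(2) norm_ge_zero order_trans by blast+
  define q where "q = (\<lambda>z. (indicator G (snd z) / \<tau>) *\<^sub>R (F (p z) - h z))"
  have q_meas[measurable]: "q \<in> borel_measurable borel"
  proof -
    have [measurable]: "(snd :: real \<times> (real^'d) \<Rightarrow> real^'d) \<in> borel_measurable borel"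
      by (intro borel_measurable_continuous_onI continuous_intros)
    show ?thesis unfolding q_def by measurable
  qed
  have q_bound: "norm (q z) \<le> 1 / \<tau> * (c + B)" for z
  proof -
    have "norm (q z) = indicator G (snd z) / \<tau> * norm (F (p z) - h z)"
      using \<tau> by (simp add: q_def indicator_def)
    also have "\<dots> \<le> 1 / \<tau> * (c + B)"
      using \<tau> norm_triangle_ineq4[of "F (p z)" "h z"] F(2)[of z] h(2)[of z]
      by (intro mult_mono divide_right_mono) (auto simp: indicator_def)
    finally show ?thesis .
  qed
  define \<gamma> where "\<gamma> \<rho> = (LBINT x. q (\<rho>, x) \<bullet> \<xi> x)" for \<rho>
  obtain R where R: "G \<subseteq> cball 0 R"
    using G(2) unfolding bounded_iff by (metis mem_cball_0 subsetI)
  have qx: "\<bar>q (\<rho>, x) \<bullet> \<xi> x\<bar> \<le> 1 / \<tau> * (c + B) * J" for \<rho> x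
    using Cauchy_Schwarz_ineq2[of "q (\<rho>, x)" "\<xi> x"]
      mult_mono[OF q_bound \<xi>(2) _ norm_ge_zero, of "(\<rho>, x)" x] nn \<tau> by force
  have q0: "q (\<rho>, x) = 0" if "x \<notin> G" for \<rho> x
    using that by (simp add: q_def)
  have \<gamma>: "\<gamma> \<in> borel_measurable borel" "\<bar>\<gamma> \<rho>\<bar> \<le> 1 / \<tau> * (c + B) * J * measure lborel (cball (0::real^'d) R)" for \<rho>
  proof -
    show "\<gamma> \<in> borel_measurable borel"
      unfolding \<gamma>_def by measurable
    show "\<bar>\<gamma> \<rho>\<bar> \<le> 1 / \<tau> * (c + B) * J * measure lborel (cball (0::real^'d) R)"
      unfolding \<gamma>_def
      by (rule integrable_bounded_support(2)[OF G(2)]) (use qx q0 R in auto)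
  qed
  define l where "l f = (LINT x|lebesgue_on G. f x \<bullet> \<xi> x)" for f
  define C where "C = J * measure (lebesgue_on G) (space (lebesgue_on G)) + 1"
  have C: "C > 0"
    using nn by (simp add: C_def add_nonneg_pos)
  have l_bound: "\<bar>l f\<bar> \<le> C * Linf_norm G f" if "f \<in> Linf_space G sym_tensors" for f
    unfolding l_def C_def by (rule Linf_inner_bound[OF fin that \<xi>G \<xi>(2)])
  have l_int: "integrable (lebesgue_on G) (\<lambda>x. f x \<bullet> \<xi> x)" if "f \<in> Linf_space G sym_tensors" for f
    by (rule Linf_inner_bound[OF fin that \<xi>G \<xi>(2)])
  have l_lin: "l (\<lambda>x. a *\<^sub>R f x + b *\<^sub>R g x) = a * l f + b * l g"
    if "f \<in> Linf_space G sym_tensors" "g \<in> Linf_space G sym_tensors" for f g a b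
    unfolding l_def using l_int[OF that(1)] l_int[OF that(2)] by (simp add: inner_add_left)
  have Kd: "(\<lambda>x. K s x - K t x) \<in> Linf_space G sym_tensors" if "s \<in> {0..T}" "t \<in> {0..T}" for s t
    using Linf_space_linear[OF subspace_sym_tensors K(1)[OF that(1)] K(1)[OF that(2)], of 1 "-1"] by simp
  have l_diff: "l (K s) - l (K t) = l (\<lambda>x. K s x - K t x)" if "s \<in> {0..T}" "t \<in> {0..T}" for s t
    using l_lin[OF K(1)[OF that(1)] K(1)[OF that(2)], of 1 "-1"] by simp
  have m_cont: "continuous_on {0..T} (\<lambda>t. l (K t))"
    unfolding continuous_on_def
  proof
    fix t assume t: "t \<in> {0..T}"
    have ev: "\<forall>\<^sub>F s in at t within {0..T}. s \<in> {0..T}"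
      by (simp add: eventually_at_filter)
    show "((\<lambda>t. l (K t)) \<longlongrightarrow> l (K t)) (at t within {0..T})"
    proof (rule LIM_zero_cancel, rule Lim_null_comparison)
      show "\<forall>\<^sub>F s in at t within {0..T}. norm (l (K s) - l (K t)) \<le> C * Linf_norm G (\<lambda>x. K s x - K t x)"
        using ev
      proof eventually_elim
        case (elim s)
        show ?case
          unfolding l_diff[OF elim t] real_norm_def by (rule l_bound[OF Kd[OF elim t]])
      qed
      show "((\<lambda>s. C * Linf_norm G (\<lambda>x. K s x - K t x)) \<longlongrightarrow> 0) (at t within {0..T})"
        using tendsto_mult_right_zero[OF K(2)[OF t]] by simp
    qed
  qed
  have m_ae: "AE t in lebesgue_on {0<..<T}. l (H t) = l (K t)"
  proof -
    have Hm: "AE t in lborel. t \<in> {0<..<T} \<longrightarrow> H t \<in> Linf_space G sym_tensors"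
      using H'(1) by (simp add: bochner_H1_deriv_def bochner_L2_def strongly_measurable_def AE_lborel_lebesgue_on_iff)
    have "AE t in lborel. t \<in> {0<..<T} \<longrightarrow> l (H t) = l (K t)"
      using ae Hm
    proof eventually_elim
      case (elim t)
      show ?case
      proof
        assume t: "t \<in> {0<..<T}"
        then have V: "H t \<in> Linf_space G sym_tensors" "K t \<in> Linf_space G sym_tensors" and eq: "AE x in lebesgue_on G. H t x = K t x"
          using elim K(1)[of t] by auto
        show "l (H t) = l (K t)"
          unfolding l_def using V \<xi>G eq
          by (intro integral_cong_AE borel_measurable_inner) (auto simp: Linf_space_def elim: eventually_mono)
      qed
    qed
    then show ?thesis by (simp add: AE_lborel_lebesgue_on_iff)
  qed
  have \<gamma>_ae: "AE t in lebesgue_on {0<..<T}. l (H' t) = \<gamma> t"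
  proof -
    have "AE t in lborel. t \<in> {0<..<T} \<longrightarrow> (AE x in lebesgue_on G. \<tau> *\<^sub>R H' t x + H t x - F (weak_jacobian G (u t) x) = 0)"
      using H'(2) by (simp add: AE_lborel_lebesgue_on_iff)
    then have "AE t in lborel. t \<in> {0<..<T} \<longrightarrow> l (H' t) = \<gamma> t"
      using ae
    proof eventually_elim
      case (elim t)
      show ?case
      proof
        assume t: "t \<in> {0<..<T}"
        show "l (H' t) = \<gamma> t"
          unfolding l_def \<gamma>_def
        proof (rule integral_lebesgue_on_eq_lborel[OF Gb])
          have "AE x in lebesgue_on G. weak_jacobian G (u t) x = p (t, x)" "AE x in lebesgue_on G. H t x = h (t, x)"
            "AE x in lebesgue_on G. \<tau> *\<^sub>R H' t x + H t x - F (weak_jacobian G (u t) x) = 0"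
            using elim t by auto
          moreover have "AE x in lebesgue_on G. x \<in> G"
            using AE_space[of "lebesgue_on G"] by (simp add: space_restrict_space)
          ultimately show "AE x in lebesgue_on G. H' t x \<bullet> \<xi> x = q (t, x) \<bullet> \<xi> x"
          proof eventually_elim
            case (elim x)
            then have "\<tau> *\<^sub>R H' t x = F (p (t, x)) - h (t, x)"
              by (simp add: algebra_simps)
            then have "(1 / \<tau>) *\<^sub>R (\<tau> *\<^sub>R H' t x) = (1 / \<tau>) *\<^sub>R (F (p (t, x)) - h (t, x))"
              by simp
            then show ?case
              using \<tau> elim(4) by (simp add: q_def)
          qed
        qed (use q0 in simp_all)
      qed
    qed
    then show ?thesis by (simp add: AE_lborel_lebesgue_on_iff)
  qed
  have "l (K b) - l (K a) = (LBINT r. indicator {a<..b} r * \<gamma> r)"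
    by (rule bochner_H1_deriv_functional[where l=l,
          OF H'(1) Linf_space_linear[OF subspace_sym_tensors] l_lin C l_bound m_cont m_ae \<gamma> \<gamma>_ae ab])
  moreover have "l (K b) - l (K a) = l (\<lambda>x. K b x - K a x)"
    using ab by (intro l_diff) auto
  ultimately show ?thesis
    by (simp add: \<gamma>_def q_def l_def)
qed

text \<open>
  The boundedness of \<open>H\<close> on space-time comes from its continuity in time with values in \<open>L\<^sup>\<infinity>\<close>. This gives a
  bound for almost every \<open>x\<close> at almost every time, which has to be transferred to space-time through a
  Borel representative \<open>h0\<close> before the bounded representative \<open>h\<close> can be chosen.
\<close>

lemma weak_solution_integrated:
  fixes G :: "(real^'d::finite) set" and F :: "('k::finite, 'd) matr \<Rightarrow> ('k, 'd) tensor"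
  assumes G: "open G" "bounded G" and T: "T > 0" and \<tau>: "\<tau> > 0" and F: "L-lipschitz_on UNIV F"
    and sol: "weak_solution T G \<tau> F u0 H0 u H" and grad: "bounded_gradient T G u"
  obtains W K p h \<kappa> where "integrated_solution T G \<tau> F u W K p h" "\<kappa> > 0"
    "AE z in lborel. z \<in> {0<..<T} \<times> G \<longrightarrow> h z \<in> sym_tensors_ge \<kappa>"
    "L2_norm G (\<lambda>x. W 0 x - u0 x) = 0" "Linf_norm G (\<lambda>x. K 0 x - H0 x) = 0"
proof -
  let ?\<Omega> = "{0<..<T} \<times> G"
  have Gb: "G \<in> sets borel" using G by auto
  have \<Omega>: "?\<Omega> \<in> sets borel" using Gb by (intro borel_Times) auto
  obtain \<kappa> u' H' W K where \<kappa>: "\<kappa> > 0" "AE (t, x) in lebesgue_on ?\<Omega>. H t x \<in> sym_tensors_ge \<kappa>"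
    and Hm: "(\<lambda>(t, x). H t x) \<in> borel_measurable (lebesgue_on ?\<Omega>)"
    and uL2: "u \<in> bochner_L2 T (V_space G) (H1_norm G)"
    and u': "bochner_H1_deriv T (V_dual G) (V_dual_norm G) (\<lambda>t. gelfand_embed G (u t)) u'"
      "AE t in lebesgue_on {0<..<T}. \<forall>v\<in>V_space G. u' t v + A_op G (H t) (u t) v = 0"
    and H': "bochner_H1_deriv T (Linf_space G sym_tensors) (Linf_norm G) H H'"
      "AE t in lebesgue_on {0<..<T}. AE x in lebesgue_on G. \<tau> *\<^sub>R H' t x + H t x - F (weak_jacobian G (u t) x) = 0"
    and W: "\<forall>t\<in>{0..T}. W t \<in> H_space G"
      "\<forall>t\<in>{0..T}. ((\<lambda>s. L2_norm G (\<lambda>x. W s x - W t x)) \<longlongrightarrow> 0) (at t within {0..T})"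
      "AE t in lebesgue_on {0<..<T}. u t \<in> H_space G \<and> L2_norm G (\<lambda>x. u t x - W t x) = 0"
      "L2_norm G (\<lambda>x. W 0 x - u0 x) = 0"
    and K: "\<forall>t\<in>{0..T}. K t \<in> Linf_space G sym_tensors"
      "\<forall>t\<in>{0..T}. ((\<lambda>s. Linf_norm G (\<lambda>x. K s x - K t x)) \<longlongrightarrow> 0) (at t within {0..T})"
      "AE t in lebesgue_on {0<..<T}. H t \<in> Linf_space G sym_tensors \<and> Linf_norm G (\<lambda>x. H t x - K t x) = 0"
      "Linf_norm G (\<lambda>x. K 0 x - H0 x) = 0"
    using sol unfolding weak_solution_def has_initial_value_def by blast

  have uW: "AE t in lborel. t \<in> {0<..<T} \<longrightarrow> (AE x in lebesgue_on G. u t x = W t x)"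
    using W(3)[unfolded AE_lborel_lebesgue_on_iff[OF borel_open[OF open_greaterThanLessThan]]]
  proof eventually_elim
    case (elim t)
    show ?case
    proof
      assume t: "t \<in> {0<..<T}"
      then have "u t \<in> L2_space G" "W t \<in> L2_space G"
        using elim W(1) by (auto simp: H_space_def)
      then have "(\<lambda>x. u t x - W t x) \<in> L2_space G"
        using L2_space_linear[of "u t" G "W t" 1 "-1"] by simp
      then have "AE x in lebesgue_on G. u t x - W t x = 0"
        using elim t by (intro L2_norm_eq_0D) auto
      then show "AE x in lebesgue_on G. u t x = W t x" by simp
    qed
  qed
  have HK: "AE t in lborel. t \<in> {0<..<T} \<longrightarrow> (AE x in lebesgue_on G. H t x = K t x)"
    using K(3)[unfolded AE_lborel_lebesgue_on_iff[OF borel_open[OF open_greaterThanLessThan]]]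
  proof eventually_elim
    case (elim t)
    show ?case
    proof
      assume t: "t \<in> {0<..<T}"
      then have "H t \<in> Linf_space G sym_tensors" "K t \<in> Linf_space G sym_tensors"
        using elim K(1) by auto
      from Linf_norm_AE[OF Linf_space_linear[OF subspace_sym_tensors this, of 1 "-1"]]
      show "AE x in lebesgue_on G. H t x = K t x"
        using elim t by simp
    qed
  qed

  obtain Du P0 where Du: "(\<lambda>(t, x). Du t x) \<in> borel_measurable (lebesgue_on ?\<Omega>)"
      "AE z in lebesgue_on ?\<Omega>. norm (case z of (t, x) \<Rightarrow> Du t x) \<le> P0"
    and Dw: "AE t in lebesgue_on {0<..<T}. has_weak_jacobian G (u t) (Du t)"
    using grad unfolding bounded_gradient_def Linf_space_def by auto
  have DuP: "AE z in lebesgue_on ?\<Omega>. norm (case z of (t, x) \<Rightarrow> Du t x) \<le> max P0 0"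
    using Du(2) by eventually_elim simp
  obtain p where p: "p \<in> borel_measurable borel" "\<And>z. z \<notin> ?\<Omega> \<Longrightarrow> p z = 0"
      "AE z in lborel. z \<in> ?\<Omega> \<longrightarrow> (case z of (t, x) \<Rightarrow> Du t x) = p z" "\<And>z. norm (p z) \<le> max P0 0"
    using bounded_borel_representative[OF \<Omega> Du(1) DuP max.cobounded2] by blast
  have up: "AE t in lborel. t \<in> {0<..<T} \<longrightarrow> (AE x in lebesgue_on G. weak_jacobian G (u t) x = p (t, x))"
    using AE_time_space[OF p(3)] Dw[unfolded AE_lborel_lebesgue_on_iff[OF borel_open[OF open_greaterThanLessThan]]]
  proof eventually_elim
    case (elim t)
    show ?case
    proof
      assume t: "t \<in> {0<..<T}"
      have "AE x in lebesgue_on G. Du t x = p (t, x)"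
        using elim(1) t by (simp add: AE_lborel_lebesgue_on_iff[OF Gb])
      moreover have "AE x in lebesgue_on G. weak_jacobian G (u t) x = Du t x"
        using elim(2) t by (intro weak_jacobian_eq[OF G(1)]) auto
      ultimately show "AE x in lebesgue_on G. weak_jacobian G (u t) x = p (t, x)"
        by eventually_elim simp
    qed
  qed

  obtain B where B: "B \<ge> 0" "\<And>t. t \<in> {0..T} \<Longrightarrow> Linf_norm G (K t) \<le> B"
    using Linf_norm_bounded_on_interval[OF subspace_sym_tensors, of T K G] K(1,2) by blast
  obtain h0 where h0: "h0 \<in> borel_measurable borel" "AE z in lborel. z \<in> ?\<Omega> \<longrightarrow> (case z of (t, x) \<Rightarrow> H t x) = h0 z"
    using borel_representative[OF \<Omega> Hm] by blast
  have "AE z in lborel. z \<in> ?\<Omega> \<longrightarrow> norm (h0 z) \<le> B"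
  proof (rule AE_time_spaceI[OF _ Gb])
    show "{z. norm (h0 z) \<le> B} \<in> sets borel"
      using h0(1) by measurable
    show "AE t in lborel. t \<in> {0<..<T} \<longrightarrow> (AE x in lborel. x \<in> G \<longrightarrow> norm (h0 (t, x)) \<le> B)"
      using AE_time_space[OF h0(2)] HK
    proof eventually_elim
      case (elim t)
      show ?case
      proof
        assume t: "t \<in> {0<..<T}"
        have "AE x in lebesgue_on G. H t x = h0 (t, x)"
          using elim(1) t by (simp add: AE_lborel_lebesgue_on_iff[OF Gb])
        moreover have "AE x in lebesgue_on G. H t x = K t x"
          using elim(2) t by auto
        moreover have "AE x in lebesgue_on G. norm (K t x) \<le> Linf_norm G (K t)"
          using K(1) t by (intro Linf_norm_AE[of _ _ sym_tensors]) auto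
        ultimately have "AE x in lebesgue_on G. norm (h0 (t, x)) \<le> B"
        proof eventually_elim
          case (elim x)
          then show ?case using B(2)[of t] t by simp
        qed
        then show "AE x in lborel. x \<in> G \<longrightarrow> norm (h0 (t, x)) \<le> B"
          by (simp add: AE_lborel_lebesgue_on_iff[OF Gb])
      qed
    qed
  qed
  with h0(2) have "AE z in lborel. z \<in> ?\<Omega> \<longrightarrow> norm (case z of (t, x) \<Rightarrow> H t x) \<le> B"
    by eventually_elim simp
  then have HB: "AE z in lebesgue_on ?\<Omega>. norm (case z of (t, x) \<Rightarrow> H t x) \<le> B"
    by (simp only: AE_lborel_lebesgue_on_iff[OF \<Omega>])
  obtain h where h: "h \<in> borel_measurable borel" "\<And>z. z \<notin> ?\<Omega> \<Longrightarrow> h z = 0"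
      "AE z in lborel. z \<in> ?\<Omega> \<longrightarrow> (case z of (t, x) \<Rightarrow> H t x) = h z" "\<And>z. norm (h z) \<le> B"
    using bounded_borel_representative[OF \<Omega> Hm HB B(1)] by blast
  have Hh: "AE t in lborel. t \<in> {0<..<T} \<longrightarrow> (AE x in lebesgue_on G. H t x = h (t, x))"
    using AE_time_space[OF h(3)] by (simp add: AE_lborel_lebesgue_on_iff[OF Gb])
  have uV: "AE t in lborel. t \<in> {0<..<T} \<longrightarrow> u t \<in> V_space G"
    using uL2 by (simp add: bochner_L2_def strongly_measurable_def AE_lborel_lebesgue_on_iff)

  have Fc: "continuous_on UNIV F"
    using F by (rule lipschitz_on_continuous_on)
  have Fp: "norm (F (p z)) \<le> norm (F 0) + L * max P0 0" for z
  proof -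
    have "dist (F (p z)) (F 0) \<le> L * dist (p z) 0"
      using F by (rule lipschitz_onD) auto
    also have "\<dots> \<le> L * max P0 0"
      using p(4)[of z] lipschitz_on_nonneg[OF F] by (intro mult_left_mono) auto
    finally show ?thesis
      using norm_triangle_ineq2[of "F (p z)" "F 0"] by (simp add: dist_norm)
  qed
  have ae1: "AE t in lborel. t \<in> {0<..<T} \<longrightarrow> u t \<in> V_space G \<and> (AE x in lebesgue_on G. u t x = W t x) \<and>
        (AE x in lebesgue_on G. weak_jacobian G (u t) x = p (t, x)) \<and>
        (AE x in lebesgue_on G. H t x = h (t, x))"
    using uV uW up Hh by eventually_elim blast
  have ae2: "AE t in lborel. t \<in> {0<..<T} \<longrightarrow>
        (AE x in lebesgue_on G. weak_jacobian G (u t) x = p (t, x)) \<and>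
        (AE x in lebesgue_on G. H t x = h (t, x)) \<and> (AE x in lebesgue_on G. H t x = K t x)"
    using up Hh HK by eventually_elim blast
  have ae3: "AE t in lborel. t \<in> {0<..<T} \<longrightarrow> u t \<in> V_space G \<and>
        (AE x in lebesgue_on G. u t x = W t x) \<and>
        (AE x in lebesgue_on G. weak_jacobian G (u t) x = p (t, x)) \<and>
        (AE x in lebesgue_on G. K t x = h (t, x))"
    using ae1 HK
  proof eventually_elim
    case (elim t)
    show ?case
    proof
      assume t: "t \<in> {0<..<T}"
      have "AE x in lebesgue_on G. K t x = h (t, x)"
        using conjunct2[OF conjunct2[OF conjunct2[OF mp[OF elim(1) t]]]] mp[OF elim(2) t] by eventually_elim simp
      with elim(1) t show "u t \<in> V_space G \<and> (AE x in lebesgue_on G. u t x = W t x) \<and>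
        (AE x in lebesgue_on G. weak_jacobian G (u t) x = p (t, x)) \<and> (AE x in lebesgue_on G. K t x = h (t, x))"
        by blast
    qed
  qed

  have "integrated_solution T G \<tau> F u W K p h"
    unfolding integrated_solution_def
  proof (intro conjI allI impI W(1,2) K(1) p(1) h(1) p(2) h(2) ae3)
    show "bounded (range p)" "bounded (range h)"
      using p(4) h(4) by (auto simp: bounded_iff)
  next
    fix v :: "real^'d \<Rightarrow> real^'k" and j a b
    assume v: "v \<in> V_space G" and j: "j \<in> borel_measurable borel" "bounded (range j)" "AE x in lebesgue_on G. weak_jacobian G v x = j x"
      and ab: "0 \<le> a" "a \<le> b" "b < T"
    obtain J where J: "\<And>x. norm (j x) \<le> J"
      using j(2) by (auto simp: bounded_iff)
    show "(LINT x|lebesgue_on G. (W b x - W a x) \<bullet> v x) =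
           - (LBINT \<rho>. indicator {a<..b} \<rho> * (LBINT x. tensor_app (h (\<rho>, x)) (p (\<rho>, x)) \<bullet> j x))"
      by (rule momentum_equation_integrated[OF G T u' _ _ p(1,4,2) h(1,4,2) ae1 v j(1) J j(3) ab])
         (use W(1,2) in \<open>auto simp: H_space_def\<close>)
  next
    fix \<xi> :: "real^'d \<Rightarrow> ('k, 'd) tensor" and a b
    assume \<xi>: "\<xi> \<in> borel_measurable borel" "bounded (range \<xi>)" and ab: "0 \<le> a" "a \<le> b" "b < T"
    obtain J where J: "\<And>x. norm (\<xi> x) \<le> J"
      using \<xi>(2) by (auto simp: bounded_iff)
    show "(LINT x|lebesgue_on G. (K b x - K a x) \<bullet> \<xi> x) =
           (LBINT \<rho>. indicator {a<..b} \<rho> *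
              (LBINT x. (indicator G x / \<tau>) *\<^sub>R (F (p (\<rho>, x)) - h (\<rho>, x)) \<bullet> \<xi> x))"
      by (rule tensor_equation_integrated[OF G T \<tau> H' _ _ Fc Fp p(1) h(1,4) ae2 \<xi>(1) J ab])
         (use K(1,2) in auto)
  qed
  moreover have "AE z in lborel. z \<in> ?\<Omega> \<longrightarrow> h z \<in> sym_tensors_ge \<kappa>"
    using \<kappa>(2)[unfolded AE_lborel_lebesgue_on_iff[OF \<Omega>]] h(3) by eventually_elim auto
  ultimately show ?thesis
    using that \<kappa>(1) W(4) K(4) by blast
qed

section \<open>Integrals over space-time\<close>

text \<open>
  For these functions all integrals over slices exist and are bounded uniformly in time.
\<close>

definition bounded_slices :: "'e::euclidean_space set \<Rightarrow> (real \<times> 'e \<Rightarrow> 'm::euclidean_space) \<Rightarrow> bool" where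
  "bounded_slices G f \<longleftrightarrow> f \<in> borel_measurable borel \<and> bounded (range f) \<and> (\<forall>r x. x \<notin> G \<longrightarrow> f (r, x) = 0)"

definition spacetime_integral :: "(real \<times> 'e::euclidean_space \<Rightarrow> real) \<Rightarrow> real \<Rightarrow> real \<Rightarrow> real" where
  "spacetime_integral f a b = (LBINT \<rho>. indicator {a<..b} \<rho> * (LBINT x. f (\<rho>, x)))"

context
  fixes G :: "'e::euclidean_space set"
  assumes G: "bounded G"
begin

lemma bounded_slices_integrals:
  fixes f :: "real \<times> 'e \<Rightarrow> real"
  assumes f: "bounded_slices G f"
  shows "integrable lborel (\<lambda>x. f (\<rho>, x))"
    and "(\<lambda>\<rho>. \<integral>x. f (\<rho>, x) \<partial>lborel) \<in> borel_measurable borel"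
    and "\<exists>C. \<forall>\<rho>. \<bar>\<integral>x. f (\<rho>, x) \<partial>lborel\<bar> \<le> C"
    and "integrable lborel (\<lambda>\<rho>. indicator {a<..b} \<rho> * (LBINT x. f (\<rho>, x)))"
proof -
  have [measurable]: "f \<in> borel_measurable borel"
    using f by (simp add: bounded_slices_def)
  obtain B where B: "\<And>z. \<bar>f z\<bar> \<le> B"
    using f by (auto simp: bounded_slices_def bounded_iff)
  obtain R where R: "G \<subseteq> cball 0 R"
    using G unfolding bounded_iff by (metis mem_cball_0 subsetI)
  have zero: "f (\<rho>, x) = 0" if "x \<notin> G" for \<rho> x
    using f that by (simp add: bounded_slices_def)
  show "integrable lborel (\<lambda>x. f (\<rho>, x))"
    by (rule integrable_bounded_support(1)[OF G]) (use B zero in auto)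
  show m: "(\<lambda>\<rho>. \<integral>x. f (\<rho>, x) \<partial>lborel) \<in> borel_measurable borel"
    by measurable
  have C: "\<bar>\<integral>x. f (\<rho>, x) \<partial>lborel\<bar> \<le> B * measure lborel (cball (0::'e) R)" for \<rho>
    by (rule integrable_bounded_support(2)[OF G]) (use B zero R in auto)
  then show "\<exists>C. \<forall>\<rho>. \<bar>\<integral>x. f (\<rho>, x) \<partial>lborel\<bar> \<le> C" by blast
  show "integrable lborel (\<lambda>\<rho>. indicator {a<..b} \<rho> * (LBINT x. f (\<rho>, x)))"
    by (rule integrable_bounded_Ioc[OF m C])
qed

lemma bounded_slices_linear:
  assumes "bounded_slices G f" "bounded_slices G g"
  shows "bounded_slices G (\<lambda>z. a *\<^sub>R f z + b *\<^sub>R g z)"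
proof -
  obtain B1 B2 where B: "\<And>z. norm (f z) \<le> B1" "\<And>z. norm (g z) \<le> B2"
    using assms by (auto simp: bounded_slices_def bounded_iff)
  have "norm (a *\<^sub>R f z + b *\<^sub>R g z) \<le> \<bar>a\<bar> * B1 + \<bar>b\<bar> * B2" for z
    using norm_triangle_ineq[of "a *\<^sub>R f z" "b *\<^sub>R g z"] mult_left_mono[OF B(1)[of z], of "\<bar>a\<bar>"] mult_left_mono[OF B(2)[of z], of "\<bar>b\<bar>"]
    by simp
  then have "bounded (range (\<lambda>z. a *\<^sub>R f z + b *\<^sub>R g z))"
    by (auto simp: bounded_iff)
  then show ?thesis
    using assms by (auto simp: bounded_slices_def)
qed

lemma bounded_slices_inner:
  assumes f: "bounded_slices G f" and g: "g \<in> borel_measurable borel" "bounded (range g)"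
  shows "bounded_slices G (\<lambda>z. f z \<bullet> g z)"
proof -
  obtain B1 B2 where B: "\<And>z. norm (f z) \<le> B1" "\<And>z. norm (g z) \<le> B2"
    using f g(2) by (auto simp: bounded_slices_def bounded_iff)
  have "B1 \<ge> 0" using B(1) norm_ge_zero order_trans by blast
  then have "\<bar>f z \<bullet> g z\<bar> \<le> B1 * B2" for z
    using Cauchy_Schwarz_ineq2[of "f z" "g z"] mult_mono[OF B(1,2) _ norm_ge_zero, of z z] by linarith
  then have "bounded (range (\<lambda>z. f z \<bullet> g z))"
    by (auto simp: bounded_real)
  then show ?thesis
    using f g by (auto simp: bounded_slices_def)
qed

lemma bounded_slices_norm2: "bounded_slices G f \<Longrightarrow> bounded_slices G (\<lambda>z. (norm (f z))\<^sup>2)"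
  using bounded_slices_inner[of f f] by (simp add: bounded_slices_def power2_norm_eq_inner)

lemma spacetime_integral_linear:
  assumes f: "bounded_slices G f" and g: "bounded_slices G g"
  shows "spacetime_integral (\<lambda>z. s * f z + t * g z) a b = s * spacetime_integral f a b + t * spacetime_integral g a b"
proof -
  have eq: "indicator {a<..b} \<rho> * (LBINT x. s * f (\<rho>, x) + t * g (\<rho>, x)) =
      s * (indicator {a<..b} \<rho> * (LBINT x. f (\<rho>, x))) + t * (indicator {a<..b} \<rho> * (LBINT x. g (\<rho>, x)))" for \<rho>
    using bounded_slices_integrals(1)[OF f] bounded_slices_integrals(1)[OF g] by (simp add: distrib_left mult.left_commute)
  show ?thesis
    unfolding spacetime_integral_def eq
    using bounded_slices_integrals(4)[OF f] bounded_slices_integrals(4)[OF g] by simp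
qed

lemma spacetime_integral_mono:
  assumes f: "bounded_slices G f" and g: "bounded_slices G g" and le: "AE z in lborel. f z \<le> g z"
  shows "spacetime_integral f a b \<le> spacetime_integral g a b"
  unfolding spacetime_integral_def
proof (rule integral_mono_AE[OF bounded_slices_integrals(4)[OF f] bounded_slices_integrals(4)[OF g]])
  show "AE \<rho> in lborel. indicator {a<..b} \<rho> * (LBINT x. f (\<rho>, x)) \<le> indicator {a<..b} \<rho> * (LBINT x. g (\<rho>, x))"
    using AE_lborel_sections[OF le]
  proof eventually_elim
    case (elim \<rho>)
    then show ?case
      by (intro mult_left_mono integral_mono_AE bounded_slices_integrals(1) f g) auto
  qed
qed

lemma spacetime_integral_nonneg:
  assumes "\<And>z. 0 \<le> f z"
  shows "0 \<le> spacetime_integral f a b"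
  unfolding spacetime_integral_def using assms by (intro Bochner_Integration.integral_nonneg mult_nonneg_nonneg) auto

end

section \<open>Uniqueness\<close>

text \<open>
  The right-hand side of the tensor equation, solved for the time derivative.
\<close>

definition relaxation ::
    "(real^'d::finite) set \<Rightarrow> real \<Rightarrow> (('k::finite, 'd) matr \<Rightarrow> ('k, 'd) tensor) \<Rightarrow>
     (real \<times> (real^'d) \<Rightarrow> ('k, 'd) matr) \<Rightarrow> (real \<times> (real^'d) \<Rightarrow> ('k, 'd) tensor) \<Rightarrow>
     real \<times> (real^'d) \<Rightarrow> ('k, 'd) tensor" where
  "relaxation G \<tau> F p h z = (indicator G (snd z) / \<tau>) *\<^sub>R (F (p z) - h z)"

context
  fixes T :: real and G :: "(real^'d::finite) set" and \<tau> :: real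
    and F :: "('k::finite, 'd) matr \<Rightarrow> ('k, 'd) tensor"
    and u W :: "real \<Rightarrow> real^'d \<Rightarrow> real^'k" and K :: "real \<Rightarrow> real^'d \<Rightarrow> ('k, 'd) tensor"
    and p :: "real \<times> (real^'d) \<Rightarrow> ('k, 'd) matr" and h :: "real \<times> (real^'d) \<Rightarrow> ('k, 'd) tensor"
  assumes sol: "integrated_solution T G \<tau> F u W K p h"
begin

lemma
  shows solution_in_L2: "t \<in> {0..T} \<Longrightarrow> W t \<in> L2_space G"
    and solution_continuous_in_L2: "t \<in> {0..T} \<Longrightarrow> ((\<lambda>s. L2_norm G (\<lambda>x. W s x - W t x)) \<longlongrightarrow> 0) (at t within {0..T})"
    and tensor_in_Linf: "t \<in> {0..T} \<Longrightarrow> K t \<in> Linf_space G sym_tensors"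
    and gradient_slices: "bounded_slices G p"
    and tensor_slices: "bounded_slices G h"
    and representatives_AE: "AE t in lborel. t \<in> {0<..<T} \<longrightarrow> u t \<in> V_space G \<and>
        (AE x in lebesgue_on G. u t x = W t x) \<and>
        (AE x in lebesgue_on G. weak_jacobian G (u t) x = p (t, x)) \<and>
        (AE x in lebesgue_on G. K t x = h (t, x))"
  using sol unfolding integrated_solution_def bounded_slices_def H_space_def by auto

lemma representatives_zero_outside:
  assumes "z \<notin> {0<..<T} \<times> G"
  shows "p z = 0" and "h z = 0"
  using sol assms unfolding integrated_solution_def by blast+

lemma flux_slices: "bounded_slices G (\<lambda>z. tensor_app (h z) (p z))"
proof -
  have "continuous_on UNIV (\<lambda>z. tensor_app (fst z :: ('k, 'd) tensor) (snd z))"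
    by (intro bounded_bilinear.continuous_on[OF bounded_bilinear_tensor_app] continuous_intros)
  then have "(\<lambda>z. tensor_app (fst z :: ('k, 'd) tensor) (snd z)) \<in> borel_measurable borel"
    by (rule borel_measurable_continuous_onI)
  from measurable_compose[OF borel_measurable_Pair this, of h borel p]
  have m: "(\<lambda>z. tensor_app (h z) (p z)) \<in> borel_measurable borel"
    using tensor_slices gradient_slices by (simp add: bounded_slices_def)
  obtain P B where PB: "\<And>z. norm (p z) \<le> P" "\<And>z. norm (h z) \<le> B"
    using tensor_slices gradient_slices by (auto simp: bounded_slices_def bounded_iff)
  have "B \<ge> 0" using PB norm_ge_zero order_trans by blast
  then have "norm (tensor_app (h z) (p z)) \<le> B * P" for z
    by (intro order_trans[OF norm_tensor_app_le] mult_mono PB) auto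
  then have "bounded (range (\<lambda>z. tensor_app (h z) (p z)))"
    by (auto simp: bounded_iff)
  with m gradient_slices show ?thesis
    by (simp add: bounded_slices_def bounded_bilinear.zero_right[OF bounded_bilinear_tensor_app])
qed

lemma momentum_equation_spacetime:
  assumes "v \<in> V_space G" "j \<in> borel_measurable borel" "bounded (range j)"
    "AE x in lebesgue_on G. weak_jacobian G v x = j x" "0 \<le> a" "a \<le> b" "b < T"
  shows "(LINT x|lebesgue_on G. (W b x - W a x) \<bullet> v x) = - spacetime_integral (\<lambda>z. tensor_app (h z) (p z) \<bullet> j (snd z)) a b"
proof -
  have "(LINT x|lebesgue_on G. (W b x - W a x) \<bullet> v x) =
           - (LBINT \<rho>. indicator {a<..b} \<rho> * (LBINT x. tensor_app (h (\<rho>, x)) (p (\<rho>, x)) \<bullet> j x))"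
    using sol assms unfolding integrated_solution_def by blast
  then show ?thesis by (simp add: spacetime_integral_def)
qed

lemma tensor_equation_spacetime:
  assumes "\<xi> \<in> borel_measurable borel" "bounded (range \<xi>)" "0 \<le> a" "a \<le> b" "b < T"
  shows "(LINT x|lebesgue_on G. (K b x - K a x) \<bullet> \<xi> x) = spacetime_integral (\<lambda>z. relaxation G \<tau> F p h z \<bullet> \<xi> (snd z)) a b"
proof -
  have "(LINT x|lebesgue_on G. (K b x - K a x) \<bullet> \<xi> x) =
           (LBINT \<rho>. indicator {a<..b} \<rho> *
              (LBINT x. (indicator G x / \<tau>) *\<^sub>R (F (p (\<rho>, x)) - h (\<rho>, x)) \<bullet> \<xi> x))"
    using sol assms unfolding integrated_solution_def by blast
  then show ?thesis by (simp add: spacetime_integral_def relaxation_def)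
qed

lemma relaxation_slices:
  assumes F: "L-lipschitz_on UNIV F" and G: "G \<in> sets borel"
  shows "bounded_slices G (relaxation G \<tau> F p h)"
proof -
  have hp: "h \<in> borel_measurable borel" "p \<in> borel_measurable borel"
    using tensor_slices gradient_slices by (auto simp: bounded_slices_def)
  have [measurable]: "(snd :: real \<times> (real^'d) \<Rightarrow> real^'d) \<in> borel_measurable borel" "F \<in> borel_measurable borel"
    "G \<in> sets borel"
    using G lipschitz_on_continuous_on[OF F] by (auto intro!: borel_measurable_continuous_onI continuous_intros)
  note [measurable] = hp
  have m: "relaxation G \<tau> F p h \<in> borel_measurable borel"
    unfolding relaxation_def[abs_def] by measurable
  obtain P B where PB: "\<And>z. norm (p z) \<le> P" "\<And>z. norm (h z) \<le> B"
    using tensor_slices gradient_slices by (auto simp: bounded_slices_def bounded_iff)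
  have "norm (relaxation G \<tau> F p h z) \<le> 1 / \<bar>\<tau>\<bar> * ((norm (F 0) + L * P) + B)" for z
  proof -
    have "dist (F (p z)) (F 0) \<le> L * dist (p z) 0"
      using F by (rule lipschitz_onD) auto
    also have "\<dots> \<le> L * P"
      using PB(1)[of z] lipschitz_on_nonneg[OF F] by (intro mult_left_mono) auto
    finally have "norm (F (p z) - h z) \<le> (norm (F 0) + L * P) + B"
      using norm_triangle_ineq2[of "F (p z)" "F 0"] norm_triangle_ineq4[of "F (p z)" "h z"] PB(2)[of z]
      by (simp add: dist_norm)
    then show ?thesis
      unfolding relaxation_def norm_scaleR by (intro mult_mono) (auto simp: indicator_def)
  qed
  then have "bounded (range (relaxation G \<tau> F p h))"
    by (auto simp: bounded_iff)
  with m show ?thesis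
    by (simp add: bounded_slices_def relaxation_def)
qed

end

text \<open>
  The quantities \<open>Y t\<close> and \<open>Z t\<close> are the integrals of \<open>|\<nabla>w|\<^sup>2\<close> and \<open>|\<delta>|\<^sup>2\<close> up to the time \<open>t\<close>. The energy identity
  bounds \<open>\<kappa> Y t\<close> by a multiple of \<open>Z t\<close>, the tensor equation bounds \<open>Z\<close> by a multiple of the integral of
  \<open>Y + Z\<close>, and Gronwall's inequality applies to \<open>Z\<close>.
\<close>

lemma integrated_solutions_unique:
  fixes G :: "(real^'d::finite) set" and F :: "('k::finite, 'd) matr \<Rightarrow> ('k, 'd) tensor"
  assumes G: "open G" "bounded G" and T: "T > 0" and \<tau>: "\<tau> > 0" and F: "L-lipschitz_on UNIV F"
    and s1: "integrated_solution T G \<tau> F u1 W1 K1 p1 h1" and s2: "integrated_solution T G \<tau> F u2 W2 K2 p2 h2"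
    and \<kappa>: "\<kappa> > 0" "AE z in lborel. z \<in> {0<..<T} \<times> G \<longrightarrow> h1 z \<in> sym_tensors_ge \<kappa>"
    and W0: "AE x in lebesgue_on G. W1 0 x = W2 0 x" and K0: "AE x in lebesgue_on G. K1 0 x = K2 0 x"
    and t: "0 \<le> t" "t < T"
  shows "AE x in lebesgue_on G. W1 t x = W2 t x"
proof -
  have Gb: "G \<in> sets borel" using G by auto
  define W where "W t x = W1 t x - W2 t x" for t x
  define K where "K t x = K1 t x - K2 t x" for t x
  define p where "p z = p1 z - p2 z" for z
  define \<delta> where "\<delta> z = h1 z - h2 z" for z
  define q where "q z = tensor_app (h1 z) (p1 z) - tensor_app (h2 z) (p2 z)" for z
  define R where "R z = relaxation G \<tau> F p1 h1 z - relaxation G \<tau> F p2 h2 z" for z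
  note lin = bounded_slices_linear[OF G(2), of _ _ 1 "-1", simplified]
  have p: "bounded_slices G p" and \<delta>: "bounded_slices G \<delta>" and q: "bounded_slices G q" and R: "bounded_slices G R"
    unfolding p_def[abs_def] \<delta>_def[abs_def] q_def[abs_def] R_def[abs_def]
    by (intro lin gradient_slices[OF s1] gradient_slices[OF s2] tensor_slices[OF s1] tensor_slices[OF s2] flux_slices[OF s1] flux_slices[OF s2]
        relaxation_slices[OF s1 F Gb] relaxation_slices[OF s2 F Gb])+
  have p0: "p z = 0" and q0: "q z = 0" if "z \<notin> {0<..<T} \<times> G" for z
    using representatives_zero_outside[OF s1 that] representatives_zero_outside[OF s2 that]
    by (simp_all add: p_def q_def bounded_bilinear.zero_right[OF bounded_bilinear_tensor_app])
  have W: "W t \<in> L2_space G" if "t \<in> {0..T}" for t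
    using L2_space_linear[OF solution_in_L2[OF s1 that] solution_in_L2[OF s2 that], of 1 "-1"] by (simp add: W_def[abs_def])
  have Kl: "K t \<in> Linf_space G sym_tensors" if "t \<in> {0..T}" for t
    using Linf_space_linear[OF subspace_sym_tensors tensor_in_Linf[OF s1 that] tensor_in_Linf[OF s2 that], of 1 "-1"] by (simp add: K_def[abs_def])
  have pm: "p \<in> borel_measurable borel" "bounded (range p)"
    using p by (auto simp: bounded_slices_def)
  have p_slice: "(\<lambda>x. p (t, x)) \<in> borel_measurable borel" "bounded (range (\<lambda>x. p (t, x)))" for t
  proof -
    have [measurable]: "p \<in> borel_measurable borel" by (rule pm)
    show "(\<lambda>x. p (t, x)) \<in> borel_measurable borel" by measurable
    show "bounded (range (\<lambda>x. p (t, x)))"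
      using pm(2) by (rule bounded_subset) auto
  qed
  have snd_m: "(snd :: real \<times> (real^'d) \<Rightarrow> real^'d) \<in> borel_measurable borel"
    by (intro borel_measurable_continuous_onI continuous_intros)
  have comp_snd: "(\<lambda>z :: real \<times> (real^'d). j (snd z)) \<in> borel_measurable borel" "bounded (range (\<lambda>z :: real \<times> (real^'d). j (snd z)))"
    if "j \<in> borel_measurable borel" "bounded (range j)" for j :: "real^'d \<Rightarrow> 'x::euclidean_space"
    using measurable_compose[OF snd_m that(1)] that(2) by (auto intro: bounded_subset)

  have ae: "AE t in lborel. t \<in> {0<..<T} \<longrightarrow>
      (\<lambda>x. u1 t x - u2 t x) \<in> V_space G \<and> (AE x in lebesgue_on G. u1 t x - u2 t x = W t x) \<and>
      (AE x in lebesgue_on G. weak_jacobian G (\<lambda>x. u1 t x - u2 t x) x = p (t, x)) \<and>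
      (AE x in lebesgue_on G. K t x = \<delta> (t, x))"
    using representatives_AE[OF s1] representatives_AE[OF s2]
  proof eventually_elim
    case (elim t)
    show ?case
    proof
      assume t: "t \<in> {0<..<T}"
      have V: "u1 t \<in> V_space G" "u2 t \<in> V_space G" using elim t by auto
      then have H1: "u1 t \<in> H1_space G" "u2 t \<in> H1_space G" by (auto simp: V_space_def)
      have "(\<lambda>x. u1 t x - u2 t x) \<in> V_space G"
        using V_space_linear[OF G(1) finite_measure_lebesgue_on_bounded[OF G] V, of 1 "-1"] by simp
      moreover have "AE x in lebesgue_on G. u1 t x = W1 t x" "AE x in lebesgue_on G. u2 t x = W2 t x"
        using elim t by auto
      then have "AE x in lebesgue_on G. u1 t x - u2 t x = W t x"
        by eventually_elim (simp add: W_def)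
      moreover have "AE x in lebesgue_on G. weak_jacobian G (\<lambda>x. u1 t x - u2 t x) x = weak_jacobian G (u1 t) x - weak_jacobian G (u2 t) x"
        using weak_jacobian_eq[OF G(1) has_weak_jacobian_linear[OF G(1) H1_space_weak_jacobian(1)[OF G(1) H1(1)]
              H1_space_weak_jacobian(1)[OF G(1) H1(2)], of 1 "-1"]] by simp
      moreover have "AE x in lebesgue_on G. weak_jacobian G (u1 t) x = p1 (t, x)" "AE x in lebesgue_on G. weak_jacobian G (u2 t) x = p2 (t, x)"
        using elim t by auto
      ultimately have "(\<lambda>x. u1 t x - u2 t x) \<in> V_space G" "AE x in lebesgue_on G. u1 t x - u2 t x = W t x"
        "AE x in lebesgue_on G. weak_jacobian G (\<lambda>x. u1 t x - u2 t x) x = p (t, x)"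
        by (auto elim: eventually_elim2 eventually_mono simp: p_def)
      moreover have "AE x in lebesgue_on G. K1 t x = h1 (t, x)" "AE x in lebesgue_on G. K2 t x = h2 (t, x)"
        using elim t by auto
      then have "AE x in lebesgue_on G. K t x = \<delta> (t, x)"
        by eventually_elim (simp add: K_def \<delta>_def)
      ultimately show "(\<lambda>x. u1 t x - u2 t x) \<in> V_space G \<and> (AE x in lebesgue_on G. u1 t x - u2 t x = W t x) \<and>
        (AE x in lebesgue_on G. weak_jacobian G (\<lambda>x. u1 t x - u2 t x) x = p (t, x)) \<and>
        (AE x in lebesgue_on G. K t x = \<delta> (t, x))" by blast
    qed
  qed

  have energy: "(L2_norm G (W t))\<^sup>2 = - 2 * spacetime_integral (\<lambda>z. q z \<bullet> p z) 0 t" if t: "0 \<le> t" "t < T" for t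
  proof -
    obtain P Q where PQ: "\<And>z. norm (p z) \<le> P" "\<And>z. norm (q z) \<le> Q"
      using p q by (auto simp: bounded_slices_def bounded_iff)
    have "(L2_norm G (W t))\<^sup>2 = (L2_norm G (W 0))\<^sup>2 -
       2 * (LBINT \<rho>. indicator {0<..t} \<rho> * (LBINT x. q (\<rho>, x) \<bullet> p (\<rho>, x)))"
    proof (rule energy_identity[OF G(2) T W _ pm(1) PQ(1) p0 _ PQ(2) q0 _ t])
      show "q \<in> borel_measurable borel" using q by (simp add: bounded_slices_def)
      fix t assume t: "t \<in> {0..T}"
      show "((\<lambda>s. L2_norm G (\<lambda>x. W s x - W t x)) \<longlongrightarrow> 0) (at t within {0..T})"
      proof (rule Lim_null_comparison)
        have ev: "\<forall>\<^sub>F s in at t within {0..T}. s \<in> {0..T}"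
          by (simp add: eventually_at_filter)
        show "\<forall>\<^sub>F s in at t within {0..T}. norm (L2_norm G (\<lambda>x. W s x - W t x)) \<le>
            L2_norm G (\<lambda>x. W1 s x - W1 t x) + L2_norm G (\<lambda>x. W2 s x - W2 t x)"
          using ev
        proof eventually_elim
          case (elim s)
          have d: "(\<lambda>x. W1 s x - W1 t x) \<in> L2_space G" "(\<lambda>x. W2 t x - W2 s x) \<in> L2_space G"
            using L2_space_linear[OF solution_in_L2[OF s1 elim] solution_in_L2[OF s1 t], of 1 "-1"]
              L2_space_linear[OF solution_in_L2[OF s2 t] solution_in_L2[OF s2 elim], of 1 "-1"] by simp_all
          have "(\<lambda>x. W s x - W t x) = (\<lambda>x. (W1 s x - W1 t x) + (W2 t x - W2 s x))"
            by (simp add: W_def fun_eq_iff)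
          with L2_triangle[OF d] show ?case
            by (simp add: L2_norm_nonneg L2_norm_minus_commute[of G "W2 s"])
        qed
        show "((\<lambda>s. L2_norm G (\<lambda>x. W1 s x - W1 t x) + L2_norm G (\<lambda>x. W2 s x - W2 t x)) \<longlongrightarrow> 0) (at t within {0..T})"
          using tendsto_add[OF solution_continuous_in_L2[OF s1 t] solution_continuous_in_L2[OF s2 t]] by simp
      qed
    next
      show "AE t in lborel. t \<in> {0<..<T} \<longrightarrow> (\<forall>a b. 0 \<le> a \<longrightarrow> a \<le> b \<longrightarrow> b < T \<longrightarrow>
        (LINT x|lebesgue_on G. (W b x - W a x) \<bullet> W t x) =
        - (LBINT \<rho>. indicator {a<..b} \<rho> * (LBINT x. q (\<rho>, x) \<bullet> p (t, x))))"
        using ae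
      proof eventually_elim
        case (elim t)
        show ?case
        proof (intro impI allI)
          fix a b assume t: "t \<in> {0<..<T}" and ab: "0 \<le> a" "a \<le> b" "b < T"
          let ?v = "\<lambda>x. u1 t x - u2 t x" and ?j = "\<lambda>x. p (t, x)"
          have v: "?v \<in> V_space G" "AE x in lebesgue_on G. ?v x = W t x" "AE x in lebesgue_on G. weak_jacobian G ?v x = ?j x"
            using elim t by auto
          have vL: "?v \<in> L2_space G" using v(1) by (simp add: V_space_def H_space_def)
          have ab': "a \<in> {0..T}" "b \<in> {0..T}" "t \<in> {0..T}" using ab t by auto
          have d: "(\<lambda>x. W1 b x - W1 a x) \<in> L2_space G" "(\<lambda>x. W2 b x - W2 a x) \<in> L2_space G" "(\<lambda>x. W b x - W a x) \<in> L2_space G"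
            using L2_space_linear[OF solution_in_L2[OF s1 ab'(2)] solution_in_L2[OF s1 ab'(1)], of 1 "-1"]
              L2_space_linear[OF solution_in_L2[OF s2 ab'(2)] solution_in_L2[OF s2 ab'(1)], of 1 "-1"]
              L2_space_linear[OF W[OF ab'(2)] W[OF ab'(1)], of 1 "-1"] by simp_all
          have "(LINT x|lebesgue_on G. (W b x - W a x) \<bullet> W t x) = (LINT x|lebesgue_on G. (W b x - W a x) \<bullet> ?v x)"
            using v(2) d(3) W[OF ab'(3)] vL
            by (intro integral_cong_AE borel_measurable_inner) (auto simp: L2_space_def elim: eventually_mono)
          also have "\<dots> = (LINT x|lebesgue_on G. (W1 b x - W1 a x) \<bullet> ?v x - (W2 b x - W2 a x) \<bullet> ?v x)"
            by (intro Bochner_Integration.integral_cong refl) (simp add: W_def inner_diff_left)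
          also have "\<dots> = (LINT x|lebesgue_on G. (W1 b x - W1 a x) \<bullet> ?v x) - (LINT x|lebesgue_on G. (W2 b x - W2 a x) \<bullet> ?v x)"
            by (intro Bochner_Integration.integral_diff L2_space_inner d vL)
          also have "\<dots> = - (1 * spacetime_integral (\<lambda>z. tensor_app (h1 z) (p1 z) \<bullet> ?j (snd z)) a b +
              (- 1) * spacetime_integral (\<lambda>z. tensor_app (h2 z) (p2 z) \<bullet> ?j (snd z)) a b)"
            using momentum_equation_spacetime[OF s1 v(1) p_slice v(3) ab] momentum_equation_spacetime[OF s2 v(1) p_slice v(3) ab] by simp
          also have "\<dots> = - spacetime_integral (\<lambda>z. 1 * (tensor_app (h1 z) (p1 z) \<bullet> ?j (snd z)) + (- 1) * (tensor_app (h2 z) (p2 z) \<bullet> ?j (snd z))) a b"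
            by (subst spacetime_integral_linear[OF G(2)])
               (intro bounded_slices_inner[OF G(2)] flux_slices[OF s1] flux_slices[OF s2] comp_snd p_slice refl)+
          also have "\<dots> = - (LBINT \<rho>. indicator {a<..b} \<rho> * (LBINT x. q (\<rho>, x) \<bullet> p (t, x)))"
            by (simp add: spacetime_integral_def q_def inner_diff_left)
          finally show "(LINT x|lebesgue_on G. (W b x - W a x) \<bullet> W t x) =
            - (LBINT \<rho>. indicator {a<..b} \<rho> * (LBINT x. q (\<rho>, x) \<bullet> p (t, x)))" .
        qed
      qed
    qed
    moreover have "L2_norm G (W 0) = L2_norm G (\<lambda>x. 0 :: real^'k)"
    proof (rule L2_norm_cong_AE)
      show "W 0 \<in> L2_space G" using W T by simp
      then show "(\<lambda>x. 0 :: real^'k) \<in> L2_space G"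
        using L2_space_linear[of "W 0" G "W 0" 0 0] by simp
      show "AE x in lebesgue_on G. W 0 x = 0"
        using W0 by eventually_elim (simp add: W_def)
    qed
    then have "L2_norm G (W 0) = 0" by (simp add: L2_norm_def)
    ultimately show ?thesis by (simp add: spacetime_integral_def)
  qed

  note slices2 = bounded_slices_norm2[OF G(2) p] bounded_slices_norm2[OF G(2) \<delta>]
  define Y where "Y t = spacetime_integral (\<lambda>z. (norm (p z))\<^sup>2) 0 t" for t
  define Z where "Z t = spacetime_integral (\<lambda>z. (norm (\<delta> z))\<^sup>2) 0 t" for t
  have Y0: "Y t \<ge> 0" and Z0: "Z t \<ge> 0" for t
    unfolding Y_def Z_def by (rule spacetime_integral_nonneg[OF G(2)]; simp)+
  obtain M where M: "\<And>z. norm (p2 z) \<le> M"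
    using gradient_slices[OF s2] by (auto simp: bounded_slices_def bounded_iff)

  have W_le: "(L2_norm G (W t))\<^sup>2 + \<kappa> * Y t \<le> M\<^sup>2 / \<kappa> * Z t" if t: "0 \<le> t" "t < T" for t
  proof -
    have "\<kappa> / 2 * Y t + (- (M\<^sup>2 / (2 * \<kappa>))) * Z t \<le> spacetime_integral (\<lambda>z. q z \<bullet> p z) 0 t"
      unfolding Y_def Z_def spacetime_integral_linear[OF G(2) slices2, symmetric]
    proof (rule spacetime_integral_mono[OF G(2)])
      show "bounded_slices G (\<lambda>z. \<kappa> / 2 * (norm (p z))\<^sup>2 + (- (M\<^sup>2 / (2 * \<kappa>))) * (norm (\<delta> z))\<^sup>2)"
        using bounded_slices_linear[OF G(2) slices2] by (simp only: real_scaleR_def)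
      show "bounded_slices G (\<lambda>z. q z \<bullet> p z)"
        by (rule bounded_slices_inner[OF G(2) q pm])
      show "AE z in lborel. \<kappa> / 2 * (norm (p z))\<^sup>2 + (- (M\<^sup>2 / (2 * \<kappa>))) * (norm (\<delta> z))\<^sup>2 \<le> q z \<bullet> p z"
        using \<kappa>(2)
      proof eventually_elim
        case (elim z)
        show ?case
        proof (cases "z \<in> {0<..<T} \<times> G")
          case True
          \<comment> \<open>The mixed term is absorbed into half of the coercive term by Young's inequality.\<close>
          then have coer: "tensor_app (h1 z) (p z) \<bullet> p z \<ge> \<kappa> * (norm (p z))\<^sup>2"
            using elim by (simp add: sym_tensors_ge_def power2_norm_eq_inner)
          have "q z = tensor_app (h1 z) (p z) + tensor_app (\<delta> z) (p2 z)"
            by (simp add: q_def p_def \<delta>_def bounded_bilinear.diff_left[OF bounded_bilinear_tensor_app]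
                bounded_bilinear.diff_right[OF bounded_bilinear_tensor_app])
          then have split: "q z \<bullet> p z = tensor_app (h1 z) (p z) \<bullet> p z + tensor_app (\<delta> z) (p2 z) \<bullet> p z"
            by (simp add: inner_add_left)
          have "\<bar>tensor_app (\<delta> z) (p2 z) \<bullet> p z\<bar> \<le> norm (tensor_app (\<delta> z) (p2 z)) * norm (p z)"
            by (rule Cauchy_Schwarz_ineq2)
          also have "\<dots> \<le> (norm (\<delta> z) * M) * norm (p z)"
            using M[of z] by (intro mult_right_mono order_trans[OF norm_tensor_app_le] mult_left_mono) auto
          also have "\<dots> \<le> \<kappa> / 2 * (norm (p z))\<^sup>2 + M\<^sup>2 / (2 * \<kappa>) * (norm (\<delta> z))\<^sup>2"
          proof -
            have "0 \<le> (\<kappa> * norm (p z) - M * norm (\<delta> z))\<^sup>2 / (2 * \<kappa>)"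
              using \<kappa>(1) by simp
            also have "\<dots> = \<kappa> / 2 * (norm (p z))\<^sup>2 + M\<^sup>2 / (2 * \<kappa>) * (norm (\<delta> z))\<^sup>2 - (norm (\<delta> z) * M) * norm (p z)"
              using \<kappa>(1) by (simp add: power2_diff power_mult_distrib field_simps) (simp add: power2_eq_square algebra_simps)
            finally show ?thesis by simp
          qed
          finally have "tensor_app (\<delta> z) (p2 z) \<bullet> p z \<ge> - (\<kappa> / 2 * (norm (p z))\<^sup>2 + M\<^sup>2 / (2 * \<kappa>) * (norm (\<delta> z))\<^sup>2)"
            by linarith
          with coer show ?thesis unfolding split by simp
        next
          case False
          then show ?thesis
            using p0 q0 \<kappa>(1) by simp
        qed
      qed
    qed
    then have "\<kappa> * Y t - M\<^sup>2 / \<kappa> * Z t \<le> - (L2_norm G (W t))\<^sup>2"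
      using energy[OF t] by (simp add: field_simps)
    then show ?thesis by simp
  qed

  have K_le: "(L2_norm G (K t))\<^sup>2 \<le> T * (2 / \<tau>\<^sup>2 * (L\<^sup>2 * Y t + Z t))" if t: "0 \<le> t" "t < T" for t
  proof -
    have tT: "t \<in> {0..T}" "0 \<in> {0..T}" using t by auto
    obtain MR where MR: "\<And>z. norm (R z) \<le> MR"
      using R by (auto simp: bounded_slices_def bounded_iff)
    let ?B = "Linf_norm G (K t)"
    have "(L2_norm G (K t))\<^sup>2 \<le> t * (LBINT \<rho>. indicator {0<..t} \<rho> * (LBINT x. (norm (R (\<rho>, x)))\<^sup>2))"
    proof (rule L2_norm_time_integral_le[OF Gb G(2) _ Linf_norm_AE[OF Kl[OF tT(1)]] Linf_norm_nonneg[OF Kl[OF tT(1)]] _ MR _ _ t(1)])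
      show "K t \<in> borel_measurable (lebesgue_on G)"
        using Kl[OF tT(1)] by (simp add: Linf_space_def)
      show "R \<in> borel_measurable borel" "\<And>r x. x \<notin> G \<Longrightarrow> R (r, x) = 0"
        using R by (auto simp: bounded_slices_def)
      fix \<xi> :: "real^'d \<Rightarrow> ('k, 'd) tensor"
      assume \<xi>: "\<xi> \<in> borel_measurable borel" "\<And>x. norm (\<xi> x) \<le> ?B"
      have \<xi>b: "bounded (range \<xi>)" using \<xi>(2) by (auto simp: bounded_iff)
      have \<xi>G: "\<xi> \<in> borel_measurable (lebesgue_on G)"
        using \<xi>(1) by (intro measurable_restrict_space1 borel_measurable_lebesgueI)
      have Kd: "(\<lambda>x. K1 t x - K1 0 x) \<in> Linf_space G sym_tensors" "(\<lambda>x. K2 t x - K2 0 x) \<in> Linf_space G sym_tensors"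
        using Linf_space_linear[OF subspace_sym_tensors tensor_in_Linf[OF s1 tT(1)] tensor_in_Linf[OF s1 tT(2)], of 1 "-1"]
          Linf_space_linear[OF subspace_sym_tensors tensor_in_Linf[OF s2 tT(1)] tensor_in_Linf[OF s2 tT(2)], of 1 "-1"] by simp_all
      note Kint = Linf_inner_bound(1)[OF finite_measure_lebesgue_on_bounded[OF G] Kd(1) \<xi>G \<xi>(2)]
        Linf_inner_bound(1)[OF finite_measure_lebesgue_on_bounded[OF G] Kd(2) \<xi>G \<xi>(2)]
      have "(LINT x|lebesgue_on G. K t x \<bullet> \<xi> x) = (LINT x|lebesgue_on G. (K1 t x - K1 0 x) \<bullet> \<xi> x - (K2 t x - K2 0 x) \<bullet> \<xi> x)"
      proof (rule integral_cong_AE)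
        show "AE x in lebesgue_on G. K t x \<bullet> \<xi> x = (K1 t x - K1 0 x) \<bullet> \<xi> x - (K2 t x - K2 0 x) \<bullet> \<xi> x"
          using K0 by eventually_elim (simp add: K_def inner_diff_left)
        show "(\<lambda>x. K t x \<bullet> \<xi> x) \<in> borel_measurable (lebesgue_on G)"
          using Kl[OF tT(1)] \<xi>G by (intro borel_measurable_inner) (auto simp: Linf_space_def)
        show "(\<lambda>x. (K1 t x - K1 0 x) \<bullet> \<xi> x - (K2 t x - K2 0 x) \<bullet> \<xi> x) \<in> borel_measurable (lebesgue_on G)"
          using Kint by (intro borel_measurable_diff borel_measurable_integrable)
      qed
      also have "\<dots> = (LINT x|lebesgue_on G. (K1 t x - K1 0 x) \<bullet> \<xi> x) - (LINT x|lebesgue_on G. (K2 t x - K2 0 x) \<bullet> \<xi> x)"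
        using Kint by (intro Bochner_Integration.integral_diff)
      also have "\<dots> = 1 * spacetime_integral (\<lambda>z. relaxation G \<tau> F p1 h1 z \<bullet> \<xi> (snd z)) 0 t
          + (- 1) * spacetime_integral (\<lambda>z. relaxation G \<tau> F p2 h2 z \<bullet> \<xi> (snd z)) 0 t"
        using tensor_equation_spacetime[OF s1 \<xi>(1) \<xi>b _ t] tensor_equation_spacetime[OF s2 \<xi>(1) \<xi>b _ t] by simp
      also have "\<dots> = spacetime_integral (\<lambda>z. 1 * (relaxation G \<tau> F p1 h1 z \<bullet> \<xi> (snd z)) + (- 1) * (relaxation G \<tau> F p2 h2 z \<bullet> \<xi> (snd z))) 0 t"
        by (rule spacetime_integral_linear[OF G(2), symmetric])
           (intro bounded_slices_inner[OF G(2)] relaxation_slices[OF s1 F Gb] relaxation_slices[OF s2 F Gb] comp_snd \<xi>(1) \<xi>b)+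
      also have "\<dots> = (LBINT \<rho>. indicator {0<..t} \<rho> * (LBINT x. R (\<rho>, x) \<bullet> \<xi> x))"
        by (simp add: spacetime_integral_def R_def inner_diff_left)
      finally show "(LINT x|lebesgue_on G. K t x \<bullet> \<xi> x) = (LBINT \<rho>. indicator {0<..t} \<rho> * (LBINT x. R (\<rho>, x) \<bullet> \<xi> x))" .
    qed
    also have "\<dots> = t * spacetime_integral (\<lambda>z. (norm (R z))\<^sup>2) 0 t"
      by (simp add: spacetime_integral_def)
    also have "\<dots> \<le> T * spacetime_integral (\<lambda>z. (norm (R z))\<^sup>2) 0 t"
      using t spacetime_integral_nonneg[OF G(2), of "\<lambda>z. (norm (R z))\<^sup>2"] by (intro mult_right_mono) auto
    also have "\<dots> \<le> T * (2 / \<tau>\<^sup>2 * L\<^sup>2 * Y t + 2 / \<tau>\<^sup>2 * Z t)"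
    proof (intro mult_left_mono)
      show "spacetime_integral (\<lambda>z. (norm (R z))\<^sup>2) 0 t \<le> 2 / \<tau>\<^sup>2 * L\<^sup>2 * Y t + 2 / \<tau>\<^sup>2 * Z t"
        unfolding Y_def Z_def spacetime_integral_linear[OF G(2) slices2, symmetric]
      proof (rule spacetime_integral_mono[OF G(2) bounded_slices_norm2[OF G(2) R]])
        show "bounded_slices G (\<lambda>z. 2 / \<tau>\<^sup>2 * L\<^sup>2 * (norm (p z))\<^sup>2 + 2 / \<tau>\<^sup>2 * (norm (\<delta> z))\<^sup>2)"
          using bounded_slices_linear[OF G(2) slices2] by (simp only: real_scaleR_def)
        show "AE z in lborel. (norm (R z))\<^sup>2 \<le> 2 / \<tau>\<^sup>2 * L\<^sup>2 * (norm (p z))\<^sup>2 + 2 / \<tau>\<^sup>2 * (norm (\<delta> z))\<^sup>2"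
        proof (rule AE_I2)
          fix z
          have "norm (R z) \<le> 1 / \<tau> * (L * norm (p z) + norm (\<delta> z))"
          proof -
            have R_eq: "R z = (indicator G (snd z) / \<tau>) *\<^sub>R ((F (p1 z) - F (p2 z)) - \<delta> z)"
              by (simp add: R_def relaxation_def \<delta>_def scaleR_diff_right)
            have "norm (F (p1 z) - F (p2 z)) \<le> L * norm (p z)"
              using lipschitz_onD[OF F, of "p1 z" "p2 z"] by (simp add: dist_norm p_def)
            then have "norm ((F (p1 z) - F (p2 z)) - \<delta> z) \<le> L * norm (p z) + norm (\<delta> z)"
              using norm_triangle_ineq4[of "F (p1 z) - F (p2 z)" "\<delta> z"] by linarith
            then show ?thesis
              unfolding R_eq norm_scaleR using \<tau> by (intro mult_mono) (auto simp: indicator_def)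
          qed
          then have "(norm (R z))\<^sup>2 \<le> (1 / \<tau> * (L * norm (p z) + norm (\<delta> z)))\<^sup>2"
            by (intro power_mono) auto
          also have "\<dots> = 1 / \<tau>\<^sup>2 * (L * norm (p z) + norm (\<delta> z))\<^sup>2"
            by (simp add: power_mult_distrib power_divide)
          also have "\<dots> \<le> 1 / \<tau>\<^sup>2 * (2 * L\<^sup>2 * (norm (p z))\<^sup>2 + 2 * (norm (\<delta> z))\<^sup>2)"
          proof (intro mult_left_mono)
            have "0 \<le> (L * norm (p z) - norm (\<delta> z))\<^sup>2" by simp
            then show "(L * norm (p z) + norm (\<delta> z))\<^sup>2 \<le> 2 * L\<^sup>2 * (norm (p z))\<^sup>2 + 2 * (norm (\<delta> z))\<^sup>2"
              unfolding power2_sum power2_diff power_mult_distrib by linarith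
          qed simp
          also have "\<dots> = 2 / \<tau>\<^sup>2 * L\<^sup>2 * (norm (p z))\<^sup>2 + 2 / \<tau>\<^sup>2 * (norm (\<delta> z))\<^sup>2"
            by (simp add: distrib_left)
          finally show "(norm (R z))\<^sup>2 \<le> 2 / \<tau>\<^sup>2 * L\<^sup>2 * (norm (p z))\<^sup>2 + 2 / \<tau>\<^sup>2 * (norm (\<delta> z))\<^sup>2" .
        qed
      qed
    qed (use T in simp)
    also have "\<dots> = T * (2 / \<tau>\<^sup>2 * (L\<^sup>2 * Y t + Z t))"
      by (simp add: distrib_left)
    finally show ?thesis .
  qed

  define C where "C = T * (2 / \<tau>\<^sup>2 * (L\<^sup>2 * (M\<^sup>2 / \<kappa>\<^sup>2) + 1))"
  have C: "C > 0"
    using T \<tau> unfolding C_def by (intro mult_pos_pos add_nonneg_pos) auto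
  have K_Z: "(L2_norm G (K t))\<^sup>2 \<le> C * Z t" if t: "0 \<le> t" "t < T" for t
  proof -
    have "\<kappa> * Y t \<le> M\<^sup>2 / \<kappa> * Z t"
      using W_le[OF t] zero_le_power2[of "L2_norm G (W t)"] by linarith
    then have "Y t \<le> M\<^sup>2 / \<kappa>\<^sup>2 * Z t"
      using \<kappa>(1) by (simp add: field_simps power2_eq_square)
    then have "L\<^sup>2 * Y t + Z t \<le> L\<^sup>2 * (M\<^sup>2 / \<kappa>\<^sup>2 * Z t) + Z t"
      by (intro add_right_mono mult_left_mono) auto
    then have "T * (2 / \<tau>\<^sup>2 * (L\<^sup>2 * Y t + Z t)) \<le> T * (2 / \<tau>\<^sup>2 * (L\<^sup>2 * (M\<^sup>2 / \<kappa>\<^sup>2 * Z t) + Z t))"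
      using T by (intro mult_left_mono) auto
    also have "\<dots> = C * Z t"
      by (simp add: C_def algebra_simps)
    finally show ?thesis using K_le[OF t] by linarith
  qed

  define \<beta> where "\<beta> \<rho> = (LBINT x. (norm (\<delta> (\<rho>, x)))\<^sup>2)" for \<rho>
  have \<beta>_meas: "\<beta> \<in> borel_measurable borel"
    unfolding \<beta>_def[abs_def] by (rule bounded_slices_integrals(2)[OF G(2) slices2(2)])
  obtain D where D: "\<And>\<rho>. \<bar>\<beta> \<rho>\<bar> \<le> D"
    using bounded_slices_integrals(3)[OF G(2) slices2(2)] unfolding \<beta>_def by blast
  have \<beta>0: "\<beta> \<rho> \<ge> 0" for \<rho> unfolding \<beta>_def by simp
  have Z_eq: "Z t = (LBINT \<rho>. indicator {0<..t} \<rho> * \<beta> \<rho>)" for t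
    by (simp add: Z_def spacetime_integral_def \<beta>_def)
  \<comment> \<open>The constant extension makes \<open>Z\<close> measurable on the whole line.\<close>
  define Z' where "Z' t = Z (max 0 (min T t))" for t
  have Z_cont: "continuous_on {0..T} Z"
    unfolding Z_eq[abs_def] by (rule continuous_on_integral_Ioc[OF \<beta>_meas D])
  have Z'_meas: "Z' \<in> borel_measurable borel"
    unfolding Z'_def using T
    by (intro borel_measurable_continuous_onI continuous_on_compose2[OF Z_cont] continuous_intros) auto
  have Z'_eq: "Z' t = Z t" if "t \<in> {0..T}" for t
    using that by (simp add: Z'_def)
  have "bounded (Z ` {0..T})"
    by (intro compact_imp_bounded compact_continuous_image Z_cont) auto
  then obtain BZ where BZ: "\<forall>t\<in>{0..T}. \<bar>Z t\<bar> \<le> BZ"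
    by (auto simp: bounded_real)
  have Z'_bound: "\<bar>Z' t\<bar> \<le> BZ" for t
    unfolding Z'_def using BZ T by auto
  have \<beta>_K: "AE \<rho> in lborel. \<rho> \<in> {0<..<T} \<longrightarrow> \<beta> \<rho> \<le> C * Z' \<rho>"
    using ae
  proof eventually_elim
    case (elim \<rho>)
    show ?case
    proof
      assume \<rho>: "\<rho> \<in> {0<..<T}"
      then have K\<delta>: "AE x in lebesgue_on G. K \<rho> x = \<delta> (\<rho>, x)" using elim by auto
      have [measurable]: "\<delta> \<in> borel_measurable borel" using \<delta> by (simp add: bounded_slices_def)
      have "(L2_norm G (K \<rho>))\<^sup>2 = \<beta> \<rho>"
        unfolding L2_norm_power2 \<beta>_def
      proof (rule integral_lebesgue_on_eq_lborel[OF Gb])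
        show "AE x in lebesgue_on G. (norm (K \<rho> x))\<^sup>2 = (norm (\<delta> (\<rho>, x)))\<^sup>2"
          using K\<delta> by eventually_elim simp
      qed (use \<delta> in \<open>auto simp: bounded_slices_def\<close>)
      then show "\<beta> \<rho> \<le> C * Z' \<rho>"
        using K_Z[of \<rho>] \<rho> by (simp add: Z'_eq)
    qed
  qed
  have Z_gronwall: "Z' t \<le> C * (LBINT r. indicator {0<..t} r * Z' r)" if t: "0 \<le> t" "t < T" for t
  proof -
    have "Z' t = (LBINT \<rho>. indicator {0<..t} \<rho> * \<beta> \<rho>)"
      using t by (simp add: Z'_eq Z_eq)
    also have "\<dots> \<le> (LBINT \<rho>. C * (indicator {0<..t} \<rho> * Z' \<rho>))"
    proof (rule integral_mono_AE)
      show "integrable lborel (\<lambda>\<rho>. indicator {0<..t} \<rho> * \<beta> \<rho>)"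
        by (rule integrable_bounded_Ioc[OF \<beta>_meas D])
      show "integrable lborel (\<lambda>\<rho>. C * (indicator {0<..t} \<rho> * Z' \<rho>))"
        by (intro integrable_mult_right integrable_bounded_Ioc[OF Z'_meas Z'_bound])
      show "AE \<rho> in lborel. indicator {0<..t} \<rho> * \<beta> \<rho> \<le> C * (indicator {0<..t} \<rho> * Z' \<rho>)"
        using \<beta>_K by eventually_elim (use t in \<open>auto simp: indicator_def\<close>)
    qed
    finally show ?thesis by simp
  qed
  have Z_zero: "Z t = 0"
  proof -
    have "Z' t = 0"
      by (rule gronwall_zero[OF Z'_meas _ _ C Z_gronwall t, of BZ])
         (simp add: Z'_def Z0, rule abs_le_D1[OF Z'_bound])
    then show ?thesis using t by (simp add: Z'_eq)
  qed
  have "(L2_norm G (W t))\<^sup>2 \<le> 0"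
  proof -
    have "0 \<le> \<kappa> * Y t" using Y0[of t] \<kappa>(1) by simp
    moreover have "(L2_norm G (W t))\<^sup>2 + \<kappa> * Y t \<le> 0"
      using W_le[OF t] by (simp add: Z_zero)
    ultimately show ?thesis by linarith
  qed
  then have "L2_norm G (W t) = 0" by simp
  then have "AE x in lebesgue_on G. W t x = 0"
    using W[of t] t by (intro L2_norm_eq_0D) auto
  then show ?thesis
    by eventually_elim (simp add: W_def)
qed

theorem theorem15:
  fixes G :: "(real^'d::finite) set"
    and \<tau> T c :: real
    and F :: "('k::finite, 'd) matr \<Rightarrow> ('k, 'd) tensor"
    and DF :: "('k, 'd) matr \<Rightarrow> ('k, 'd) tensor^'d^'k"
    and u0 :: "real^'d \<Rightarrow> real^'k"
    and H0 :: "real^'d \<Rightarrow> ('k, 'd) tensor"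
    and u1 u2 :: "real \<Rightarrow> real^'d \<Rightarrow> real^'k"
    and H1 H2 :: "real \<Rightarrow> real^'d \<Rightarrow> ('k, 'd) tensor"
  assumes "open G" and "connected G" and "bounded G" and "G \<noteq> {}"
    and "\<tau> > 0" and "T > 0" and "c > 0"
    and "\<And>D. F D \<in> sym_tensors_ge 0"
    and "\<exists>L. L-lipschitz_on UNIV F"
    and "has_weak_jacobian_matr F DF"
    and "AE D in lebesgue. norm (F D) \<le> c"
    and "AE D in lebesgue. norm (DF D) \<le> c"
    and "u0 \<in> H_space G"
    and "H0 \<in> Linf_space G sym_tensors"
    and "weak_solution T G \<tau> F u0 H0 u1 H1"
    and "weak_solution T G \<tau> F u0 H0 u2 H2"
    and "bounded_gradient T G u1"
    and "bounded_gradient T G u2"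
  shows "AE (t, x) in lebesgue_on ({0<..<T} \<times> G). u1 t x = u2 t x"
proof -
  let ?\<Omega> = "{0<..<T} \<times> G"
  have G: "open G" "bounded G" and T: "T > 0" and \<tau>: "\<tau> > 0" by fact+
  have Gb: "G \<in> sets borel" using G by auto
  have \<Omega>: "?\<Omega> \<in> sets borel" using Gb by (intro borel_Times) auto
  have T0: "0 \<in> {0..T}" using T by simp
  obtain L where F: "L-lipschitz_on UNIV F" using assms(9) by blast
  obtain W1 K1 p1 h1 \<kappa> where s1: "integrated_solution T G \<tau> F u1 W1 K1 p1 h1" and \<kappa>: "\<kappa> > 0"
    "AE z in lborel. z \<in> ?\<Omega> \<longrightarrow> h1 z \<in> sym_tensors_ge \<kappa>"
    and W1: "L2_norm G (\<lambda>x. W1 0 x - u0 x) = 0" and K1: "Linf_norm G (\<lambda>x. K1 0 x - H0 x) = 0"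
    by (rule weak_solution_integrated[OF G T \<tau> F assms(15,17)]) (rule that; assumption)
  obtain W2 K2 p2 h2 where s2: "integrated_solution T G \<tau> F u2 W2 K2 p2 h2"
    and W2: "L2_norm G (\<lambda>x. W2 0 x - u0 x) = 0" and K2: "Linf_norm G (\<lambda>x. K2 0 x - H0 x) = 0"
    by (rule weak_solution_integrated[OF G T \<tau> F assms(16,18)]) (rule that; assumption)

  have W_init: "AE x in lebesgue_on G. W 0 x = u0 x"
    if "integrated_solution T G \<tau> F u W K p h" "L2_norm G (\<lambda>x. W 0 x - u0 x) = 0" for u W K p h
  proof -
    have "(\<lambda>x. W 0 x - u0 x) \<in> L2_space G"
      using L2_space_linear[OF solution_in_L2[OF that(1) T0], of u0 1 "-1"] assms(13) by (simp add: H_space_def)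
    then have "AE x in lebesgue_on G. W 0 x - u0 x = 0"
      using that(2) by (rule L2_norm_eq_0D)
    then show ?thesis by simp
  qed
  have K_init: "AE x in lebesgue_on G. K 0 x = H0 x"
    if "integrated_solution T G \<tau> F u W K p h" "Linf_norm G (\<lambda>x. K 0 x - H0 x) = 0" for u W K p h
  proof -
    have "(\<lambda>x. K 0 x - H0 x) \<in> Linf_space G sym_tensors"
      using Linf_space_linear[OF subspace_sym_tensors tensor_in_Linf[OF that(1) T0] assms(14), of 1 "-1"] by simp
    from Linf_norm_AE[OF this] show ?thesis
      using that(2) by simp
  qed
  have W0: "AE x in lebesgue_on G. W1 0 x = W2 0 x"
    using W_init[OF s1 W1] W_init[OF s2 W2] by eventually_elim simp
  have K0: "AE x in lebesgue_on G. K1 0 x = K2 0 x"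
    using K_init[OF s1 K1] K_init[OF s2 K2] by eventually_elim simp

  have "AE t in lborel. t \<in> {0<..<T} \<longrightarrow> (AE x in lebesgue_on G. u1 t x = u2 t x)"
    using representatives_AE[OF s1] representatives_AE[OF s2]
  proof eventually_elim
    case (elim t)
    show ?case
    proof
      assume t: "t \<in> {0<..<T}"
      then have "AE x in lebesgue_on G. W1 t x = W2 t x"
        by (intro integrated_solutions_unique[OF G T \<tau> F s1 s2 \<kappa> W0 K0]) auto
      moreover have "AE x in lebesgue_on G. u1 t x = W1 t x" "AE x in lebesgue_on G. u2 t x = W2 t x"
        using elim t by auto
      ultimately show "AE x in lebesgue_on G. u1 t x = u2 t x"
        by eventually_elim simp
    qed
  qed
  note slices = this

  have meas: "(\<lambda>(t, x). u1 t x) \<in> borel_measurable (lebesgue_on ?\<Omega>)" "(\<lambda>(t, x). u2 t x) \<in> borel_measurable (lebesgue_on ?\<Omega>)"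
    using assms(15,16) by (auto simp: weak_solution_def)
  obtain U1 where U1: "U1 \<in> borel_measurable borel" "AE z in lborel. z \<in> ?\<Omega> \<longrightarrow> (case z of (t, x) \<Rightarrow> u1 t x) = U1 z"
    using borel_representative[OF \<Omega> meas(1)] by blast
  obtain U2 where U2: "U2 \<in> borel_measurable borel" "AE z in lborel. z \<in> ?\<Omega> \<longrightarrow> (case z of (t, x) \<Rightarrow> u2 t x) = U2 z"
    using borel_representative[OF \<Omega> meas(2)] by blast
  have "AE z in lborel. z \<in> ?\<Omega> \<longrightarrow> U1 z = U2 z"
  proof (rule AE_time_spaceI[OF _ Gb])
    show "{z. U1 z = U2 z} \<in> sets borel"
      using U1(1) U2(1) by measurable
    show "AE t in lborel. t \<in> {0<..<T} \<longrightarrow> (AE x in lborel. x \<in> G \<longrightarrow> U1 (t, x) = U2 (t, x))"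
      using AE_time_space[OF U1(2)] AE_time_space[OF U2(2)] slices
    proof eventually_elim
      case (elim t)
      show ?case
      proof
        assume t: "t \<in> {0<..<T}"
        have "AE x in lborel. x \<in> G \<longrightarrow> u1 t x = u2 t x"
          using elim(3) t by (simp add: AE_lborel_lebesgue_on_iff[OF Gb])
        moreover have "AE x in lborel. x \<in> G \<longrightarrow> u1 t x = U1 (t, x)" "AE x in lborel. x \<in> G \<longrightarrow> u2 t x = U2 (t, x)"
          using elim t by auto
        ultimately show "AE x in lborel. x \<in> G \<longrightarrow> U1 (t, x) = U2 (t, x)"
          by eventually_elim auto
      qed
    qed
  qed
  then have "AE z in lborel. z \<in> ?\<Omega> \<longrightarrow> (case z of (t, x) \<Rightarrow> u1 t x = u2 t x)"
    using U1(2) U2(2) by eventually_elim auto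
  then show ?thesis
    by (simp only: AE_lborel_lebesgue_on_iff[OF \<Omega>])
qed

end
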